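(* Let $K$ be the Sierpiński gasket with normalized self-similar Hausdorff measure $\mu$ and Laplacian $\Delta$, let $d_h=\frac{\ln 3}{\ln 2}$ be its Hausdorff dimension and $d_w=\frac{\ln 5}{\ln 2}$ its walk dimension. Let $W$ be a white noise on $L^2_0(K,\mu)$. If $\frac{d_h}{2d_w}<s<1-\frac{d_h}{2d_w}$, then there exists a Gaussian random field $(X(x))_{x\in K}$ which is almost surely Hölder continuous with exponent $H^-$, where $$H=s d_w-\frac{d_h}{2},$$ (that is, for every $\varepsilon\in(0,H)$ it is $(H-\varepsilon)$-Hölder continuous on $K$ with respect to $d$), and such that for every $f$ in the $L^2_0$-domain of the operator $(-\Delta)^s$, almost surely, $$\int_K (-\Delta)^s f(x)\,X(x)\,d\mu(x)=\int_K f(x)\,W(dx).$$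
   Context: Gasket and Laplacian. Let $q_0=0$, $q_1=1$, $q_2=e^{i\pi/3}$ in $\mathbb{C}\simeq\mathbb{R}^2$ and $F_i(z)=\frac12(z-q_{i-1})+q_{i-1}$ for $i=1,2,3$. The Sierpiński gasket $K$ is the unique non-empty compact set with $K=\bigcup_{i=1}^3F_i(K)$; $d(x,y)=|x-y|$ is the Euclidean distance on $K$, and $\mu$ is the Borel measure on $K$ with $\mu(F_{i_1}\circ\cdots\circ F_{i_n}(K))=3^{-n}$ for all $i_1,\dots,i_n\in\{1,2,3\}$. Put $V_0=\{q_0,q_1,q_2\}$, $V_n=\bigcup_{i_1,\dots,i_n}F_{i_1}\circ\cdots\circ F_{i_n}(V_0)$, $V_*=\bigcup_{n\ge0}V_n$, and $$\mathcal{E}_n(f,f)=\frac12\Big(\frac53\Big)^n\sum_{i_1,\dots,i_n}\sum_{x,y\in V_0}\big(f(F_{i_1}\circ\cdots\circ F_{i_n}(x))-f(F_{i_1}\circ\cdots\circ F_{i_n}(y))\big)^2 .$$ Functions $f:V_*\to\mathbb{R}$ with $\mathcal{E}(f,f):=\lim_n\mathcal{E}_n(f,f)<\infty$ extend uniquely to continuous functions on $K$; $\mathcal{F}$ is the set of these extensions. $(\mathcal{E},\mathcal{F})$ is a local regular Dirichlet form on $L^2(K,\mu)$ and $\Delta$ is its generator (so $\mathcal{E}(f,g)=-\int_K(\Delta f)g\,d\mu$). $L^2_0(K,\mu)=\{f\in L^2(K,\mu):\int_K f\,d\mu=0\}$. The operator $-\Delta$ has eigenvalues $0<\lambda_1\le\lambda_2\le\cdots$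 on $L_0^2(K,\mu)$ with an orthonormal basis $(\Phi_j)_{j\ge1}$ of $L^2_0(K,\mu)$ of continuous eigenfunctions, $\Delta\Phi_j=-\lambda_j\Phi_j$. The $L_0^2$-domain of $(-\Delta)^s$ is $\{f\in L_0^2(K,\mu):\sum_j\lambda_j^{2s}\langle f,\Phi_j\rangle^2<\infty\}$, on which $(-\Delta)^sf=\sum_j\lambda_j^s\langle f,\Phi_j\rangle\Phi_j$. White noise. A white noise on $L_0^2(K,\mu)$ is a linear map $f\mapsto W(f)=\int_K f(x)W(dx)$ from $L_0^2(K,\mu)$ into centered, jointly Gaussian real random variables on a probability space $(\Omega,\mathbb{P})$, with $\mathbb{E}(W(f)W(g))=\int_K fg\,d\mu$. The field $X$ is defined on the same probability space. *)

theory Defs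
  imports "HOL-Probability.Probability"
begin

section \<open>The gasket and its self-similar measure\<close>

definition gasket_vertex :: "nat \<Rightarrow> complex" where
  "gasket_vertex i = (if i = 0 then 0 else if i = 1 then 1 else exp (\<i> * complex_of_real (pi / 3)))"

definition gasket_map :: "nat \<Rightarrow> complex \<Rightarrow> complex" where
  "gasket_map i z = (1 / 2) * (z - gasket_vertex (i - 1)) + gasket_vertex (i - 1)"

definition gasket_words :: "nat \<Rightarrow> nat list set" where
  "gasket_words n = {w. length w = n \<and> set w \<subseteq> {1, 2, 3}}"

text \<open>For \<open>w = [i\<^sub>1, \<dots>, i\<^sub>n]\<close> this is \<open>F\<^sub>i\<^sub>1 \<circ> \<dots> \<circ> F\<^sub>i\<^sub>n\<close>; the head of the word is applied last.\<close>

definition gasket_word_map :: "nat list \<Rightarrow> complex \<Rightarrow> complex" where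
  "gasket_word_map w z = foldr gasket_map w z"

definition gasket :: "complex set" where
  "gasket = (THE K. compact K \<and> K \<noteq> {} \<and> K = (\<Union>i\<in>{1, 2, 3}. gasket_map i ` K))"

definition gasket_measure :: "complex measure" where
  "gasket_measure = (THE M. sets M = sets (restrict_space borel gasket) \<and>
     (\<forall>n. \<forall>w\<in>gasket_words n. emeasure M (gasket_word_map w ` gasket) = ennreal (1 / 3 ^ n)))"

definition gasket_dh :: real where
  "gasket_dh = ln 3 / ln 2"

definition gasket_dw :: real where
  "gasket_dw = ln 5 / ln 2"


section \<open>The Dirichlet form and the Laplacian\<close>

definition gasket_V0 :: "complex set" where
  "gasket_V0 = gasket_vertex ` {0, 1, 2}"

text \<open>
  The polarized form of the quadratic energies. Functions on \<open>K\<close> are represented by functions on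
  \<open>\<complex>\<close>, whose values off the gasket are irrelevant.
\<close>

definition gasket_energy_n :: "nat \<Rightarrow> (complex \<Rightarrow> real) \<Rightarrow> (complex \<Rightarrow> real) \<Rightarrow> real" where
  "gasket_energy_n n f g = 1 / 2 * (5 / 3) ^ n *
     (\<Sum>w\<in>gasket_words n. \<Sum>x\<in>gasket_V0. \<Sum>y\<in>gasket_V0.
        (f (gasket_word_map w x) - f (gasket_word_map w y)) *
        (g (gasket_word_map w x) - g (gasket_word_map w y)))"

text \<open>
  Finite-energy functions on \<open>V\<^sub>*\<close> are identified with their continuous extensions to the gasket; the
  energies of an extension only involve its values on \<open>V\<^sub>*\<close>. Since \<open>gasket_energy_n n f f\<close> is
  nondecreasing in \<open>n\<close>, its convergence in \<open>\<real>\<close> says that the limit is finite.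
\<close>

definition gasket_form_domain :: "(complex \<Rightarrow> real) set" where
  "gasket_form_domain =
     {f. continuous_on gasket f \<and> convergent (\<lambda>n. gasket_energy_n n f f)}"

definition gasket_energy :: "(complex \<Rightarrow> real) \<Rightarrow> (complex \<Rightarrow> real) \<Rightarrow> real" where
  "gasket_energy f g = lim (\<lambda>n. gasket_energy_n n f g)"

definition gasket_L2 :: "(complex \<Rightarrow> real) set" where
  "gasket_L2 = {f \<in> borel_measurable gasket_measure. integrable gasket_measure (\<lambda>x. (f x)\<^sup>2)}"

definition gasket_L2_0 :: "(complex \<Rightarrow> real) set" where
  "gasket_L2_0 = {f \<in> gasket_L2. (\<integral>x. f x \<partial>gasket_measure) = 0}"

definition gasket_inner :: "(complex \<Rightarrow> real) \<Rightarrow> (complex \<Rightarrow> real) \<Rightarrow> real" where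
  "gasket_inner f g = (\<integral>x. f x * g x \<partial>gasket_measure)"

text \<open>
  The graph of the generator: \<open>f\<close> (taken in its continuous version) belongs to the domain
  of \<open>\<Delta>\<close> and \<open>h\<close> is a version of \<open>\<Delta> f\<close>.
\<close>

definition gasket_laplacian :: "(complex \<Rightarrow> real) \<Rightarrow> (complex \<Rightarrow> real) \<Rightarrow> bool" where
  "gasket_laplacian f h \<longleftrightarrow> f \<in> gasket_form_domain \<and> h \<in> gasket_L2 \<and>
     (\<forall>g\<in>gasket_form_domain. gasket_energy f g = - (\<integral>x. h x * g x \<partial>gasket_measure))"

definition gasket_L2_sums :: "(nat \<Rightarrow> complex \<Rightarrow> real) \<Rightarrow> (complex \<Rightarrow> real) \<Rightarrow> bool" where
  "gasket_L2_sums u g \<longleftrightarrow>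
     (\<lambda>n. \<integral>x. (g x - (\<Sum>j<n. u j x))\<^sup>2 \<partial>gasket_measure) \<longlonglongrightarrow> 0"

text \<open>
  Indices start at \<open>0\<close>: \<open>lam j\<close> and \<open>Phi j\<close> are \<open>\<lambda>\<^sub>j\<^sub>+\<^sub>1\<close> and \<open>\<Phi>\<^sub>j\<^sub>+\<^sub>1\<close>. Multiple eigenvalues are repeated.
\<close>

definition gasket_eigenbasis :: "(nat \<Rightarrow> real) \<Rightarrow> (nat \<Rightarrow> complex \<Rightarrow> real) \<Rightarrow> bool" where
  "gasket_eigenbasis lam Phi \<longleftrightarrow>
     0 < lam 0 \<and> mono lam \<and>
     (\<forall>j. Phi j \<in> gasket_L2_0 \<and> continuous_on gasket (Phi j) \<and>
          gasket_laplacian (Phi j) (\<lambda>x. - lam j * Phi j x)) \<and>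
     (\<forall>i j. gasket_inner (Phi i) (Phi j) = (if i = j then 1 else 0)) \<and>
     (\<forall>f\<in>gasket_L2_0. gasket_L2_sums (\<lambda>j x. gasket_inner f (Phi j) * Phi j x) f)"

definition frac_laplacian_domain ::
    "(nat \<Rightarrow> real) \<Rightarrow> (nat \<Rightarrow> complex \<Rightarrow> real) \<Rightarrow> real \<Rightarrow> (complex \<Rightarrow> real) set" where
  "frac_laplacian_domain lam Phi s =
     {f \<in> gasket_L2_0. summable (\<lambda>j. lam j powr (2 * s) * (gasket_inner f (Phi j))\<^sup>2)}"

text \<open>A version of \<open>(-\<Delta>)\<^sup>s f\<close>, which is determined up to \<open>\<mu>\<close>-null sets by its \<open>L\<^sup>2\<close>-expansion.\<close>

definition frac_laplacian ::
    "(nat \<Rightarrow> real) \<Rightarrow> (nat \<Rightarrow> complex \<Rightarrow> real) \<Rightarrow> real \<Rightarrow> (complex \<Rightarrow> real) \<Rightarrow> complex \<Rightarrow> real" where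
  "frac_laplacian lam Phi s f =
     (SOME g. g \<in> gasket_L2_0 \<and>
        gasket_L2_sums (\<lambda>j x. lam j powr s * gasket_inner f (Phi j) * Phi j x) g)"


section \<open>Gaussian families and white noise\<close>

text \<open>Constants count as (degenerate) Gaussian variables.\<close>

definition gaussian_rv :: "'w measure \<Rightarrow> ('w \<Rightarrow> real) \<Rightarrow> bool" where
  "gaussian_rv M Y \<longleftrightarrow> Y \<in> borel_measurable M \<and>
     ((\<exists>m. AE \<omega> in M. Y \<omega> = m) \<or>
      (\<exists>m \<sigma>. 0 < \<sigma> \<and> distributed M lborel Y (\<lambda>y. ennreal (normal_density m \<sigma> y))))"

definition gaussian_family :: "'w measure \<Rightarrow> 'i set \<Rightarrow> ('i \<Rightarrow> 'w \<Rightarrow> real) \<Rightarrow> bool" where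
  "gaussian_family M I Y \<longleftrightarrow>
     (\<forall>J c. finite J \<and> J \<subseteq> I \<longrightarrow> gaussian_rv M (\<lambda>\<omega>. \<Sum>i\<in>J. c i * Y i \<omega>))"

text \<open>
  \<open>W\<close> acts on representatives and is linear up to \<open>\<P>\<close>-null sets; that it respects \<open>\<mu>\<close>-a.e. equality
  follows from linearity and the covariance.
\<close>

definition gasket_white_noise :: "'w measure \<Rightarrow> ((complex \<Rightarrow> real) \<Rightarrow> 'w \<Rightarrow> real) \<Rightarrow> bool" where
  "gasket_white_noise M W \<longleftrightarrow> prob_space M \<and>
     (\<forall>f\<in>gasket_L2_0. \<forall>g\<in>gasket_L2_0. \<forall>a b.
        AE \<omega> in M. W (\<lambda>x. a * f x + b * g x) \<omega> = a * W f \<omega> + b * W g \<omega>) \<and>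
     gaussian_family M gasket_L2_0 W \<and>
     (\<forall>f\<in>gasket_L2_0. (\<integral>\<omega>. W f \<omega> \<partial>M) = 0) \<and>
     (\<forall>f\<in>gasket_L2_0. \<forall>g\<in>gasket_L2_0. (\<integral>\<omega>. W f \<omega> * W g \<omega> \<partial>M) = gasket_inner f g)"

definition holder_on :: "complex set \<Rightarrow> real \<Rightarrow> (complex \<Rightarrow> real) \<Rightarrow> bool" where
  "holder_on S a f \<longleftrightarrow> (\<exists>C. \<forall>x\<in>S. \<forall>y\<in>S. \<bar>f x - f y\<bar> \<le> C * dist x y powr a)"

end

theory Submission
  imports Defs
begin

text \<open>Let \<open>G\<^sub>x\<close> be the kernel \<open>\<Sum>\<^sub>j \<lambda>\<^sub>j\<^sup>-\<^sup>s \<Phi>\<^sub>j(x) \<Phi>\<^sub>j\<close> of \<open>(-\<Delta>)\<^sup>-\<^sup>s\<close>. The field is \<open>X(x) = W(G\<^sub>x)\<close>, so that an increment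
\<open>X(x) - X(y)\<close> is centred Gaussian with variance \<open>\<Sum>\<^sub>j \<lambda>\<^sub>j\<^sup>-\<^sup>2\<^sup>s (\<Phi>\<^sub>j(x) - \<Phi>\<^sub>j(y))\<^sup>2\<close>. Everything rests on
bounding this variance by a multiple of \<open>2\<^sup>-\<^sup>2\<^sup>H\<^sup>m\<close> when \<open>x\<close> and \<open>y\<close> lie in a common cell of level \<open>m\<close>
(\<open>diff_bound\<close>). Instead of heat kernel estimates, the proof uses only the self-similarity of the
energy.

Let \<open>f\<close> be a combination of eigenfunctions with \<open>\<lambda>\<^sub>j \<le> 5\<^sup>n\<close> and \<open>L\<^sup>2\<close>-norm 1. A function of energy \<open>E\<close>
oscillates on a cell of level \<open>n\<close> by at most a multiple of the square root of \<open>(3/5)\<^sup>n E\<close>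
(\<open>energy_cell_osc\<close>); averaging over the cell gives \<open>\<bar>f\<bar>\<^sup>2 \<le> C 3\<^sup>n\<close> (\<open>eigensum_sup\<close>). The same
applies to \<open>-\<Delta>f\<close>, whose norm is at most \<open>5\<^sup>n\<close>. Below level \<open>n\<close> the function \<open>f\<close> is nearly harmonic:
testing the weak equation with a tent function in a cell of level \<open>k\<close> shows that \<open>f\<close> obeys the
1/5-2/5 rule at the midpoints of the cell up to an error of order \<open>5\<^sup>-\<^sup>k sup\<bar>\<Delta>f\<bar>\<close>
(\<open>midpoint_defect\<close>). The exact rule contracts oscillations by 3/5 per level, and the errors decay
faster, so the oscillation of \<open>f\<close> on a cell of level \<open>m \<ge> n\<close> is at most a multiple of
\<open>(3/5)\<^sup>m\<^sup>-\<^sup>n 3\<^sup>n\<^sup>/\<^sup>2\<close> (\<open>eigensum_osc\<close>). By duality, the sum of \<open>(\<Phi>\<^sub>j(x) - \<Phi>\<^sub>j(y))\<^sup>2\<close> over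
\<open>\<lambda>\<^sub>j \<le> 5\<^sup>n\<close> is at most \<open>C 3\<^sup>n min(1, (9/25)\<^sup>m\<^sup>-\<^sup>n)\<close> (\<open>spectral_sum_diff\<close>). Weighting with
\<open>5\<^sup>-\<^sup>2\<^sup>s\<^sup>n\<close> and summing over \<open>n\<close> leaves two geometric series that meet at \<open>n = m\<close>. The one with \<open>n \<ge> m\<close>
converges because \<open>s > d\<^sub>h/(2 d\<^sub>w)\<close>, the one with \<open>n \<le> m\<close> is dominated by its last term because
\<open>s < 1 - d\<^sub>h/(2 d\<^sub>w)\<close>, and the common value at \<open>n = m\<close> is \<open>(3 * 5\<^sup>-\<^sup>2\<^sup>s)\<^sup>m = 2\<^sup>-\<^sup>2\<^sup>H\<^sup>m\<close>.

Paths are obtained by Kolmogorov's moment argument along the vertices of the cells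
(\<open>vertex_increments_AE\<close>): almost surely all increments along edges of level \<open>n\<close> are
\<open>O(2\<^sup>-\<^sup>\<beta>\<^sup>n)\<close> for each \<open>\<beta> < H\<close>. The harmonic splines through the vertex values then converge uniformly,
their limit is a continuous modification of the field, and its oscillation on cells is controlled.
Distances enter only at the end: two close points are joined by a third one that shares a small
cell with each of them (\<open>gasket_chain\<close>).

For the equation, put \<open>F = (-\<Delta>)\<^sup>s f\<close>. For the truncated field \<open>X\<^sub>N = \<Sum>\<^sub>j\<^sub><\<^sub>N \<lambda>\<^sub>j\<^sup>-\<^sup>s \<Phi>\<^sub>j W(\<Phi>\<^sub>j)\<close> the
integral \<open>\<integral> F X\<^sub>N d\<mu>\<close> is a partial sum of the expansion of \<open>W(f)\<close>, and the error
\<open>\<integral> \<bar>F\<bar> \<bar>X - X\<^sub>N\<bar> d\<mu>\<close> has expectation tending to 0 by Tonelli and dominated convergence, since the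
variance of \<open>X(x) - X\<^sub>N(x)\<close> is the tail of a series that is bounded uniformly in \<open>x\<close> (\<open>diag_bound\<close>).

The gasket and its measure are given by definite descriptions, so their existence and uniqueness
come first. Both are images of the address map from streams of symbols: the gasket is the closure
of its range, the measure is the image of the uniform product measure.\<close>

section \<open>Barycentric geometry of the gasket\<close>

abbreviation corner :: "nat \<Rightarrow> complex" where
  "corner i \<equiv> gasket_vertex (i - 1)"

abbreviation I3 :: "nat set" where
  "I3 \<equiv> {1, 2, 3}"

definition bary :: "nat \<Rightarrow> complex \<Rightarrow> real" where
  "bary i z = (if i = 1 then 1 - Re z - Im z / sqrt 3
     else if i = 2 then Re z - Im z / sqrt 3 else 2 * Im z / sqrt 3)"

lemma corner_simps:
  "gasket_vertex 0 = 0" "gasket_vertex (Suc 0) = 1" "gasket_vertex 2 = Complex (1/2) (sqrt 3 / 2)"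
proof -
  have "exp (\<i> * complex_of_real (pi / 3)) = Complex (1/2) (sqrt 3 / 2)"
    unfolding cis_conv_exp[symmetric] by (simp add: cis.ctr cos_60 sin_60)
  then show "gasket_vertex 2 = Complex (1/2) (sqrt 3 / 2)"
    by (simp add: gasket_vertex_def)
qed (auto simp: gasket_vertex_def)

lemma gasket_map_eq: "gasket_map i z = (z + corner i) / 2"
  by (simp add: gasket_map_def field_simps)

lemma I3_cases: "i \<in> I3 \<longleftrightarrow> i = 1 \<or> i = 2 \<or> i = 3"
  by auto

lemma bary_corner: "i \<in> I3 \<Longrightarrow> j \<in> I3 \<Longrightarrow> bary i (corner j) = (if i = j then 1 else 0)"
  unfolding I3_cases by (elim disjE) (simp_all add: bary_def corner_simps)

lemma bary_sum: "bary 1 z + bary 2 z + bary 3 z = 1"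
  by (simp add: bary_def)

lemma bary_affine: "bary i ((x + y) / 2) = (bary i x + bary i y) / 2"
  by (simp add: bary_def add_divide_distrib diff_divide_distrib)

lemma bary_gasket_map:
  assumes "i \<in> I3" "j \<in> I3"
  shows "bary j (gasket_map i z) = (bary j z + (if i = j then 1 else 0)) / 2"
  using assms by (simp only: gasket_map_eq bary_affine bary_corner) simp

lemma bary_eqI:
  assumes "\<And>i. i \<in> I3 \<Longrightarrow> bary i x = bary i y" shows "x = y"
proof -
  have "bary 2 x = bary 2 y" "bary 3 x = bary 3 y" using assms by auto
  then show ?thesis by (simp add: bary_def complex_eq_iff)
qed

lemma bary_diff_le: "\<bar>bary i x - bary i y\<bar> \<le> 2 * dist x y"
proof -
  have s: "1 \<le> sqrt 3" "sqrt 3 * sqrt 3 = 3" by auto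
  have s2: "1.7 \<le> sqrt 3" by (rule real_le_rsqrt) (simp add: power2_eq_square)
  have a: "\<bar>Re x - Re y\<bar> \<le> dist x y" "\<bar>Im x - Im y\<bar> \<le> dist x y"
    unfolding dist_norm using abs_Re_le_cmod[of "x-y"] abs_Im_le_cmod[of "x-y"] by auto
  have b: "\<bar>Im x - Im y\<bar> / sqrt 3 \<le> dist x y"
    using a(2) s by (smt (verit) divide_le_eq_1_pos frac_le abs_ge_zero div_by_1)
  define q where "q = (Im x - Im y) / sqrt 3"
  have i: "bary i x - bary i y = (if i = 1 then - (Re x - Re y) - q
     else if i = 2 then (Re x - Re y) - q else 2 * q)"
    by (simp add: bary_def q_def diff_divide_distrib)
  have c: "\<bar>q\<bar> \<le> dist x y" using b by (simp add: q_def)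
  show ?thesis unfolding i using a(1) c by auto
qed

lemma continuous_on_bary [continuous_intros]: "continuous_on S (bary i)"
  unfolding bary_def by (cases "i = 1"; cases "i = 2") (auto intro!: continuous_intros)

lemma dist_gasket_map: "dist (gasket_map i x) (gasket_map i y) = dist x y / 2"
proof -
  have "gasket_map i x - gasket_map i y = (x - y) / 2" by (simp add: gasket_map_eq field_simps)
  then show ?thesis unfolding dist_norm by (simp only: norm_divide) simp
qed

lemma inj_gasket_map: "gasket_map i x = gasket_map i y \<longleftrightarrow> x = y"
  by (simp add: gasket_map_eq)

lemma continuous_on_gasket_map [continuous_intros]: "continuous_on S (gasket_map i)"
  unfolding gasket_map_eq[abs_def] by (intro continuous_intros) auto

lemma gasket_map_corner: "gasket_map i (corner i) = corner i"
  by (simp add: gasket_map_eq)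

lemma gasket_map_junction: "gasket_map i (corner j) = gasket_map j (corner i)"
  by (simp add: gasket_map_eq add.commute)

subsection \<open>Words\<close>

lemma gasket_words_0: "gasket_words 0 = {[]}"
  by (auto simp: gasket_words_def)

lemma gasket_words_Suc: "gasket_words (Suc n) = (\<lambda>(i, w). i # w) ` (I3 \<times> gasket_words n)"
proof (intro subset_antisym subsetI)
  fix v assume "v \<in> gasket_words (Suc n)"
  then obtain i w where v: "v = i # w" "i \<in> I3" "w \<in> gasket_words n"
    by (cases v) (auto simp: gasket_words_def)
  then show "v \<in> (\<lambda>(i, w). i # w) ` (I3 \<times> gasket_words n)"
    by (intro image_eqI[of _ _ "(i, w)"]) auto
qed (auto simp: gasket_words_def)

lemma Cons_gasket_words: "i # w \<in> gasket_words (Suc n) \<longleftrightarrow> i \<in> I3 \<and> w \<in> gasket_words n"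
  by (auto simp: gasket_words_def)

lemma finite_gasket_words [simp]: "finite (gasket_words n)"
  by (induction n) (auto simp: gasket_words_0 gasket_words_Suc)

lemma sum_gasket_words_Suc:
  "(\<Sum>w\<in>gasket_words (Suc n). f w) = (\<Sum>i\<in>I3. \<Sum>w\<in>gasket_words n. f (i # w))"
proof -
  have "inj_on (\<lambda>(i, w). i # w) (I3 \<times> gasket_words n)" by (auto simp: inj_on_def)
  then show ?thesis
    unfolding gasket_words_Suc by (simp add: sum.reindex sum.cartesian_product case_prod_unfold)
qed

lemma card_gasket_words: "card (gasket_words n) = 3 ^ n"
proof (induction n)
  case (Suc n)
  have "card (gasket_words (Suc n)) = (\<Sum>w\<in>gasket_words (Suc n). 1)" by simp
  also have "\<dots> = 3 ^ Suc n" unfolding sum_gasket_words_Suc using Suc by simp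
  finally show ?case .
qed (simp add: gasket_words_0)

lemma gasket_word_map_Nil [simp]: "gasket_word_map [] z = z"
  by (simp add: gasket_word_map_def)

lemma gasket_word_map_Cons [simp]:
  "gasket_word_map (i # w) z = gasket_map i (gasket_word_map w z)"
  by (simp add: gasket_word_map_def)

lemma gasket_word_map_append: "gasket_word_map (u @ v) z = gasket_word_map u (gasket_word_map v z)"
  by (simp add: gasket_word_map_def)

lemma gasket_words_append:
  "u \<in> gasket_words m \<Longrightarrow> v \<in> gasket_words n \<Longrightarrow> u @ v \<in> gasket_words (m + n)"
  by (auto simp: gasket_words_def)

lemma dist_gasket_word_map: "dist (gasket_word_map w x) (gasket_word_map w y) = dist x y / 2 ^ length w"
  by (induction w) (auto simp: dist_gasket_map)

lemma continuous_on_gasket_word_map [continuous_intros]: "continuous_on S (gasket_word_map w)"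
proof (induction w)
  case (Cons i w)
  have "continuous_on S (gasket_map i \<circ> gasket_word_map w)"
    by (intro continuous_on_compose Cons continuous_on_gasket_map)
  then show ?case by (simp add: comp_def)
qed auto

subsection \<open>The attractor\<close>

lemma eventually_power_half_less: "(0::real) < e \<Longrightarrow> \<exists>n. D / 2 ^ n < e"
proof -
  assume e: "0 < e"
  have "(\<lambda>n. D * (1/2) ^ n) \<longlonglongrightarrow> D * 0" by (intro tendsto_intros) auto
  then have "\<forall>\<^sub>F n in sequentially. D * (1/2) ^ n < e" using e by (auto dest: order_tendstoD)
  then show ?thesis unfolding eventually_sequentially by (auto simp: power_divide)
qed

text \<open>The fixed point equation is handled for an arbitrary solution first, since uniqueness compares two
of them.\<close>

definition gasket_like :: "complex set \<Rightarrow> bool" where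
  "gasket_like K \<longleftrightarrow> compact K \<and> K \<noteq> {} \<and> K = (\<Union>i\<in>I3. gasket_map i ` K)"

lemma gasket_like_step:
  assumes "gasket_like K" "x \<in> K" obtains i y where "i \<in> I3" "y \<in> K" "x = gasket_map i y"
proof -
  have "x \<in> (\<Union>i\<in>I3. gasket_map i ` K)"
    using assms unfolding gasket_like_def by blast
  then show ?thesis using that by blast
qed

lemma gasket_like_map:
  assumes "gasket_like K" "x \<in> K" "i \<in> I3" shows "gasket_map i x \<in> K"
proof -
  have "gasket_map i x \<in> (\<Union>i\<in>I3. gasket_map i ` K)" using assms by blast
  then show ?thesis using assms(1) unfolding gasket_like_def by blast
qed

lemma gasket_like_cover:
  assumes "gasket_like K" "x \<in> K" shows "\<exists>w\<in>gasket_words n. \<exists>y\<in>K. x = gasket_word_map w y"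
  using assms(2)
proof (induction n arbitrary: x)
  case (Suc n)
  obtain i y where 1: "i \<in> I3" "y \<in> K" "x = gasket_map i y"
    using gasket_like_step[OF assms(1) Suc.prems] .
  obtain w z where 2: "w \<in> gasket_words n" "z \<in> K" "y = gasket_word_map w z" using Suc.IH[OF 1(2)] by blast
  then show ?case using 1 by (intro bexI[of _ "i # w"] bexI[of _ z]) (auto simp: Cons_gasket_words)
qed (auto simp: gasket_words_0)

lemma gasket_like_word:
  assumes "gasket_like K" "x \<in> K" "w \<in> gasket_words n" shows "gasket_word_map w x \<in> K"
  using assms(3)
proof (induction w arbitrary: n)
  case (Cons i w)
  then obtain m where "n = Suc m" by (cases n) (auto simp: gasket_words_def)
  then show ?case using Cons by (auto simp: Cons_gasket_words intro!: gasket_like_map[OF assms(1)])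
qed (simp add: assms)

text \<open>A point of \<open>K\<close> lies in cells of \<open>K\<close> of every level. The cell of \<open>L\<close> with the same word is nonempty and
at a distance of order \<open>2\<^sup>-\<^sup>n\<close>, so the point is a limit of points of the closed set \<open>L\<close>.\<close>

lemma gasket_like_subset:
  assumes K: "gasket_like K" and L: "gasket_like L" shows "K \<subseteq> L"
proof
  fix x assume x: "x \<in> K"
  obtain z where z: "z \<in> L" using L by (auto simp: gasket_like_def)
  have "bounded (K \<union> L)" using K L by (auto simp: gasket_like_def compact_imp_bounded)
  then obtain D where D: "\<And>a b. a \<in> K \<union> L \<Longrightarrow> b \<in> K \<union> L \<Longrightarrow> dist a b \<le> D"
    unfolding bounded_two_points by blast
  have "x \<in> closure L"
  proof (subst closure_approachable, intro allI impI)
    fix e :: real assume e: "e > 0"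
    obtain n where n: "D / 2 ^ n < e" using eventually_power_half_less[OF e] by blast
    obtain w y where w: "w \<in> gasket_words n" "y \<in> K" "x = gasket_word_map w y"
      using gasket_like_cover[OF K x] by blast
    have "dist (gasket_word_map w z) x = dist z y / 2 ^ n"
      using w by (simp add: dist_gasket_word_map gasket_words_def)
    also have "\<dots> \<le> D / 2 ^ n" by (intro divide_right_mono D) (use z w in auto)
    finally show "\<exists>v\<in>L. dist v x < e" using gasket_like_word[OF L z w(1)] n by force
  qed
  then show "x \<in> L" using L by (simp add: gasket_like_def compact_imp_closed)
qed

text \<open>The address map: the series is the limit of the points obtained by applying the maps of the first
\<open>n\<close> symbols to 0.\<close>

definition coding :: "nat stream \<Rightarrow> complex" where
  "coding \<omega> = (\<Sum>k. corner (\<omega> !! k) / 2 ^ Suc k)"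

lemma gasket_vertex_norm: "norm (gasket_vertex i) \<le> 1"
  by (simp add: gasket_vertex_def)

lemma coding_term_bound: "norm (corner (\<omega> !! n) / 2 ^ Suc n) \<le> (1/2) ^ Suc n"
proof -
  have "norm (corner (\<omega> !! n) / 2 ^ Suc n) = norm (corner (\<omega> !! n)) / 2 ^ Suc n"
    by (simp add: norm_divide norm_mult norm_power)
  also have "\<dots> \<le> 1 / 2 ^ Suc n" by (intro divide_right_mono gasket_vertex_norm) auto
  finally show ?thesis by (simp add: power_divide)
qed

lemma summable_coding: "summable (\<lambda>k. corner (\<omega> !! k) / 2 ^ Suc k)"
proof (rule summable_comparison_test'[of "\<lambda>k. (1/2) ^ Suc k :: real" 0])
  show "summable (\<lambda>k. (1/2) ^ Suc k :: real)" by (subst summable_Suc_iff) (auto intro: summable_geometric)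
  show "norm (corner (\<omega> !! n) / 2 ^ Suc n) \<le> (1/2) ^ Suc n" for n
    by (rule coding_term_bound)
qed

lemma coding_Stream: "coding (i ## \<omega>) = gasket_map i (coding \<omega>)"
proof -
  have "coding (i ## \<omega>) = (\<Sum>k. corner (\<omega> !! k) / 2 ^ Suc (Suc k)) + corner i / 2"
    unfolding coding_def using suminf_split_initial_segment[OF summable_coding[of "i ## \<omega>"], of 1] by simp
  also have "(\<Sum>k. corner (\<omega> !! k) / 2 ^ Suc (Suc k)) = coding \<omega> / 2"
    unfolding coding_def using suminf_divide[OF summable_coding[of \<omega>], of 2] by (simp add: mult.assoc mult.commute)
  finally show ?thesis by (simp add: gasket_map_eq add_divide_distrib)
qed

lemma norm_coding: "norm (coding \<omega>) \<le> 1"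
proof -
  have s: "(\<lambda>k. (1/2) ^ Suc k :: real) sums 1" by (rule power_half_series)
  have b: "norm (corner (\<omega> !! n) / 2 ^ Suc n) \<le> (1/2) ^ Suc n" for n
    by (rule coding_term_bound)
  have "norm (coding \<omega>) \<le> (\<Sum>k. (1/2) ^ Suc k)"
    unfolding coding_def by (rule norm_suminf_le) (use s b in \<open>auto simp: sums_iff\<close>)
  then show ?thesis using s by (simp add: sums_iff)
qed

text \<open>As \<open>corner\<close> is total, symbols outside \<open>I3\<close> act like \<open>1\<close> or \<open>3\<close>, so that all streams may be used as codes.\<close>

lemma gasket_map_clamp: "\<exists>j\<in>I3. gasket_map i = gasket_map j"
proof -
  consider "i = 0" | "i = 1" | "i = 2" | "i \<ge> 3" by linarith
  then show ?thesis
  proof cases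
    case 1 then show ?thesis by (intro bexI[of _ 1]) (auto simp: gasket_map_def fun_eq_iff)
  next
    case 4 then show ?thesis by (intro bexI[of _ 3]) (auto simp: gasket_map_def fun_eq_iff gasket_vertex_def)
  qed auto
qed

lemma range_coding: "range coding = (\<Union>i\<in>I3. gasket_map i ` range coding)"
proof (intro subset_antisym subsetI)
  fix x assume "x \<in> range coding"
  then obtain \<omega> where "x = coding (shd \<omega> ## stl \<omega>)" by auto
  then have "x = gasket_map (shd \<omega>) (coding (stl \<omega>))" by (simp only: coding_Stream)
  moreover obtain j where "j \<in> I3" "gasket_map (shd \<omega>) = gasket_map j" using gasket_map_clamp by blast
  ultimately have "x = gasket_map j (coding (stl \<omega>))" by simp
  with \<open>j \<in> I3\<close> show "x \<in> (\<Union>i\<in>I3. gasket_map i ` range coding)"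
    by (intro UN_I[of j] image_eqI[of _ _ "coding (stl \<omega>)"] rangeI)
next
  fix x assume "x \<in> (\<Union>i\<in>I3. gasket_map i ` range coding)"
  then obtain i \<omega> where "x = gasket_map i (coding \<omega>)" by blast
  then have "x = coding (i ## \<omega>)" by (simp add: coding_Stream)
  then show "x \<in> range coding" by blast
qed

lemma closure_gasket_map: "closure (gasket_map i ` S) = gasket_map i ` closure S"
proof -
  have e: "gasket_map i ` S = (+) (corner i / 2) ` ((*\<^sub>R) (1/2) ` S)" for S
    by (auto simp: gasket_map_eq image_image scaleR_conv_of_real add_divide_distrib)
  show ?thesis unfolding e by (simp add: closure_translation closure_scaleR)
qed

text \<open>Prepending a symbol to an address applies a map, which makes the range self-similar; the three maps
are homeomorphisms and commute with closure, which turns the bounded range into a compact set.\<close>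

lemma gasket_like_closure_coding: "gasket_like (closure (range coding))"
proof -
  have "bounded (range coding)" unfolding bounded_iff using norm_coding by blast
  moreover have "closure (range coding) \<noteq> {}" by simp
  moreover have "closure (range coding) = (\<Union>i\<in>I3. gasket_map i ` closure (range coding))"
  proof -
    have "closure (range coding) = closure (\<Union>i\<in>I3. gasket_map i ` range coding)"
      by (rule arg_cong[OF range_coding])
    then show ?thesis
      by (simp only: UN_insert UN_empty closure_Un closure_empty closure_gasket_map)
  qed
  ultimately show ?thesis unfolding gasket_like_def compact_closure by blast
qed

lemma gasket_like_gasket: "gasket_like gasket"
proof -
  have "gasket = (THE K. gasket_like K)" by (simp add: gasket_def gasket_like_def)
  moreover have "\<exists>!K. gasket_like K"
    using gasket_like_closure_coding gasket_like_subset by blast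
  ultimately show ?thesis using theI'[of gasket_like] by simp
qed

lemma coding_in_gasket: "coding \<omega> \<in> gasket"
  by (rule subsetD[OF gasket_like_subset[OF gasket_like_closure_coding gasket_like_gasket]],
      rule subsetD[OF closure_subset]) simp

lemma compact_gasket: "compact gasket"
  using gasket_like_gasket by (simp add: gasket_like_def)

lemma closed_gasket: "closed gasket"
  using compact_gasket by (rule compact_imp_closed)

lemma gasket_diameter: "\<exists>D. \<forall>a\<in>gasket. \<forall>b\<in>gasket. dist a b \<le> D"
  using compact_imp_bounded[OF compact_gasket] unfolding bounded_two_points by blast

lemmas gasket_step = gasket_like_step[OF gasket_like_gasket]
lemmas gasket_map_in = gasket_like_map[OF gasket_like_gasket]
lemmas gasket_cover = gasket_like_cover[OF gasket_like_gasket]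
lemmas gasket_word_map_in = gasket_like_word[OF gasket_like_gasket]

lemma corner_in_gasket: assumes "i \<in> I3" shows "corner i \<in> gasket"
proof -
  define r where "r = coding (sconst i)"
  have "sconst i = i ## sconst i" using siterate.code[of id i] by (simp only: id_apply)
  then have "coding (sconst i) = coding (i ## sconst i)" by (rule arg_cong)
  then have "r = gasket_map i r" by (simp only: coding_Stream r_def)
  then have "r = corner i" by (simp add: gasket_map_eq)
  then show ?thesis using coding_in_gasket r_def by metis
qed

text \<open>By self-similarity the minimum of a barycentric coordinate on the compact gasket is at least half
of itself.\<close>

lemma bary_nonneg: assumes "z \<in> gasket" "j \<in> I3" shows "bary j z \<ge> 0"
proof -
  have ne: "gasket \<noteq> {}" using assms by auto
  obtain m where m: "m \<in> gasket" "\<And>y. y \<in> gasket \<Longrightarrow> bary j m \<le> bary j y"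
    using continuous_attains_inf[OF compact_gasket ne continuous_on_bary] by blast
  obtain i y where y: "i \<in> I3" "y \<in> gasket" "m = gasket_map i y" using gasket_step[OF m(1)] .
  have "bary j m \<ge> bary j y / 2" using bary_gasket_map[OF y(1) assms(2)] y(3) by auto
  with m(2)[OF y(2)] have "bary j m \<ge> 0" by simp
  then show ?thesis using m(2)[OF assms(1)] by simp
qed

lemma bary_le_1: assumes "z \<in> gasket" "j \<in> I3" shows "bary j z \<le> 1"
  using bary_nonneg[OF assms(1), of 1] bary_nonneg[OF assms(1), of 2] bary_nonneg[OF assms(1), of 3]
    bary_sum[of z] assms(2) by auto

lemma bary_half: assumes "z \<in> gasket" "i \<in> I3" shows "bary i (gasket_map i z) \<ge> 1 / 2"
  using bary_nonneg[OF assms] bary_gasket_map[OF assms(2) assms(2)] by simp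

lemma bary_ge_1_imp_corner:
  assumes "x \<in> gasket" "j \<in> I3" "bary j x \<ge> 1" shows "x = corner j"
proof (rule bary_eqI)
  fix k assume k: "k \<in> I3"
  have "bary j x = 1" using assms(3) bary_le_1[OF assms(1,2)] by simp
  moreover have "k \<noteq> j \<Longrightarrow> bary k x = 0"
    using assms(3) bary_nonneg[OF assms(1), of 1] bary_nonneg[OF assms(1), of 2]
      bary_nonneg[OF assms(1), of 3] bary_sum[of x] k assms(2) by auto
  ultimately show "bary k x = bary k (corner j)" using bary_corner[OF k assms(2)] by auto
qed

text \<open>On the \<open>j\<close>-th cell the coordinate \<open>bary j\<close> is at least 1/2, on the \<open>i\<close>-th one it is half of a number
in \<open>[0, 1]\<close>. At a common point this number is 1.\<close>

lemma gasket_cells_meet: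
  assumes "x \<in> gasket" "y \<in> gasket" "i \<in> I3" "j \<in> I3" "i \<noteq> j" "gasket_map i x = gasket_map j y"
  shows "x = corner j"
proof (rule bary_ge_1_imp_corner)
  show "bary j x \<ge> 1"
    using bary_half[OF assms(2,4)] bary_gasket_map[OF assms(3,4), of x] assms(5,6) by simp
qed (use assms in auto)

subsection \<open>Close points lie in small cells with a common point\<close>

text \<open>The combinatorial substitute for \<open>\<bar>x - y\<bar> = O(2\<^sup>-\<^sup>n)\<close>: all regularity estimates are proved for
points of a common cell and only \<open>gasket_chain\<close> translates them to the Euclidean distance.\<close>

definition same_cell :: "nat \<Rightarrow> complex \<Rightarrow> complex \<Rightarrow> bool" where
  "same_cell n x y \<longleftrightarrow>
     (\<exists>w\<in>gasket_words n. \<exists>x'\<in>gasket. \<exists>y'\<in>gasket. x = gasket_word_map w x' \<and> y = gasket_word_map w y')"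

lemma same_cell_0: "x \<in> gasket \<Longrightarrow> y \<in> gasket \<Longrightarrow> same_cell 0 x y"
  by (auto simp: same_cell_def gasket_words_0)

lemma same_cell_map:
  assumes "same_cell n x y" "i \<in> I3" shows "same_cell (Suc n) (gasket_map i x) (gasket_map i y)"
proof -
  obtain w x' y' where "w \<in> gasket_words n" "x' \<in> gasket" "y' \<in> gasket"
    "x = gasket_word_map w x'" "y = gasket_word_map w y'"
    using assms(1) unfolding same_cell_def by blast
  then show ?thesis
    unfolding same_cell_def using assms(2)
    by (intro bexI[of _ "i # w"] bexI[of _ x'] bexI[of _ y']) (auto simp: Cons_gasket_words)
qed

text \<open>Follow the cells at the corner inwards until \<open>x\<close> leaves them. The number \<open>1 - bary j x\<close> doubles
when the \<open>j\<close>-th map is undone, and it is at least 1/2 once \<open>x\<close> lies in another cell.\<close>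

lemma same_cell_corner:
  assumes "j \<in> I3" "x \<in> gasket" "(1/2) ^ k \<le> 1 - bary j x"
  shows "\<exists>n. same_cell n x (corner j) \<and> (1/2) ^ Suc n \<le> 1 - bary j x"
  using assms(2,3)
proof (induction k arbitrary: x)
  case 0
  then show ?case using same_cell_0[OF 0(1) corner_in_gasket[OF assms(1)]] by (intro exI[of _ 0]) auto
next
  case (Suc k)
  obtain i x' where i: "i \<in> I3" "x' \<in> gasket" "x = gasket_map i x'" using gasket_step[OF Suc.prems(1)] .
  show ?case
  proof (cases "i = j")
    case True
    have e: "1 - bary j x = (1 - bary j x') / 2"
      using bary_gasket_map[OF i(1) assms(1), of x'] i True by (simp add: field_simps)
    then have "(1/2) ^ k \<le> 1 - bary j x'" using Suc.prems(2) by simp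
    from Suc.IH[OF i(2) this] obtain n where "same_cell n x' (corner j)" "(1/2) ^ Suc n \<le> 1 - bary j x'" by blast
    moreover from this(1) have "same_cell (Suc n) x (corner j)"
      using same_cell_map[of n x' "corner j" j] assms(1) i(3) True by (simp only: gasket_map_corner)
    ultimately show ?thesis by (intro exI[of _ "Suc n"]) (simp add: e)
  next
    case False
    then have "1/2 \<le> 1 - bary j x"
      using bary_gasket_map[OF i(1) assms(1), of x'] i bary_le_1[OF i(2) assms(1)] by simp
    then show ?thesis using same_cell_0[OF Suc.prems(1) corner_in_gasket[OF assms(1)]] by (intro exI[of _ 0]) auto
  qed
qed

lemma same_cell_refl: "x \<in> gasket \<Longrightarrow> same_cell n x x"
  using gasket_cover[of x n] unfolding same_cell_def by blast

text \<open>Measured by the coordinate \<open>j\<close>, the junction point separates the two cells: on the \<open>i\<close>-th cell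
\<open>bary j\<close> is at most 1/2, on the \<open>j\<close>-th cell at least 1/2. So the deviation of \<open>x\<close> from the junction
point is bounded by the distance of \<open>x\<close> to any point of the other cell.\<close>

lemma same_cell_junction:
  assumes "i \<in> I3" "j \<in> I3" "i \<noteq> j" "x \<in> gasket" "y \<in> gasket"
    "gasket_map i x \<noteq> gasket_map j y"
  shows "\<exists>n. same_cell n (gasket_map i x) (gasket_map i (corner j)) \<and>
    (1/2) ^ n \<le> 4 * dist (gasket_map i x) (gasket_map j y)"
proof (cases "x = corner j")
  case True
  define e where "e = dist (gasket_map i x) (gasket_map j y)"
  have "e > 0" using assms by (simp add: e_def)
  then obtain n where "1 / 2 ^ n < e" using eventually_power_half_less by blast
  then have "(1/2) ^ n \<le> 4 * e" using \<open>e > 0\<close> by (simp add: power_divide)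
  then show ?thesis using same_cell_refl[OF gasket_map_in[OF assms(4,1)], of n] True e_def by blast
next
  case False
  then have "bary j x < 1" using bary_ge_1_imp_corner[OF assms(4,2)] by force
  then obtain k where "1 / 2 ^ k < 1 - bary j x" using eventually_power_half_less[of "1 - bary j x" 1] by auto
  then have "(1/2) ^ k \<le> 1 - bary j x" by (simp add: power_divide)
  from same_cell_corner[OF assms(2,4) this] obtain n
    where n: "same_cell n x (corner j)" "(1/2) ^ Suc n \<le> 1 - bary j x" by blast
  have "1 - bary j x = 2 * (1/2 - bary j (gasket_map i x))"
    using bary_gasket_map[OF assms(1,2), of x] assms(3) by simp
  also have "\<dots> \<le> 2 * (bary j (gasket_map j y) - bary j (gasket_map i x))"
    using bary_half[OF assms(5,2)] by simp
  also have "\<dots> \<le> 4 * dist (gasket_map i x) (gasket_map j y)"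
    using bary_diff_le[of j "gasket_map j y" "gasket_map i x"] by (simp add: dist_commute)
  finally show ?thesis using same_cell_map[OF n(1) assms(1)] n(2) by (intro exI[of _ "Suc n"]) simp
qed

text \<open>Undo the common maps until the two points lie in different cells of level one; the junction point of
these two cells is close to both.\<close>

lemma gasket_chain:
  assumes "x \<in> gasket" "y \<in> gasket" "x \<noteq> y"
  shows "\<exists>p\<in>gasket. \<exists>m n. same_cell m x p \<and> (1/2) ^ m \<le> 4 * dist x y \<and>
    same_cell n y p \<and> (1/2) ^ n \<le> 4 * dist x y"
proof -
  obtain D where D: "\<And>a b. a \<in> gasket \<Longrightarrow> b \<in> gasket \<Longrightarrow> dist a b \<le> D"
    using gasket_diameter by blast
  have *: "\<exists>p\<in>gasket. \<exists>m n. same_cell m x p \<and> (1/2) ^ m \<le> 4 * dist x y \<and>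
    same_cell n y p \<and> (1/2) ^ n \<le> 4 * dist x y"
    if "x \<in> gasket" "y \<in> gasket" "x \<noteq> y" "D / 2 ^ k < dist x y" for x y k
    using that
  proof (induction k arbitrary: x y)
    case 0
    then show ?case using D[of x y] by simp
  next
    case (Suc k)
    obtain i x' where i: "i \<in> I3" "x' \<in> gasket" "x = gasket_map i x'" using gasket_step[OF Suc.prems(1)] .
    obtain j y' where j: "j \<in> I3" "y' \<in> gasket" "y = gasket_map j y'" using gasket_step[OF Suc.prems(2)] .
    show ?case
    proof (cases "i = j")
      case True
      have d: "dist x y = dist x' y' / 2" using i j True by (simp add: dist_gasket_map)
      have "D / 2 ^ k < dist x' y'" using d Suc.prems(4) by simp
      moreover have "x' \<noteq> y'" using i j True Suc.prems(3) by auto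
      ultimately obtain p m n where p: "p \<in> gasket" "same_cell m x' p" "(1/2) ^ m \<le> 4 * dist x' y'"
        "same_cell n y' p" "(1/2) ^ n \<le> 4 * dist x' y'"
        using Suc.IH[OF i(2) j(2)] by blast
      show ?thesis
        using gasket_map_in[OF p(1) i(1)] same_cell_map[OF p(2) i(1)] same_cell_map[OF p(4) i(1)] p(3,5) d i(3) j(3) True
        by (intro bexI[of _ "gasket_map i p"] exI[of _ "Suc m"] exI[of _ "Suc n"]) auto
    next
      case False
      obtain m where m: "same_cell m x (gasket_map i (corner j))" "(1/2) ^ m \<le> 4 * dist x y"
        using same_cell_junction[OF i(1) j(1) False i(2) j(2)] i(3) j(3) Suc.prems(3) by auto
      obtain n where n: "same_cell n y (gasket_map j (corner i))" "(1/2) ^ n \<le> 4 * dist y x"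
        using same_cell_junction[OF j(1) i(1) _ j(2) i(2)] i(3) j(3) Suc.prems(3) False by auto
      show ?thesis using m n gasket_map_junction[of i j] gasket_map_in[OF corner_in_gasket[OF j(1)] i(1)]
        by (intro bexI[of _ "gasket_map i (corner j)"] exI[of _ m] exI[of _ n]) (auto simp: dist_commute)
    qed
  qed
  obtain k where "D / 2 ^ k < dist x y" using eventually_power_half_less[of "dist x y" D] assms(3) by auto
  then show ?thesis using * assms by blast
qed

section \<open>The self-similar measure\<close>

definition code_measure :: "nat stream measure" where
  "code_measure = stream_space (measure_pmf (pmf_of_set I3))"

lemma prob_space_code_measure: "prob_space code_measure"
  unfolding code_measure_def by (rule prob_space.prob_space_stream_space[OF prob_space_measure_pmf])

lemma space_code_measure [simp]: "space code_measure = UNIV"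
  by (simp add: code_measure_def space_stream_space)

lemma measurable_coding: "coding \<in> borel_measurable code_measure"
proof (rule borel_measurable_LIMSEQ_metric)
  show "(\<lambda>n. \<Sum>k<n. corner (\<omega> !! k) / 2 ^ Suc k) \<longlonglongrightarrow> coding \<omega>" for \<omega>
    unfolding coding_def using summable_coding[of \<omega>] by (rule summable_LIMSEQ)
  have [measurable]: "(\<lambda>\<omega>. corner (\<omega> !! k)) \<in> borel_measurable code_measure" for k
  proof -
    have "(\<lambda>i. corner i) \<in> measurable (measure_pmf (pmf_of_set I3)) borel" by simp
    then show ?thesis unfolding code_measure_def by (rule measurable_compose[OF measurable_snth])
  qed
  show "(\<lambda>\<omega>. \<Sum>k<n. corner (\<omega> !! k) / 2 ^ Suc k) \<in> borel_measurable code_measure" for n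
    by measurable
qed

abbreviation gasket_borel :: "complex measure" where
  "gasket_borel \<equiv> restrict_space borel gasket"

lemma borel_gasket [measurable]: "gasket \<in> sets borel"
  using closed_gasket by (rule borel_closed)

lemma sets_gasket_borel: "A \<in> sets gasket_borel \<longleftrightarrow> A \<in> sets borel \<and> A \<subseteq> gasket"
  using borel_gasket by (auto simp: sets_restrict_space_iff)

lemma measurable_coding': "coding \<in> measurable code_measure gasket_borel"
  using measurable_coding coding_in_gasket by (intro measurable_restrict_space2) auto

text \<open>The candidate for the self-similar measure: the law of a point with independent uniform symbols.\<close>

definition coding_distr :: "complex measure" where
  "coding_distr = distr code_measure gasket_borel coding"

lemma sets_coding_distr: "sets coding_distr = sets gasket_borel"
  by (simp add: coding_distr_def)

lemma prob_space_coding_distr: "prob_space coding_distr"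
  unfolding coding_distr_def by (rule prob_space.prob_space_distr[OF prob_space_code_measure measurable_coding'])

lemma borel_gasket_map_vimage:
  assumes "A \<in> sets gasket_borel" shows "{z \<in> gasket. gasket_map i z \<in> A} \<in> sets gasket_borel"
proof -
  have [measurable]: "gasket_map i \<in> borel_measurable borel"
    by (intro borel_measurable_continuous_onI continuous_on_gasket_map)
  have [measurable]: "A \<in> sets borel" using assms by (simp add: sets_gasket_borel)
  have "{z \<in> gasket. gasket_map i z \<in> A} = gasket \<inter> (gasket_map i -` A \<inter> space borel)" by auto
  also have "\<dots> \<in> sets borel" by measurable
  finally show ?thesis by (simp add: sets_gasket_borel)
qed

text \<open>Conditioning on the first symbol.\<close>

lemma emeasure_coding_distr_step:
  assumes A: "A \<in> sets gasket_borel"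
  shows "emeasure coding_distr A = (\<Sum>i\<in>I3. emeasure coding_distr {z \<in> gasket. gasket_map i z \<in> A}) / 3"
proof -
  have e: "emeasure coding_distr B = emeasure code_measure (coding -` B)" if "B \<in> sets gasket_borel" for B
    unfolding coding_distr_def using that by (simp add: emeasure_distr[OF measurable_coding'])
  have m: "coding -` A \<in> sets (stream_space (measure_pmf (pmf_of_set I3)))"
    using measurable_sets[OF measurable_coding' A] by (simp add: code_measure_def space_stream_space)
  have "emeasure code_measure (coding -` A) =
      (\<integral>\<^sup>+i. emeasure code_measure {\<omega> \<in> space code_measure. i ## \<omega> \<in> coding -` A} \<partial>measure_pmf (pmf_of_set I3))"
    using prob_space.emeasure_stream_space[OF prob_space_measure_pmf m] unfolding code_measure_def .
  also have "\<dots> = (\<integral>\<^sup>+i. emeasure coding_distr {z \<in> gasket. gasket_map i z \<in> A} \<partial>measure_pmf (pmf_of_set I3))"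
    by (intro nn_integral_cong) (auto simp: e[OF borel_gasket_map_vimage[OF A]] coding_Stream coding_in_gasket
        intro!: arg_cong[where f = "emeasure code_measure"])
  also have "\<dots> = (\<Sum>i\<in>I3. emeasure coding_distr {z \<in> gasket. gasket_map i z \<in> A}) / 3"
    by (subst nn_integral_pmf_of_set) auto
  finally show ?thesis using e[OF A] by simp
qed

text \<open>At most two of the three cells of level one contain a given point, so each further symbol costs a
factor of 2/3.\<close>

lemma coding_distr_point: "measure coding_distr {x} \<le> (2/3) ^ n"
proof (induction n arbitrary: x)
  case 0
  interpret prob_space coding_distr by (rule prob_space_coding_distr)
  show ?case by simp
next
  case (Suc n)
  interpret prob_space coding_distr by (rule prob_space_coding_distr)
  show ?case
  proof (cases "x \<in> gasket")
    case False
    then have "{x} \<notin> sets coding_distr" by (simp add: sets_coding_distr sets_gasket_borel)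
    then show ?thesis by (simp add: measure_notin_sets)
  next
    case True
    define P where "P i = {z \<in> gasket. gasket_map i z \<in> {x}}" for i
    have s: "{x} \<in> sets gasket_borel" using True by (simp add: sets_gasket_borel)
    have P: "P i \<in> sets gasket_borel" for i unfolding P_def by (rule borel_gasket_map_vimage[OF s])
    have sub: "P i \<subseteq> {2 * x - corner i}" for i unfolding P_def by (auto simp: gasket_map_eq field_simps)
    have le: "measure coding_distr (P i) \<le> (2/3) ^ n" for i
    proof (cases "P i = {}")
      case False
      then have "P i = {2 * x - corner i}" using sub[of i] by blast
      then show ?thesis using Suc.IH by simp
    qed auto
    have "ennreal (measure coding_distr {x}) = (\<Sum>i\<in>I3. ennreal (measure coding_distr (P i))) / 3"
      using emeasure_coding_distr_step[OF s] by (simp add: emeasure_eq_measure P_def)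
    also have "\<dots> = ennreal ((\<Sum>i\<in>I3. measure coding_distr (P i)) / 3)"
      by (simp add: divide_ennreal sum_nonneg flip: ennreal_plus ennreal_numeral)
    finally have eq: "measure coding_distr {x} = (\<Sum>i\<in>I3. measure coding_distr (P i)) / 3"
      by (simp add: sum_nonneg)
    \<comment> \<open>Otherwise all three barycentric coordinates of \<open>x\<close> would be at least 1/2, but they sum to 1.\<close>
    have "\<exists>i\<in>I3. P i = {}"
    proof (rule ccontr)
      assume "\<not> ?thesis"
      then have ne: "P i \<noteq> {}" if "i \<in> I3" for i using that by blast
      have "bary i x \<ge> 1/2" if "i \<in> I3" for i
        using ne[OF that] bary_half[OF _ that] unfolding P_def by auto
      from this[of 1] this[of 2] this[of 3] show False using bary_sum[of x] by simp
    qed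
    then obtain i where i: "i \<in> I3" "P i = {}" by blast
    have "(\<Sum>i\<in>I3. measure coding_distr (P i)) \<le> 2 * (2/3) ^ n"
      using i le[of 1] le[of 2] le[of 3] by (auto simp: I3_cases)
    then show ?thesis unfolding eq by simp
  qed
qed

lemma emeasure_coding_distr_point: "emeasure coding_distr {x} = 0"
proof -
  interpret prob_space coding_distr by (rule prob_space_coding_distr)
  have "(\<lambda>n. (2/3::real) ^ n) \<longlonglongrightarrow> 0" by (rule LIMSEQ_power_zero) simp
  then have "measure coding_distr {x} \<le> 0" by (rule LIMSEQ_le_const) (use coding_distr_point in auto)
  then show ?thesis by (simp add: emeasure_eq_measure measure_le_0_iff)
qed

lemma compact_cell: "compact (gasket_word_map w ` gasket)"
  by (intro compact_continuous_image compact_gasket continuous_on_gasket_word_map)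

lemma cell_in_sets: assumes "w \<in> gasket_words n" shows "gasket_word_map w ` gasket \<in> sets gasket_borel"
  using compact_cell[of w] gasket_word_map_in[OF _ assms]
  by (auto simp: sets_gasket_borel intro: borel_compact)

text \<open>Different cells of level one meet in single points, which are null sets, so only the cell with the
right first symbol contributes.\<close>

lemma emeasure_coding_distr_cell:
  "w \<in> gasket_words n \<Longrightarrow> emeasure coding_distr (gasket_word_map w ` gasket) = ennreal (1 / 3 ^ n)"
proof (induction w arbitrary: n)
  case Nil
  interpret prob_space coding_distr by (rule prob_space_coding_distr)
  have "space coding_distr = gasket" by (simp add: coding_distr_def space_restrict_space)
  then show ?case using Nil emeasure_space_1 by (simp add: gasket_words_def image_def)
next
  case (Cons i w)
  then obtain m where n: "n = Suc m" "i \<in> I3" "w \<in> gasket_words m"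
    by (cases n) (auto simp: gasket_words_def)
  let ?A = "gasket_word_map (i # w) ` gasket"
  have "emeasure coding_distr {z \<in> gasket. gasket_map j z \<in> ?A} = (if j = i then ennreal (1 / 3 ^ m) else 0)"
    if j: "j \<in> I3" for j
  proof (cases "j = i")
    case True
    have "{z \<in> gasket. gasket_map j z \<in> ?A} = gasket_word_map w ` gasket"
      using gasket_word_map_in[OF _ n(3)] True by (auto simp: inj_gasket_map)
    then show ?thesis using Cons.IH[OF n(3)] True by simp
  next
    case False
    have "{z \<in> gasket. gasket_map j z \<in> ?A} \<subseteq> {corner i}"
      using gasket_cells_meet[OF _ gasket_word_map_in[OF _ n(3)] j n(2) False] by auto
    moreover have "{corner i} \<in> sets coding_distr"
      using corner_in_gasket[OF n(2)] by (simp add: sets_coding_distr sets_gasket_borel)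
    ultimately have "emeasure coding_distr {z \<in> gasket. gasket_map j z \<in> ?A} \<le> emeasure coding_distr {corner i}"
      by (intro emeasure_mono)
    then show ?thesis using False by (simp add: emeasure_coding_distr_point)
  qed
  then have "emeasure coding_distr ?A = (\<Sum>j\<in>I3. if j = i then ennreal (1 / 3 ^ m) else 0) / 3"
    using emeasure_coding_distr_step[OF cell_in_sets[OF Cons.prems]] by (simp cong: sum.cong)
  also have "\<dots> = ennreal (1 / 3 ^ m) / 3" using n(2) by auto
  also have "\<dots> = ennreal (1 / 3 ^ n)"
    by (simp add: n divide_ennreal flip: ennreal_numeral)
  finally show ?case .
qed

definition gasket_measure_like :: "complex measure \<Rightarrow> bool" where
  "gasket_measure_like M \<longleftrightarrow> sets M = sets gasket_borel \<and>
     (\<forall>n. \<forall>w\<in>gasket_words n. emeasure M (gasket_word_map w ` gasket) = ennreal (1 / 3 ^ n))"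

lemma gasket_measure_like_space: "gasket_measure_like M \<Longrightarrow> space M = gasket"
  unfolding gasket_measure_like_def by (metis inf_top.right_neutral sets_eq_imp_space_eq space_borel space_restrict_space inf_commute)

lemma gasket_measure_like_prob: assumes "gasket_measure_like M" shows "prob_space M"
proof
  have "emeasure M (gasket_word_map [] ` gasket) = 1"
    using assms unfolding gasket_measure_like_def
    by (metis div_by_1 ennreal_1 gasket_words_0 insertI1 power_0)
  then show "emeasure M (space M) = 1" using gasket_measure_like_space[OF assms] by (simp add: image_def)
qed

text \<open>The masses of all cells of level \<open>n\<close> add up to the total mass 1, so their overlaps
must be null sets: the subadditivity estimates for a family and for its complement are both equalities.\<close>

lemma gasket_measure_like_union:
  assumes M: "gasket_measure_like M" and A: "A \<subseteq> gasket_words n"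
  shows "measure M (\<Union>w\<in>A. gasket_word_map w ` gasket) = card A / 3 ^ n"
proof -
  interpret prob_space M by (rule gasket_measure_like_prob[OF M])
  have sp: "space M = gasket" by (rule gasket_measure_like_space[OF M])
  have sets: "gasket_word_map w ` gasket \<in> sets M" if "w \<in> gasket_words n" for w
    using M cell_in_sets[OF that] by (simp add: gasket_measure_like_def)
  have m: "measure M (gasket_word_map w ` gasket) = 1 / 3 ^ n" if "w \<in> gasket_words n" for w
    using M that by (simp add: gasket_measure_like_def measure_def)
  have le: "measure M (\<Union>w\<in>B. gasket_word_map w ` gasket) \<le> card B / 3 ^ n" if B: "B \<subseteq> gasket_words n" for B
  proof -
    have "measure M (\<Union>w\<in>B. gasket_word_map w ` gasket) \<le> (\<Sum>w\<in>B. measure M (gasket_word_map w ` gasket))"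
      by (rule finite_measure_subadditive_finite) (use B sets finite_subset[OF B] in auto)
    also have "\<dots> = (\<Sum>w\<in>B. 1 / 3 ^ n)" using B m by (intro sum.cong) auto
    finally show ?thesis by simp
  qed
  let ?U = "\<lambda>B. \<Union>w\<in>B. gasket_word_map w ` gasket"
  have U: "?U B \<in> sets M" if "B \<subseteq> gasket_words n" for B
    using that sets finite_subset[OF that] by (intro sets.finite_UN) auto
  have "space M \<subseteq> ?U A \<union> ?U (gasket_words n - A)"
  proof
    fix x assume "x \<in> space M"
    then obtain w y where "w \<in> gasket_words n" "y \<in> gasket" "x = gasket_word_map w y"
      using gasket_cover[of x n] sp by blast
    then show "x \<in> ?U A \<union> ?U (gasket_words n - A)" by (cases "w \<in> A") auto
  qed
  then have "1 \<le> measure M (?U A \<union> ?U (gasket_words n - A))"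
    using U[OF A] U[of "gasket_words n - A"] by (subst prob_space[symmetric]) (intro finite_measure_mono sets.Un, auto)
  also have "\<dots> \<le> measure M (?U A) + measure M (?U (gasket_words n - A))"
    using U[OF A] U[of "gasket_words n - A"] by (intro measure_Un_le) auto
  also have "measure M (?U (gasket_words n - A)) \<le> card (gasket_words n - A) / 3 ^ n" by (rule le) auto
  also have "card (gasket_words n - A) = 3 ^ n - card A"
    using A by (simp add: card_Diff_subset finite_subset card_gasket_words)
  also have "real (3 ^ n - card A) / 3 ^ n = 1 - card A / 3 ^ n"
    using card_mono[OF finite_gasket_words A] by (simp add: card_gasket_words of_nat_diff diff_divide_distrib)
  finally show ?thesis using le[OF A] by simp
qed

text \<open>The cells of level \<open>n\<close> that meet \<open>C\<close> have a union of the same mass for both measures, and this union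
lies in a neighbourhood of \<open>C\<close> that shrinks to \<open>C\<close>.\<close>

lemma gasket_measure_like_closed_le:
  assumes M: "gasket_measure_like M" and N: "gasket_measure_like N" and C: "closed C" "C \<subseteq> gasket"
  shows "emeasure M C \<le> emeasure N C"
proof (cases "C = {}")
  case False
  interpret M: prob_space M by (rule gasket_measure_like_prob[OF M])
  interpret N: prob_space N by (rule gasket_measure_like_prob[OF N])
  have setsM: "sets M = sets gasket_borel" and setsN: "sets N = sets gasket_borel"
    using M N by (auto simp: gasket_measure_like_def)
  obtain D where D: "\<And>a b. a \<in> gasket \<Longrightarrow> b \<in> gasket \<Longrightarrow> dist a b \<le> D"
    using gasket_diameter by blast
  obtain c where c: "c \<in> C" using False by blast
  have D0: "D \<ge> 0" using D[of c c] c C by auto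
  define T where "T n = {x \<in> gasket. infdist x C \<le> D / 2 ^ n}" for n :: nat
  have T: "T n \<in> sets gasket_borel" for n
  proof -
    have "closed (gasket \<inter> {x. infdist x C \<le> D / 2 ^ n})"
      by (intro closed_Int closed_gasket closed_Collect_le continuous_intros)
    then show ?thesis by (auto simp: T_def sets_gasket_borel Int_def)
  qed
  have dec: "decseq T"
  proof (rule decseq_SucI)
    fix n
    have "D / 2 ^ Suc n \<le> D / 2 ^ n" using D0 by (simp add: field_simps)
    then show "T (Suc n) \<subseteq> T n" unfolding T_def by auto
  qed
  have "(\<Inter>n. T n) = C"
  proof (intro subset_antisym subsetI)
    fix x assume x: "x \<in> (\<Inter>n. T n)"
    have "infdist x C \<le> 0"
    proof (rule ccontr)
      assume "\<not> ?thesis"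
      then obtain n where "D / 2 ^ n < infdist x C" using eventually_power_half_less[of "infdist x C" D] by auto
      moreover have "infdist x C \<le> D / 2 ^ n" using x unfolding T_def by blast
      ultimately show False by simp
    qed
    then have "infdist x C = 0" using infdist_nonneg[of x C] by linarith
    then show "x \<in> C" using in_closed_iff_infdist_zero[OF C(1) False] by simp
  qed (use C D0 in \<open>auto simp: T_def\<close>)
  then have lim: "(\<lambda>n. emeasure N (T n)) \<longlonglongrightarrow> emeasure N C"
    using Lim_emeasure_decseq[OF _ dec, of N] T setsN by auto
  have "emeasure M C \<le> emeasure N (T n)" for n
  proof -
    define A where "A = {w \<in> gasket_words n. gasket_word_map w ` gasket \<inter> C \<noteq> {}}"
    let ?U = "\<Union>w\<in>A. gasket_word_map w ` gasket"
    have A: "A \<subseteq> gasket_words n" by (auto simp: A_def)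
    have U: "?U \<in> sets gasket_borel"
      using A cell_in_sets finite_subset[OF A] by (intro sets.finite_UN) auto
    have "C \<subseteq> ?U"
    proof
      fix x assume "x \<in> C"
      then obtain w y where "w \<in> gasket_words n" "y \<in> gasket" "x = gasket_word_map w y"
        using gasket_cover[of x n] C by blast
      then show "x \<in> ?U" using \<open>x \<in> C\<close> unfolding A_def by blast
    qed
    then have "emeasure M C \<le> emeasure M ?U" using U setsM by (intro emeasure_mono) auto
    also have "\<dots> = emeasure N ?U"
      by (simp add: M.emeasure_eq_measure N.emeasure_eq_measure gasket_measure_like_union[OF M A] gasket_measure_like_union[OF N A])
    also have "?U \<subseteq> T n"
    proof
      fix x assume "x \<in> ?U"
      then obtain w y z where w: "w \<in> gasket_words n" "y \<in> gasket" "x = gasket_word_map w y"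
        "z \<in> gasket" "gasket_word_map w z \<in> C" unfolding A_def by blast
      have "infdist x C \<le> dist x (gasket_word_map w z)" by (rule infdist_le[OF w(5)])
      also have "\<dots> = dist y z / 2 ^ n" using w by (simp add: dist_gasket_word_map gasket_words_def)
      also have "\<dots> \<le> D / 2 ^ n" by (intro divide_right_mono D) (use w in auto)
      finally show "x \<in> T n" using gasket_word_map_in[OF w(2,1)] w(3) by (simp add: T_def)
    qed
    then have "emeasure N ?U \<le> emeasure N (T n)" using T setsN by (intro emeasure_mono) auto
    finally show ?thesis .
  qed
  then show ?thesis using lim by (intro LIMSEQ_le_const) auto
qed simp

lemma gasket_measure_like_unique:
  assumes M: "gasket_measure_like M" and N: "gasket_measure_like N"
  shows "M = N"
proof -
  interpret M: prob_space M by (rule gasket_measure_like_prob[OF M])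
  interpret N: prob_space N by (rule gasket_measure_like_prob[OF N])
  have setsM: "sets M = sets gasket_borel" and setsN: "sets N = sets gasket_borel"
    using M N by (auto simp: gasket_measure_like_def)
  have idM: "(\<lambda>x. x) \<in> measurable M borel" and idN: "(\<lambda>x. x) \<in> measurable N borel"
    using setsM setsN by (auto simp: measurable_cong_sets[OF setsM refl] measurable_cong_sets[OF setsN refl]
        intro: measurable_restrict_space1)
  have eq: "distr M borel (\<lambda>x. x) = distr N borel (\<lambda>x. x)"
  proof (rule measure_eqI_generator_eq[where E = "Collect closed" and \<Omega> = UNIV and A = "\<lambda>_. UNIV"])
    show "Int_stable (Collect closed :: complex set set)" by (auto simp: Int_stable_def)
    show "sets (distr M borel (\<lambda>x. x)) = sigma_sets UNIV (Collect closed)"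
      by (simp add: borel_eq_closed)
    show "sets (distr N borel (\<lambda>x. x)) = sigma_sets UNIV (Collect closed)"
      by (simp add: borel_eq_closed)
    fix C :: "complex set" assume "C \<in> Collect closed"
    then have C: "closed (C \<inter> gasket)" "C \<in> sets borel" using closed_gasket by auto
    show "emeasure (distr M borel (\<lambda>x. x)) C = emeasure (distr N borel (\<lambda>x. x)) C"
      using gasket_measure_like_closed_le[OF M N C(1)] gasket_measure_like_closed_le[OF N M C(1)] C
      by (simp add: emeasure_distr[OF idM] emeasure_distr[OF idN] gasket_measure_like_space[OF M] gasket_measure_like_space[OF N])
  next
    show "\<And>i. emeasure (distr M borel (\<lambda>x. x)) UNIV \<noteq> \<infinity>"
      by (simp add: emeasure_distr[OF idM])
  qed auto
  show ?thesis
  proof (rule measure_eqI)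
    show "sets M = sets N" using setsM setsN by simp
    fix A assume "A \<in> sets M"
    then have A: "A \<in> sets borel" "A \<subseteq> gasket" by (auto simp: setsM sets_gasket_borel)
    have "emeasure M A = emeasure (distr M borel (\<lambda>x. x)) A"
      using A by (simp add: emeasure_distr[OF idM] gasket_measure_like_space[OF M] Int_absorb2)
    also have "\<dots> = emeasure N A" unfolding eq
      using A by (simp add: emeasure_distr[OF idN] gasket_measure_like_space[OF N] Int_absorb2)
    finally show "emeasure M A = emeasure N A" .
  qed
qed

lemma gasket_measure_like_gasket_measure: "gasket_measure_like gasket_measure"
proof -
  have "gasket_measure_like coding_distr"
    unfolding gasket_measure_like_def using sets_coding_distr emeasure_coding_distr_cell by blast
  then have "\<exists>!M. gasket_measure_like M" using gasket_measure_like_unique by blast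
  moreover have "gasket_measure = (THE M. gasket_measure_like M)"
    by (simp add: gasket_measure_def gasket_measure_like_def)
  ultimately show ?thesis using theI'[of gasket_measure_like] by simp
qed

lemma space_gasket_measure [simp]: "space gasket_measure = gasket"
  by (rule gasket_measure_like_space[OF gasket_measure_like_gasket_measure])

lemma sets_gasket_measure: "sets gasket_measure = sets gasket_borel"
  using gasket_measure_like_gasket_measure by (simp add: gasket_measure_like_def)

interpretation gm: prob_space gasket_measure
  by (rule gasket_measure_like_prob[OF gasket_measure_like_gasket_measure])

lemma measure_cell: "w \<in> gasket_words n \<Longrightarrow> measure gasket_measure (gasket_word_map w ` gasket) = 1 / 3 ^ n"
  using gasket_measure_like_gasket_measure by (simp add: gasket_measure_like_def measure_def)

lemma continuous_borel_gasket: "continuous_on gasket f \<Longrightarrow> f \<in> borel_measurable gasket_measure"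
  for f :: "complex \<Rightarrow> real"
  using borel_measurable_continuous_on_restrict measurable_cong_sets[OF sets_gasket_measure refl] by blast

lemma continuous_gasket_bounded:
  fixes f :: "complex \<Rightarrow> real"
  assumes "continuous_on gasket f" obtains B where "B \<ge> 0" "\<And>x. x \<in> gasket \<Longrightarrow> \<bar>f x\<bar> \<le> B"
proof -
  have "bounded (f ` gasket)" using assms compact_gasket by (intro compact_imp_bounded compact_continuous_image)
  then show ?thesis using that unfolding bounded_pos by (auto intro: less_imp_le)
qed

section \<open>Harmonic splines\<close>

subsection \<open>Gluing functions along the cells of level one\<close>

text \<open>Pasting functions on the three cells is the recursion step for harmonic coordinates, splines and
bump functions. At a junction point the choice of the cell does not matter for compatible families.\<close>

definition paste :: "(nat \<Rightarrow> complex \<Rightarrow> real) \<Rightarrow> complex \<Rightarrow> real" where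
  "paste g z = (if z \<in> gasket_map 1 ` gasket then g 1 (2 * z - corner 1)
     else if z \<in> gasket_map 2 ` gasket then g 2 (2 * z - corner 2)
     else g 3 (2 * z - corner 3))"

definition junction_compatible :: "(nat \<Rightarrow> complex \<Rightarrow> real) \<Rightarrow> bool" where
  "junction_compatible g \<longleftrightarrow> (\<forall>i\<in>I3. \<forall>j\<in>I3. g i (corner j) = g j (corner i))"

lemma gasket_map_inverse: "2 * gasket_map j y - corner j = y"
  by (simp add: gasket_map_eq field_simps)

lemma paste_map:
  assumes g: "junction_compatible g" and i: "i \<in> I3" and z: "z \<in> gasket"
  shows "paste g (gasket_map i z) = g i z"
proof -
  note inv = gasket_map_inverse
  have other: "g j (2 * gasket_map i z - corner j) = g i z"
    if j: "j \<in> I3" and m: "gasket_map i z \<in> gasket_map j ` gasket" for j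
  proof (cases "i = j")
    case False
    obtain y where y: "y \<in> gasket" "gasket_map i z = gasket_map j y" using m by blast
    have "z = corner j" by (rule gasket_cells_meet[OF z y(1) i j False y(2)])
    moreover have "y = corner i"
      by (rule gasket_cells_meet[OF y(1) z j i]) (use False y in auto)
    ultimately show ?thesis using g i j y(2) inv[of j y] by (simp only: junction_compatible_def)
  qed (simp only: inv)
  have "gasket_map i z \<in> gasket_map i ` gasket" using z by blast
  then have "gasket_map i z \<notin> gasket_map 1 ` gasket \<Longrightarrow> gasket_map i z \<notin> gasket_map 2 ` gasket
    \<Longrightarrow> i = 3" using i unfolding I3_cases by metis
  then show ?thesis unfolding paste_def using other[of 1] other[of 2] inv[of 3 z] by auto
qed

lemma continuous_on_paste:
  assumes g: "junction_compatible g" and c: "\<And>i. i \<in> I3 \<Longrightarrow> continuous_on gasket (g i)"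
  shows "continuous_on gasket (paste g)"
proof -
  have "continuous_on (gasket_map i ` gasket) (paste g)" if i: "i \<in> I3" for i
  proof -
    have "continuous_on (gasket_map i ` gasket) (\<lambda>z. g i (2 * z - corner i))"
    proof (rule continuous_on_compose2[OF c[OF i]])
      show "continuous_on (gasket_map i ` gasket) (\<lambda>z. 2 * z - corner i)" by (intro continuous_intros)
      show "(\<lambda>z. 2 * z - corner i) ` gasket_map i ` gasket \<subseteq> gasket" by (auto simp only: gasket_map_inverse)
    qed
    then show ?thesis
      by (rule continuous_on_eq) (auto simp only: paste_map[OF g i] gasket_map_inverse)
  qed
  then have "continuous_on (\<Union>i\<in>I3. gasket_map i ` gasket) (paste g)"
    by (intro continuous_on_closed_Union)
      (auto intro!: compact_imp_closed compact_continuous_image compact_gasket continuous_on_gasket_map)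
  moreover have "(\<Union>i\<in>I3. gasket_map i ` gasket) = gasket"
    using gasket_like_gasket unfolding gasket_like_def by metis
  ultimately show ?thesis by simp
qed

lemma paste_corner:
  assumes g: "junction_compatible g" and i: "i \<in> I3"
  shows "paste g (corner i) = g i (corner i)"
  using paste_map[OF g i corner_in_gasket[OF i]] by (simp only: gasket_map_corner)

subsection \<open>Harmonic coordinates\<close>

lemma sum_I3_delta: "k \<in> I3 \<Longrightarrow> (\<Sum>l\<in>I3. if l = k then f l else 0) = f k"
  by (subst sum.delta) auto

text \<open>The 1/5-2/5 rule for the harmonic function that is 1 at the \<open>j\<close>-th corner and 0 at the others: the
value at the midpoint of two corners is 2/5 if one of them is the \<open>j\<close>-th and 1/5 otherwise. The entry
\<open>harm_coeff i j l\<close> is the value at the image of corner \<open>l\<close> in cell \<open>i\<close>.\<close>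

definition harm_coeff :: "nat \<Rightarrow> nat \<Rightarrow> nat \<Rightarrow> real" where
  "harm_coeff i j l = (if i = l then (if i = j then 1 else 0)
     else (1 + (if i = j then 1 else 0) + (if l = j then 1 else 0)) / 5)"

lemma harm_coeff_sym: "harm_coeff i j l = harm_coeff l j i"
  by (auto simp: harm_coeff_def)

lemma harm_coeff_nonneg: "harm_coeff i j l \<ge> 0"
  by (auto simp: harm_coeff_def)

text \<open>Iterates of the self-similarity equation of the harmonic coordinates, started at the barycentric
coordinates because these are continuous and have the right values at the corners.\<close>

fun harm_iter :: "nat \<Rightarrow> nat \<Rightarrow> complex \<Rightarrow> real" where
  "harm_iter 0 j = bary j"
| "harm_iter (Suc n) j = paste (\<lambda>i z. \<Sum>l\<in>I3. harm_coeff i j l * harm_iter n l z)"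

lemma sum_I3: "(\<Sum>l\<in>I3. f l) = f 1 + f 2 + f 3"
  by (simp add: add.assoc)

lemma harm_iter_corner:
  "j \<in> I3 \<Longrightarrow> m \<in> I3 \<Longrightarrow> harm_iter n j (corner m) = (if j = m then 1 else 0)"
  and harm_iter_compatible:
  "j \<in> I3 \<Longrightarrow> junction_compatible (\<lambda>i z. \<Sum>l\<in>I3. harm_coeff i j l * harm_iter n l z)"
proof -
  have comp: "junction_compatible (\<lambda>i z. \<Sum>l\<in>I3. harm_coeff i j l * harm_iter n l z)"
    if "\<And>j m. j \<in> I3 \<Longrightarrow> m \<in> I3 \<Longrightarrow> harm_iter n j (corner m) = (if j = m then 1 else 0)" for n j
  proof -
    have *: "(\<Sum>l\<in>I3. harm_coeff i j l * harm_iter n l (corner k)) = harm_coeff i j k" if "k \<in> I3" for i k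
    proof -
      have "(\<Sum>l\<in>I3. harm_coeff i j l * harm_iter n l (corner k)) = (\<Sum>l\<in>I3. if l = k then harm_coeff i j l else 0)"
        by (rule sum.cong[OF refl]) (simp only: \<open>\<And>j m. j \<in> I3 \<Longrightarrow> m \<in> I3 \<Longrightarrow> harm_iter n j (corner m) = (if j = m then 1 else 0)\<close> that, simp)
      then show ?thesis using that by (simp only: sum_I3_delta)
    qed
    show ?thesis unfolding junction_compatible_def
      by (intro ballI) (simp only: *, rule harm_coeff_sym)
  qed
  have corner: "j \<in> I3 \<Longrightarrow> m \<in> I3 \<Longrightarrow> harm_iter n j (corner m) = (if j = m then 1 else 0)" for n j m
  proof (induction n arbitrary: j m)
    case 0 then show ?case by (simp only: harm_iter.simps bary_corner)
  next
    case (Suc n)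
    have "harm_iter (Suc n) j (corner m) = (\<Sum>l\<in>I3. harm_coeff m j l * harm_iter n l (corner m))"
      by (simp only: harm_iter.simps paste_corner[OF comp[OF Suc.IH] Suc.prems(2)])
    also have "\<dots> = (\<Sum>l\<in>I3. if l = m then harm_coeff m j l else 0)"
      by (rule sum.cong[OF refl]) (simp only: Suc.IH Suc.prems, simp)
    also have "\<dots> = harm_coeff m j m" using Suc.prems by (simp only: sum_I3_delta)
    finally show ?case by (auto simp: harm_coeff_def)
  qed
  show "j \<in> I3 \<Longrightarrow> m \<in> I3 \<Longrightarrow> harm_iter n j (corner m) = (if j = m then 1 else 0)" by (rule corner)
  show "j \<in> I3 \<Longrightarrow> junction_compatible (\<lambda>i z. \<Sum>l\<in>I3. harm_coeff i j l * harm_iter n l z)" by (rule comp[OF corner])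
qed

lemma harm_iter_map:
  assumes "j \<in> I3" "i \<in> I3" "z \<in> gasket"
  shows "harm_iter (Suc n) j (gasket_map i z) = (\<Sum>l\<in>I3. harm_coeff i j l * harm_iter n l z)"
  by (simp only: harm_iter.simps paste_map[OF harm_iter_compatible[OF assms(1)] assms(2,3)])

lemma continuous_on_harm_iter: "j \<in> I3 \<Longrightarrow> continuous_on gasket (harm_iter n j)"
proof (induction n arbitrary: j)
  case 0 show ?case by (simp add: continuous_on_bary)
next
  case (Suc n)
  show ?case unfolding harm_iter.simps
    by (intro continuous_on_paste harm_iter_compatible Suc.prems continuous_intros Suc.IH)
qed

lemma harm_iter_nonneg: "j \<in> I3 \<Longrightarrow> z \<in> gasket \<Longrightarrow> harm_iter n j z \<ge> 0"
proof (induction n arbitrary: j z)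
  case 0 then show ?case using bary_nonneg by simp
next
  case (Suc n)
  obtain i y where y: "i \<in> I3" "y \<in> gasket" "z = gasket_map i y" using gasket_step[OF Suc.prems(2)] .
  show ?case unfolding y(3) harm_iter_map[OF Suc.prems(1) y(1,2)]
    by (intro sum_nonneg mult_nonneg_nonneg harm_coeff_nonneg Suc.IH y(2))
qed

lemma harm_coeff_sum: "i \<in> I3 \<Longrightarrow> l \<in> I3 \<Longrightarrow> (\<Sum>j\<in>I3. harm_coeff i j l) = 1"
  by (auto simp: harm_coeff_def)

lemma harm_iter_sum: "z \<in> gasket \<Longrightarrow> (\<Sum>j\<in>I3. harm_iter n j z) = 1"
proof (induction n arbitrary: z)
  case 0 then show ?case using bary_sum[of z] by simp
next
  case (Suc n)
  obtain i y where y: "i \<in> I3" "y \<in> gasket" "z = gasket_map i y" using gasket_step[OF Suc.prems] .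
  have "(\<Sum>j\<in>I3. harm_iter (Suc n) j z) = (\<Sum>j\<in>I3. \<Sum>l\<in>I3. harm_coeff i j l * harm_iter n l y)"
    unfolding y(3) by (intro sum.cong refl harm_iter_map y)
  also have "\<dots> = (\<Sum>l\<in>I3. (\<Sum>j\<in>I3. harm_coeff i j l) * harm_iter n l y)"
    by (subst sum.swap) (simp only: sum_distrib_right)
  also have "\<dots> = (\<Sum>l\<in>I3. harm_iter n l y)"
    by (rule sum.cong[OF refl]) (simp only: harm_coeff_sum[OF y(1)] mult_1)
  finally show ?case using Suc.IH[OF y(2)] by (simp only:)
qed

lemma harm_iter_le_1: assumes "j \<in> I3" "z \<in> gasket" shows "harm_iter n j z \<le> 1"
  using harm_iter_sum[OF assms(2), of n] harm_iter_nonneg[of 1 z n] harm_iter_nonneg[of 2 z n]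
    harm_iter_nonneg[of 3 z n] assms by (auto simp: I3_cases)

text \<open>To be applied to the difference of two iterates, whose coordinates have the same sum 1. The vectors
of sum 0 form an invariant subspace of each of the three matrices, with eigenvalues 3/5 and 1/5.\<close>

lemma harm_coeff_contract:
  assumes ij: "i \<in> I3" "j \<in> I3" and s: "d 1 + d 2 + d 3 = (0::real)" and b: "\<And>l. l \<in> I3 \<Longrightarrow> \<bar>d l\<bar> \<le> a"
  shows "\<bar>\<Sum>l\<in>I3. harm_coeff i j l * d l\<bar> \<le> 3 / 5 * a"
proof -
  have b': "\<bar>d 1\<bar> \<le> a" "\<bar>d 2\<bar> \<le> a" "\<bar>d 3\<bar> \<le> a" using b by auto
  define x y z where "x = d 1" and "y = d 2" and "z = d 3"
  have b'': "x \<le> a" "- x \<le> a" "y \<le> a" "- y \<le> a" "z \<le> a" "- z \<le> a" and s': "x + y + z = 0"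
    using b' s by (auto simp: x_def y_def z_def)
  show ?thesis unfolding abs_le_iff sum_I3 x_def[symmetric] y_def[symmetric] z_def[symmetric]
    using ij unfolding I3_cases
    by (elim disjE; intro conjI; simp add: harm_coeff_def; use b'' s' in linarith)
qed

lemma harm_iter_diff:
  "j \<in> I3 \<Longrightarrow> z \<in> gasket \<Longrightarrow> \<bar>harm_iter (Suc n) j z - harm_iter n j z\<bar> \<le> (3/5) ^ n"
proof (induction n arbitrary: j z)
  case 0
  have "0 \<le> harm_iter n j z \<and> harm_iter n j z \<le> 1" for n
    using harm_iter_nonneg[OF 0] harm_iter_le_1[OF 0] by blast
  from this[of 0] this[of "Suc 0"] show ?case unfolding power_0 by linarith
next
  case (Suc n)
  obtain i y where y: "i \<in> I3" "y \<in> gasket" "z = gasket_map i y" using gasket_step[OF Suc.prems(2)] .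
  let ?d = "\<lambda>l. harm_iter (Suc n) l y - harm_iter n l y"
  have "harm_iter (Suc (Suc n)) j z - harm_iter (Suc n) j z = (\<Sum>l\<in>I3. harm_coeff i j l * ?d l)"
    unfolding y(3) harm_iter_map[OF Suc.prems(1) y(1,2)]
    by (simp only: sum_subtractf[symmetric] right_diff_distrib)
  also have "\<bar>\<dots>\<bar> \<le> 3 / 5 * (3 / 5) ^ n"
  proof (rule harm_coeff_contract[OF y(1) Suc.prems(1)])
    show "?d 1 + ?d 2 + ?d 3 = 0"
      using harm_iter_sum[OF y(2), of n] harm_iter_sum[OF y(2), of "Suc n"] unfolding sum_I3 by linarith
  qed (rule Suc.IH[OF _ y(2)])
  finally show ?case by (simp only: power_Suc)
qed

definition harm_coord :: "nat \<Rightarrow> complex \<Rightarrow> real" where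
  "harm_coord j z = bary j z + (\<Sum>n. harm_iter (Suc n) j z - harm_iter n j z)"

lemma harm_coord_uniform_limit:
  assumes j: "j \<in> I3" shows "uniform_limit gasket (\<lambda>n. harm_iter n j) (harm_coord j) sequentially"
proof -
  have "uniform_limit gasket (\<lambda>n x. \<Sum>i<n. harm_iter (Suc i) j x - harm_iter i j x)
      (\<lambda>x. \<Sum>i. harm_iter (Suc i) j x - harm_iter i j x) sequentially"
  proof (rule Weierstrass_m_test)
    show "norm (harm_iter (Suc n) j x - harm_iter n j x) \<le> (3/5) ^ n" if "x \<in> gasket" for n x
      using harm_iter_diff[OF j that] by (simp only: real_norm_def)
    show "summable (\<lambda>n. (3/5::real) ^ n)" by (rule summable_geometric) simp
  qed
  moreover have "(\<Sum>i<n. harm_iter (Suc i) j x - harm_iter i j x) = harm_iter n j x - bary j x" for n x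
    using sum_lessThan_telescope[of "\<lambda>i. harm_iter i j x" n] by (simp only: harm_iter.simps(1))
  ultimately have "uniform_limit gasket (\<lambda>n x. harm_iter n j x - bary j x)
      (\<lambda>x. \<Sum>i. harm_iter (Suc i) j x - harm_iter i j x) sequentially" by (simp only:)
  from uniform_limit_add[OF uniform_limit_const this, of "bary j"]
  have "uniform_limit gasket (\<lambda>n x. bary j x + (harm_iter n j x - bary j x))
      (\<lambda>x. bary j x + (\<Sum>i. harm_iter (Suc i) j x - harm_iter i j x)) sequentially" .
  then show ?thesis by (simp add: harm_coord_def[abs_def])
qed

lemma harm_coord_limit: "j \<in> I3 \<Longrightarrow> z \<in> gasket \<Longrightarrow> (\<lambda>n. harm_iter n j z) \<longlonglongrightarrow> harm_coord j z"
  using tendsto_uniform_limitI[OF harm_coord_uniform_limit] .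

lemma continuous_on_harm_coord: "j \<in> I3 \<Longrightarrow> continuous_on gasket (harm_coord j)"
  by (rule uniform_limit_theorem[OF _ harm_coord_uniform_limit]) (auto intro!: always_eventually continuous_on_harm_iter)

lemma harm_coord_nonneg: "j \<in> I3 \<Longrightarrow> z \<in> gasket \<Longrightarrow> harm_coord j z \<ge> 0"
proof (rule LIMSEQ_le_const[OF harm_coord_limit])
  show "j \<in> I3 \<Longrightarrow> z \<in> gasket \<Longrightarrow> \<exists>N. \<forall>n\<ge>N. 0 \<le> harm_iter n j z"
    by (intro exI allI impI harm_iter_nonneg)
qed

lemma harm_coord_sum: assumes "z \<in> gasket" shows "(\<Sum>j\<in>I3. harm_coord j z) = 1"
proof -
  have "(\<lambda>n. \<Sum>j\<in>I3. harm_iter n j z) \<longlonglongrightarrow> (\<Sum>j\<in>I3. harm_coord j z)" by (intro tendsto_sum harm_coord_limit assms)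
  then have "(\<lambda>n. 1) \<longlonglongrightarrow> (\<Sum>j\<in>I3. harm_coord j z)" by (simp only: harm_iter_sum[OF assms])
  then show ?thesis using LIMSEQ_unique tendsto_const by blast
qed

lemma harm_coord_corner: assumes "j \<in> I3" "m \<in> I3" shows "harm_coord j (corner m) = (if j = m then 1 else 0)"
proof -
  have "(\<lambda>n. if j = m then 1 else 0) \<longlonglongrightarrow> harm_coord j (corner m)"
    using harm_coord_limit[OF assms(1) corner_in_gasket[OF assms(2)]] by (simp only: harm_iter_corner[OF assms])
  then show ?thesis using LIMSEQ_unique tendsto_const by blast
qed

lemma harm_coord_map:
  assumes "j \<in> I3" "i \<in> I3" "z \<in> gasket"
  shows "harm_coord j (gasket_map i z) = (\<Sum>l\<in>I3. harm_coeff i j l * harm_coord l z)"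
proof -
  have "(\<lambda>n. harm_iter (Suc n) j (gasket_map i z)) \<longlonglongrightarrow> harm_coord j (gasket_map i z)"
    by (intro LIMSEQ_Suc harm_coord_limit gasket_map_in assms)
  then have "(\<lambda>n. \<Sum>l\<in>I3. harm_coeff i j l * harm_iter n l z) \<longlonglongrightarrow> harm_coord j (gasket_map i z)"
    by (simp only: harm_iter_map[OF assms])
  moreover have "(\<lambda>n. \<Sum>l\<in>I3. harm_coeff i j l * harm_iter n l z) \<longlonglongrightarrow> (\<Sum>l\<in>I3. harm_coeff i j l * harm_coord l z)"
    by (intro tendsto_intros harm_coord_limit assms)
  ultimately show ?thesis by (rule LIMSEQ_unique)
qed

subsection \<open>Splines interpolating on the vertices of level n\<close>

text \<open>The function that agrees with \<open>g\<close> at the vertices of level \<open>n\<close> and is harmonic in each cell of that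
level.\<close>

fun spline :: "nat \<Rightarrow> (complex \<Rightarrow> real) \<Rightarrow> complex \<Rightarrow> real" where
  "spline 0 g = (\<lambda>z. \<Sum>j\<in>I3. g (corner j) * harm_coord j z)"
| "spline (Suc n) g = paste (\<lambda>i. spline n (\<lambda>z. g (gasket_map i z)))"

lemma spline_corner: "m \<in> I3 \<Longrightarrow> spline n g (corner m) = g (corner m)"
  and spline_compatible: "junction_compatible (\<lambda>i. spline n (\<lambda>z. g (gasket_map i z)))"
proof -
  have comp: "junction_compatible (\<lambda>i. spline n (\<lambda>z. g (gasket_map i z)))"
    if h: "\<And>g m. m \<in> I3 \<Longrightarrow> spline n g (corner m) = g (corner m)" for n g
    unfolding junction_compatible_def by (intro ballI) (simp only: h, simp only: gasket_map_junction)
  have corner: "m \<in> I3 \<Longrightarrow> spline n g (corner m) = g (corner m)" for n g m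
  proof (induction n arbitrary: g m)
    case 0
    have "spline 0 g (corner m) = (\<Sum>j\<in>I3. if j = m then g (corner j) else 0)"
      unfolding spline.simps by (rule sum.cong[OF refl]) (simp only: harm_coord_corner 0, simp)
    also have "\<dots> = g (corner m)" using 0 by (simp only: sum_I3_delta)
    finally show ?case .
  next
    case (Suc n)
    show ?case
      by (simp only: spline.simps paste_corner[OF comp[OF Suc.IH] Suc.prems] Suc.IH[OF Suc.prems] gasket_map_corner)
  qed
  show "m \<in> I3 \<Longrightarrow> spline n g (corner m) = g (corner m)" by (rule corner)
  show "junction_compatible (\<lambda>i. spline n (\<lambda>z. g (gasket_map i z)))" by (rule comp[OF corner])
qed

lemma spline_map:
  assumes "i \<in> I3" "z \<in> gasket"
  shows "spline (Suc n) g (gasket_map i z) = spline n (\<lambda>z. g (gasket_map i z)) z"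
  by (simp only: spline.simps paste_map[OF spline_compatible assms])

lemma continuous_on_spline: "continuous_on gasket (spline n g)"
proof (induction n arbitrary: g)
  case 0 show ?case unfolding spline.simps by (intro continuous_intros continuous_on_harm_coord)
next
  case (Suc n) show ?case unfolding spline.simps by (intro continuous_on_paste spline_compatible Suc)
qed

lemma spline_word_map:
  assumes "w \<in> gasket_words n" "z \<in> gasket"
  shows "spline n g (gasket_word_map w z) = (\<Sum>j\<in>I3. g (gasket_word_map w (corner j)) * harm_coord j z)"
  using assms(1)
proof (induction w arbitrary: n g)
  case Nil then show ?case by (simp add: gasket_words_def)
next
  case (Cons i w)
  then obtain m where n: "n = Suc m" "i \<in> I3" "w \<in> gasket_words m"
    by (cases n) (auto simp: gasket_words_def)
  show ?case unfolding n(1) gasket_word_map_Cons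
    by (simp only: spline_map[OF n(2) gasket_word_map_in[OF assms(2) n(3)]] Cons.IH[OF n(3)])
qed

text \<open>The harmonic coordinates are nonnegative with sum 1, so this is a convex combination.\<close>

lemma harm_coord_convex_bound:
  assumes "z \<in> gasket" "\<And>j. j \<in> I3 \<Longrightarrow> \<bar>c j\<bar> \<le> a"
  shows "\<bar>\<Sum>j\<in>I3. c j * harm_coord j z\<bar> \<le> a"
proof -
  have "\<bar>\<Sum>j\<in>I3. c j * harm_coord j z\<bar> \<le> (\<Sum>j\<in>I3. \<bar>c j * harm_coord j z\<bar>)" by (rule sum_abs)
  also have "\<dots> \<le> (\<Sum>j\<in>I3. a * harm_coord j z)"
    by (rule sum_mono) (use assms harm_coord_nonneg in \<open>simp only: abs_mult abs_of_nonneg mult_right_mono\<close>)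
  also have "\<dots> = a" by (simp only: sum_distrib_left[symmetric] harm_coord_sum[OF assms(1)] mult_1_right)
  finally show ?thesis .
qed

lemma spline_bound:
  assumes "\<And>w j. w \<in> gasket_words n \<Longrightarrow> j \<in> I3 \<Longrightarrow> \<bar>g (gasket_word_map w (corner j))\<bar> \<le> a" "z \<in> gasket"
  shows "\<bar>spline n g z\<bar> \<le> a"
proof -
  obtain w y where w: "w \<in> gasket_words n" "y \<in> gasket" "z = gasket_word_map w y" using gasket_cover[OF assms(2)] by blast
  show ?thesis unfolding w(3) spline_word_map[OF w(1,2)] by (rule harm_coord_convex_bound[OF w(2) assms(1)[OF w(1)]])
qed

subsection \<open>Transplanting a function into one cell\<close>

text \<open>A copy of \<open>\<phi>\<close> in the cell of the word \<open>w\<close>, continued by 0. If \<open>\<phi>\<close> vanishes at the corners, the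
continuation is continuous.\<close>

fun bump :: "nat list \<Rightarrow> (complex \<Rightarrow> real) \<Rightarrow> complex \<Rightarrow> real" where
  "bump [] \<phi> = \<phi>"
| "bump (i # w) \<phi> = paste (\<lambda>j. if j = i then bump w \<phi> else (\<lambda>_. 0))"

context
  fixes \<phi> :: "complex \<Rightarrow> real"
  assumes \<phi>: "\<And>i. i \<in> I3 \<Longrightarrow> \<phi> (corner i) = 0" and cont: "continuous_on gasket \<phi>"
begin

lemma bump_corner: "m \<in> I3 \<Longrightarrow> bump w \<phi> (corner m) = 0"
  and bump_compatible: "junction_compatible (\<lambda>j. if j = i then bump w \<phi> else (\<lambda>_. 0))"
proof -
  have comp: "junction_compatible (\<lambda>j. if j = i then bump w \<phi> else (\<lambda>_. 0))"
    if "\<And>m. m \<in> I3 \<Longrightarrow> bump w \<phi> (corner m) = 0" for w i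
    unfolding junction_compatible_def
  proof (intro ballI)
    fix a b assume "a \<in> I3" "b \<in> I3"
    from that[OF this(1)] that[OF this(2)]
    show "(if a = i then bump w \<phi> else (\<lambda>_. 0)) (corner b) = (if b = i then bump w \<phi> else (\<lambda>_. 0)) (corner a)"
      by (cases "a = i"; cases "b = i") simp_all
  qed
  have corner: "m \<in> I3 \<Longrightarrow> bump w \<phi> (corner m) = 0" for w m
  proof (induction w arbitrary: m)
    case (Cons i w)
    have "bump (i # w) \<phi> (corner m) = (if m = i then bump w \<phi> else (\<lambda>_. 0)) (corner m)"
      unfolding bump.simps by (rule paste_corner[OF comp Cons.prems]) (rule Cons.IH)
    then show ?case using Cons.IH[OF Cons.prems] by (cases "m = i") simp_all
  next
    case Nil
    show ?case unfolding bump.simps by (rule \<phi>[OF Nil])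
  qed
  show "m \<in> I3 \<Longrightarrow> bump w \<phi> (corner m) = 0" by (rule corner)
  show "junction_compatible (\<lambda>j. if j = i then bump w \<phi> else (\<lambda>_. 0))" by (rule comp[OF corner])
qed

lemma bump_map:
  assumes "j \<in> I3" "z \<in> gasket"
  shows "bump (i # w) \<phi> (gasket_map j z) = (if j = i then bump w \<phi> z else 0)"
  by (simp only: bump.simps paste_map[OF bump_compatible assms]) simp

lemma continuous_on_bump: "continuous_on gasket (bump w \<phi>)"
proof (induction w)
  case (Cons i w)
  show ?case unfolding bump.simps
    by (intro continuous_on_paste bump_compatible) (simp add: Cons.IH)
qed (simp add: cont)

lemma bump_word_map:
  assumes "w \<in> gasket_words n" "z \<in> gasket" shows "bump w \<phi> (gasket_word_map w z) = \<phi> z"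
  using assms(1)
proof (induction w arbitrary: n)
  case (Cons i w)
  then obtain m where n: "n = Suc m" "i \<in> I3" "w \<in> gasket_words m"
    by (cases n) (auto simp: gasket_words_def)
  show ?case unfolding gasket_word_map_Cons
    by (simp only: bump_map[OF n(2) gasket_word_map_in[OF assms(2) n(3)]] Cons.IH[OF n(3)]) simp
qed simp

lemma bump_outside:
  "z \<in> gasket \<Longrightarrow> z \<notin> gasket_word_map w ` gasket \<Longrightarrow> bump w \<phi> z = 0"
proof (induction w arbitrary: z)
  case Nil then show ?case by (simp add: image_def)
next
  case (Cons i w)
  obtain j y where y: "j \<in> I3" "y \<in> gasket" "z = gasket_map j y" using gasket_step[OF Cons.prems(1)] .
  have "y \<notin> gasket_word_map w ` gasket" if "j = i" using Cons.prems(2) that y(3) by auto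
  then show ?case unfolding y(3) bump_map[OF y(1,2)] using Cons.IH[OF y(2)] by auto
qed

lemma bump_bound:
  assumes a: "\<And>x. x \<in> gasket \<Longrightarrow> \<bar>\<phi> x\<bar> \<le> a" "w \<in> gasket_words n" "z \<in> gasket"
  shows "\<bar>bump w \<phi> z\<bar> \<le> a * indicator (gasket_word_map w ` gasket) z"
proof (cases "z \<in> gasket_word_map w ` gasket")
  case True
  then obtain y where "y \<in> gasket" "z = gasket_word_map w y" by blast
  then show ?thesis using bump_word_map[OF a(2)] a(1) by auto
next
  case False
  then show ?thesis using bump_outside[OF a(3)] by simp
qed

end

text \<open>From here on these functions are only evaluated at points of a given cell, through
\<open>spline_map\<close>, \<open>spline_word_map\<close> and \<open>bump_map\<close>.\<close>

declare spline.simps [simp del] bump.simps [simp del] harm_iter.simps [simp del]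

section \<open>Energies\<close>

lemma gasket_V0_sum: "(\<Sum>x\<in>gasket_V0. f x) = f (corner 1) + f (corner 2) + f (corner 3)"
proof -
  have "inj_on gasket_vertex {0, 1, 2}"
    by (auto simp: inj_on_def corner_simps complex_eq_iff)
  then show ?thesis by (simp add: gasket_V0_def sum.reindex add.assoc)
qed

lemma energy_0:
  "gasket_energy_n 0 f g =
    (f (corner 1) - f (corner 2)) * (g (corner 1) - g (corner 2)) +
    (f (corner 1) - f (corner 3)) * (g (corner 1) - g (corner 3)) +
    (f (corner 2) - f (corner 3)) * (g (corner 2) - g (corner 3))"
  unfolding gasket_energy_n_def gasket_words_0 gasket_V0_sum by (simp add: algebra_simps)

text \<open>The self-similarity of the energy, with resistance factor 5/3. It matches the recursions that define
splines and bump functions, so the identities below are proved by induction on the level.\<close>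

lemma energy_Suc:
  "gasket_energy_n (Suc n) f g =
    5 / 3 * (\<Sum>i\<in>I3. gasket_energy_n n (\<lambda>z. f (gasket_map i z)) (\<lambda>z. g (gasket_map i z)))"
  unfolding gasket_energy_n_def sum_gasket_words_Suc gasket_word_map_Cons
  by (simp only: sum_I3 power_Suc) (simp add: algebra_simps)

lemma energy_cong:
  assumes "\<And>z. z \<in> gasket \<Longrightarrow> f z = f' z" "\<And>z. z \<in> gasket \<Longrightarrow> g z = g' z"
  shows "gasket_energy_n n f g = gasket_energy_n n f' g'"
proof -
  have "gasket_word_map w x \<in> gasket" if "w \<in> gasket_words n" "x \<in> gasket_V0" for w x
    using that gasket_word_map_in[OF _ that(1)] corner_in_gasket[of 1] corner_in_gasket[of 2] corner_in_gasket[of 3]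
    by (auto simp: gasket_V0_def)
  then show ?thesis unfolding gasket_energy_n_def using assms by (simp cong: sum.cong)
qed

lemma energy_commute: "gasket_energy_n n f g = gasket_energy_n n g f"
  by (simp add: gasket_energy_n_def mult.commute)

lemma energy_nonneg: "gasket_energy_n n f f \<ge> 0"
proof -
  have "0 \<le> (\<Sum>w\<in>gasket_words n. \<Sum>x\<in>gasket_V0. \<Sum>y\<in>gasket_V0.
      (f (gasket_word_map w x) - f (gasket_word_map w y)) * (f (gasket_word_map w x) - f (gasket_word_map w y)))"
    by (intro sum_nonneg zero_le_square)
  then show ?thesis unfolding gasket_energy_n_def by simp
qed

lemma energy_add_left: "gasket_energy_n n (\<lambda>x. f x + f' x) g = gasket_energy_n n f g + gasket_energy_n n f' g"
  unfolding gasket_energy_n_def by (simp add: algebra_simps sum.distrib sum_distrib_left sum_subtractf)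

lemma energy_scale_left: "gasket_energy_n n (\<lambda>x. c * f x) g = c * gasket_energy_n n f g"
  unfolding gasket_energy_n_def by (simp add: algebra_simps sum_distrib_left)

lemma energy_zero_left: "gasket_energy_n n (\<lambda>x. 0) g = 0"
  by (simp add: gasket_energy_n_def)

lemma energy_sum_left: "finite J \<Longrightarrow> gasket_energy_n n (\<lambda>x. \<Sum>j\<in>J. c j * F j x) g = (\<Sum>j\<in>J. c j * gasket_energy_n n (F j) g)"
  by (induction J rule: finite_induct) (simp_all add: energy_zero_left energy_add_left energy_scale_left)

lemma energy_sum:
  assumes "finite J"
  shows "gasket_energy_n n (\<lambda>x. \<Sum>j\<in>J. c j * F j x) (\<lambda>x. \<Sum>j\<in>J. c j * F j x) =
    (\<Sum>j\<in>J. \<Sum>k\<in>J. c j * c k * gasket_energy_n n (F j) (F k))"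
proof -
  have "gasket_energy_n n (F j) (\<lambda>x. \<Sum>k\<in>J. c k * F k x) = (\<Sum>k\<in>J. c k * gasket_energy_n n (F j) (F k))" for j
    by (subst energy_commute) (simp add: energy_sum_left[OF assms] energy_commute[of n "F j"])
  then show ?thesis by (simp add: energy_sum_left[OF assms] sum_distrib_left mult.assoc)
qed

lemma energy_corner_diff: 
  assumes "i \<in> I3" "j \<in> I3"
  shows "(f (corner i) - f (corner j))\<^sup>2 \<le> gasket_energy_n 0 f f"
proof -
  have "(f (corner i) - f (corner j))\<^sup>2 \<in> {0, (f (corner 1) - f (corner 2))\<^sup>2, (f (corner 1) - f (corner 3))\<^sup>2, (f (corner 2) - f (corner 3))\<^sup>2}"
    using assms unfolding I3_cases by (elim disjE) (simp_all add: power2_commute)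
  then show ?thesis unfolding energy_0 power2_eq_square[symmetric] by auto
qed

text \<open>Minimality of the harmonic extension: the energy of level one exceeds that of level zero by
  the energy of the deviation from the 1/5-2/5 rule.\<close>

lemma energy_0_le_1: "gasket_energy_n 0 f f \<le> gasket_energy_n (Suc 0) f f"
proof -
  define a b c where "a = f (corner 1)" and "b = f (corner 2)" and "c = f (corner 3)"
  define x y z where "x = f (gasket_map 1 (corner 2))" and "y = f (gasket_map 1 (corner 3))"
    and "z = f (gasket_map 2 (corner 3))"
  define p q r where "p = x - (2*a + 2*b + c)/5" and "q = y - (2*a + 2*c + b)/5" and "r = z - (2*b + 2*c + a)/5"
  have "gasket_energy_n (Suc 0) f f = 5/3 * (((a-x)*(a-x) + (a-y)*(a-y) + (x-y)*(x-y)) +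
      ((x-b)*(x-b) + (x-z)*(x-z) + (b-z)*(b-z)) + ((y-z)*(y-z) + (y-c)*(y-c) + (z-c)*(z-c)))"
    unfolding energy_Suc sum_I3 energy_0 gasket_map_corner gasket_map_junction[of 2 1]
      gasket_map_junction[of 3 1] gasket_map_junction[of 3 2] a_def b_def c_def x_def y_def z_def by (rule refl)
  also have "\<dots> = ((a-b)*(a-b) + (a-c)*(a-c) + (b-c)*(b-c)) +
      5/3 * (2*p\<^sup>2 + 2*q\<^sup>2 + 2*r\<^sup>2 + (p-q)\<^sup>2 + (p-r)\<^sup>2 + (q-r)\<^sup>2)"
    unfolding p_def q_def r_def by (simp add: power2_eq_square field_simps)
  also have "\<dots> \<ge> (a-b)*(a-b) + (a-c)*(a-c) + (b-c)*(b-c)" by simp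
  finally show ?thesis unfolding energy_0 a_def b_def c_def .
qed

lemma energy_mono_Suc: "gasket_energy_n n f f \<le> gasket_energy_n (Suc n) f f"
proof (induction n arbitrary: f)
  case 0 show ?case by (rule energy_0_le_1)
next
  case (Suc n)
  show ?case unfolding energy_Suc[of "Suc n"] unfolding energy_Suc[of n f f]
    by (intro mult_left_mono sum_mono Suc) auto
qed

lemma energy_mono: "incseq (\<lambda>n. gasket_energy_n n f f)"
  by (rule incseq_SucI) (rule energy_mono_Suc)

lemma energy_le_limit:
  assumes "(\<lambda>n. gasket_energy_n n f f) \<longlonglongrightarrow> E" shows "gasket_energy_n n f f \<le> E"
  using incseq_le[OF energy_mono assms] .

subsection \<open>Splines carry the energy of their level\<close>

lemma spline_0_map:
  assumes "i \<in> I3" "z \<in> gasket"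
  shows "spline 0 g (gasket_map i z) = spline 0 (\<lambda>z. spline 0 g (gasket_map i z)) z"
proof -
  have "spline 0 g (gasket_map i z) = (\<Sum>j\<in>I3. g (corner j) * (\<Sum>l\<in>I3. harm_coeff i j l * harm_coord l z))"
    unfolding spline.simps by (rule sum.cong[OF refl]) (simp only: harm_coord_map assms)
  also have "\<dots> = (\<Sum>l\<in>I3. (\<Sum>j\<in>I3. g (corner j) * harm_coeff i j l) * harm_coord l z)"
    by (simp only: sum_I3) (simp add: algebra_simps)
  also have "\<dots> = (\<Sum>l\<in>I3. spline 0 g (gasket_map i (corner l)) * harm_coord l z)"
  proof (rule sum.cong[OF refl])
    fix l assume l: "l \<in> I3"
    have "spline 0 g (gasket_map i (corner l)) = (\<Sum>j\<in>I3. g (corner j) * harm_coeff i j l)"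
      unfolding spline.simps
    proof (rule sum.cong[OF refl])
      fix j assume j: "j \<in> I3"
      have "harm_coord j (gasket_map i (corner l)) = (\<Sum>m\<in>I3. if m = l then harm_coeff i j m else 0)"
        unfolding harm_coord_map[OF j assms(1) corner_in_gasket[OF l]]
        by (rule sum.cong[OF refl]) (simp only: harm_coord_corner l, simp)
      then show "g (corner j) * harm_coord j (gasket_map i (corner l)) = g (corner j) * harm_coeff i j l"
        by (simp only: sum_I3_delta[OF l])
    qed
    then show "(\<Sum>j\<in>I3. g (corner j) * harm_coeff i j l) * harm_coord l z = spline 0 g (gasket_map i (corner l)) * harm_coord l z"
      by simp
  qed
  finally show ?thesis by (simp only: spline.simps)
qed

lemma spline_0_junction:
  assumes "i \<in> I3" "j \<in> I3" "i \<noteq> j"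
  shows "5 * spline 0 g (gasket_map i (corner j)) = g (corner i) + g (corner j) + (\<Sum>l\<in>I3. g (corner l))"
proof -
  have h: "harm_coord k (gasket_map i (corner j)) = harm_coeff i k j" if k: "k \<in> I3" for k
  proof -
    have "harm_coord k (gasket_map i (corner j)) = (\<Sum>m\<in>I3. if m = j then harm_coeff i k m else 0)"
      unfolding harm_coord_map[OF k assms(1) corner_in_gasket[OF assms(2)]]
      by (rule sum.cong[OF refl]) (simp only: harm_coord_corner assms, simp)
    then show ?thesis by (simp only: sum_I3_delta[OF assms(2)])
  qed
  have "spline 0 g (gasket_map i (corner j)) = (\<Sum>k\<in>I3. g (corner k) * harm_coeff i k j)"
    unfolding spline.simps by (rule sum.cong[OF refl]) (simp only: h)
  then show ?thesis using assms unfolding I3_cases sum_I3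
    by (elim disjE; simp add: harm_coeff_def)
qed

text \<open>For a harmonic function \<open>h\<close> the bilinear form \<open>E\<^sub>1(f, h)\<close> does not see the values of \<open>f\<close> at the three
midpoints, because the 1/5-2/5 rule makes the discrete Laplacian of \<open>h\<close> vanish there.\<close>

lemma energy_spline_0: "gasket_energy_n n f (spline 0 g) = gasket_energy_n 0 f g"
proof (induction n arbitrary: f g)
  case 0
  have "spline 0 g (corner i) = g (corner i)" if "i \<in> I3" for i by (rule spline_corner[OF that])
  from this[of 1] this[of 2] this[of 3] show ?case unfolding energy_0 by simp
next
  case (Suc n)
  let ?h = "spline 0 g"
  have "gasket_energy_n (Suc n) f ?h = 5/3 * (\<Sum>i\<in>I3. gasket_energy_n n (\<lambda>z. f (gasket_map i z)) (spline 0 (\<lambda>z. ?h (gasket_map i z))))"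
    unfolding energy_Suc
    by (intro arg_cong[of _ _ "(*) (5/3)"] sum.cong refl energy_cong spline_0_map)
  also have "\<dots> = 5/3 * (\<Sum>i\<in>I3. gasket_energy_n 0 (\<lambda>z. f (gasket_map i z)) (\<lambda>z. ?h (gasket_map i z)))"
    by (simp only: Suc)
  also have "\<dots> = gasket_energy_n 0 f g"
  proof -
    define a b c where "a = g (corner 1)" and "b = g (corner 2)" and "c = g (corner 3)"
    have x: "?h (gasket_map 1 (corner 2)) = (2*a + 2*b + c)/5" "?h (gasket_map 1 (corner 3)) = (2*a + 2*c + b)/5"
      "?h (gasket_map 2 (corner 3)) = (2*b + 2*c + a)/5"
      using spline_0_junction[of 1 2 g] spline_0_junction[of 1 3 g] spline_0_junction[of 2 3 g]
      unfolding sum_I3 a_def b_def c_def by (simp_all add: field_simps)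
    have y: "?h (corner 1) = a" "?h (corner 2) = b" "?h (corner 3) = c"
      unfolding a_def b_def c_def by (rule spline_corner; simp)+
    show ?thesis
      unfolding energy_0 sum_I3 gasket_map_corner gasket_map_junction[of 2 1]
        gasket_map_junction[of 3 1] gasket_map_junction[of 3 2] x y a_def[symmetric] b_def[symmetric] c_def[symmetric]
      by (simp add: field_simps)
  qed
  finally show ?case .
qed

lemma energy_spline: "k \<le> n \<Longrightarrow> gasket_energy_n n f (spline k g) = gasket_energy_n k f g"
proof (induction k arbitrary: n f g)
  case 0 show ?case by (rule energy_spline_0)
next
  case (Suc k)
  then obtain m where m: "n = Suc m" "k \<le> m" by (cases n) auto
  show ?case unfolding m(1) energy_Suc
  proof (intro arg_cong[of _ _ "(*) (5/3)"] sum.cong refl)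
    fix i assume i: "i \<in> I3"
    show "gasket_energy_n m (\<lambda>z. f (gasket_map i z)) (\<lambda>z. spline (Suc k) g (gasket_map i z)) =
        gasket_energy_n k (\<lambda>z. f (gasket_map i z)) (\<lambda>z. g (gasket_map i z))"
      unfolding Suc.IH[OF m(2), symmetric] by (rule energy_cong[OF refl]) (rule spline_map[OF i])
  qed
qed

text \<open>Only the maps along the word \<open>w\<close> contribute, each with a factor of 5/3.\<close>

lemma energy_bump:
  assumes \<phi>: "\<And>i. i \<in> I3 \<Longrightarrow> \<phi> (corner i) = 0" and cont: "continuous_on gasket \<phi>" and w: "w \<in> gasket_words k"
  shows "gasket_energy_n (n + k) f (bump w \<phi>) = (5/3) ^ k * gasket_energy_n n (\<lambda>z. f (gasket_word_map w z)) \<phi>"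
  using w
proof (induction w arbitrary: k f)
  case Nil then show ?case by (simp add: gasket_words_def bump.simps)
next
  case (Cons i w)
  then obtain m where m: "k = Suc m" "i \<in> I3" "w \<in> gasket_words m"
    by (cases k) (auto simp: gasket_words_def)
  let ?e = "\<lambda>j. gasket_energy_n (n + m) (\<lambda>z. f (gasket_map j z)) (\<lambda>z. bump (i # w) \<phi> (gasket_map j z))"
  have e: "?e j = (if j = i then gasket_energy_n (n + m) (\<lambda>z. f (gasket_map j z)) (bump w \<phi>) else 0)" if j: "j \<in> I3" for j
  proof -
    have "?e j = gasket_energy_n (n + m) (\<lambda>z. f (gasket_map j z)) (\<lambda>z. if j = i then bump w \<phi> z else 0)"
      by (rule energy_cong[OF refl]) (rule bump_map[OF \<phi> cont j])
    then show ?thesis using energy_zero_left[of "n + m" "\<lambda>z. f (gasket_map j z)"]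
      by (simp add: energy_commute)
  qed
  have "gasket_energy_n (n + k) f (bump (i # w) \<phi>) = 5/3 * (\<Sum>j\<in>I3. ?e j)"
    unfolding m(1) add_Suc_right energy_Suc ..
  also have "(\<Sum>j\<in>I3. ?e j) = (\<Sum>j\<in>I3. if j = i then gasket_energy_n (n + m) (\<lambda>z. f (gasket_map j z)) (bump w \<phi>) else 0)"
    by (rule sum.cong[OF refl e])
  also have "\<dots> = gasket_energy_n (n + m) (\<lambda>z. f (gasket_map i z)) (bump w \<phi>)"
    by (rule sum_I3_delta[OF m(2)])
  finally show ?case unfolding Cons.IH[OF m(3)] m(1) by simp
qed

subsection \<open>Test functions at the midpoints of a cell\<close>

text \<open>Testing the energy against this spline, transplanted into a cell, isolates the discrete Laplacian at
one midpoint of the cell.\<close>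

definition tent :: "nat \<Rightarrow> nat \<Rightarrow> complex \<Rightarrow> real" where
  "tent i j = spline 1 (indicator {gasket_map i (corner j)})"

lemma corner_inj: assumes "i \<in> I3" "j \<in> I3" shows "corner i = corner j \<longleftrightarrow> i = j"
proof
  assume "corner i = corner j"
  then have "bary j (corner i) = 1" using bary_corner[OF assms(2,2)] by simp
  then show "i = j" using bary_corner[OF assms(2,1)] by (metis zero_neq_one)
qed simp

lemma corner_neq_junction:
  assumes "i \<in> I3" "j \<in> I3" "k \<in> I3" "i \<noteq> j" shows "corner k \<noteq> gasket_map i (corner j)"
proof
  assume e: "corner k = gasket_map i (corner j)"
  show False
  proof (cases "k = i")
    case True
    then have "gasket_map i (corner i) = gasket_map i (corner j)"
      using trans[OF gasket_map_corner[of i], of "gasket_map i (corner j)"] e by blast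
    then have "corner i = corner j" by (simp only: inj_gasket_map)
    then show False using corner_inj[OF assms(1,2)] assms(4) by blast
  next
    case False
    have "bary k (corner k) = 1" using bary_corner[OF assms(3,3)] by simp
    moreover have "bary k (gasket_map i (corner j)) \<le> 1/2"
      using bary_gasket_map[OF assms(1,3)] bary_corner[OF assms(3,2)] False by (simp split: if_splits)
    ultimately show False using e by simp
  qed
qed

lemma junction_neq_junction:
  assumes "i \<in> I3" "j \<in> I3" "k \<in> I3" "j \<noteq> k" shows "gasket_map i (corner k) \<noteq> gasket_map i (corner j)"
proof
  assume "gasket_map i (corner k) = gasket_map i (corner j)"
  then have "corner k = corner j" by (simp only: inj_gasket_map)
  then show False using corner_inj[OF assms(3,2)] assms(4) by blast
qed

context
  fixes i j :: nat
  assumes ij: "i \<in> I3" "j \<in> I3" "i \<noteq> j"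
begin

lemma tent_corner: "k \<in> I3 \<Longrightarrow> tent i j (corner k) = 0"
  unfolding tent_def using spline_corner[of k 1] corner_neq_junction[OF ij(1,2) _ ij(3)] by (simp add: indicator_def)

lemma continuous_on_tent: "continuous_on gasket (tent i j)"
  unfolding tent_def by (rule continuous_on_spline)

lemma tent_bound: "x \<in> gasket \<Longrightarrow> \<bar>tent i j x\<bar> \<le> 1"
  unfolding tent_def by (rule spline_bound) (auto simp: indicator_def)

lemma energy_tent:
  assumes w: "w \<in> gasket_words k" and n: "n \<ge> Suc k"
  shows "gasket_energy_n n f (bump w (tent i j)) =
    (5/3) ^ k * gasket_energy_n 1 (\<lambda>z. f (gasket_word_map w z)) (indicator {gasket_map i (corner j)})"
proof -
  obtain m where m: "n = m + k" "1 \<le> m" using n by (metis Suc_leD le_add_diff_inverse2 le_diff_conv2 plus_1_eq_Suc)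
  have "gasket_energy_n (m + k) f (bump w (tent i j)) =
      (5/3) ^ k * gasket_energy_n m (\<lambda>z. f (gasket_word_map w z)) (tent i j)"
    by (rule energy_bump[OF _ continuous_on_tent w]) (rule tent_corner)
  then show ?thesis unfolding m(1) tent_def energy_spline[OF m(2)] .
qed

lemma energy_bump_tent_limit:
  assumes w: "w \<in> gasket_words k"
  shows "(\<lambda>n. gasket_energy_n n f (bump w (tent i j))) \<longlonglongrightarrow>
    (5/3) ^ k * gasket_energy_n 1 (\<lambda>z. f (gasket_word_map w z)) (indicator {gasket_map i (corner j)})"
  by (rule tendsto_eventually) (use energy_tent[OF w] in \<open>auto simp: eventually_sequentially intro!: exI[of _ "Suc k"]\<close>)

lemma bump_tent_domain: "w \<in> gasket_words k \<Longrightarrow> bump w (tent i j) \<in> gasket_form_domain"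
  unfolding gasket_form_domain_def
  using continuous_on_bump[OF tent_corner continuous_on_tent] energy_bump_tent_limit convergentI by blast

end

lemma energy_1:
  "gasket_energy_n 1 f g = 5/3 *
    ((f (corner 1) - f (gasket_map 1 (corner 2))) * (g (corner 1) - g (gasket_map 1 (corner 2))) +
     (f (corner 1) - f (gasket_map 1 (corner 3))) * (g (corner 1) - g (gasket_map 1 (corner 3))) +
     (f (gasket_map 1 (corner 2)) - f (gasket_map 1 (corner 3))) * (g (gasket_map 1 (corner 2)) - g (gasket_map 1 (corner 3))) +
     ((f (gasket_map 1 (corner 2)) - f (corner 2)) * (g (gasket_map 1 (corner 2)) - g (corner 2)) +
     (f (gasket_map 1 (corner 2)) - f (gasket_map 2 (corner 3))) * (g (gasket_map 1 (corner 2)) - g (gasket_map 2 (corner 3))) +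
     (f (corner 2) - f (gasket_map 2 (corner 3))) * (g (corner 2) - g (gasket_map 2 (corner 3)))) +
     ((f (gasket_map 1 (corner 3)) - f (gasket_map 2 (corner 3))) * (g (gasket_map 1 (corner 3)) - g (gasket_map 2 (corner 3))) +
     (f (gasket_map 1 (corner 3)) - f (corner 3)) * (g (gasket_map 1 (corner 3)) - g (corner 3)) +
     (f (gasket_map 2 (corner 3)) - f (corner 3)) * (g (gasket_map 2 (corner 3)) - g (corner 3))))"
  using energy_Suc[of 0 f g]
  unfolding sum_I3 energy_0 gasket_map_corner gasket_map_junction[of 2 1]
    gasket_map_junction[of 3 1] gasket_map_junction[of 3 2] by simp

text \<open>The three triples list each midpoint once, with \<open>k\<close> the opposite corner.\<close>

lemma energy_1_indicator:
  assumes "(i, j, k) \<in> {(1, 2, 3), (1, 3, 2), (2, 3, 1)}"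
  shows "gasket_energy_n 1 f (indicator {gasket_map i (corner j)}) =
    5/3 * (4 * f (gasket_map i (corner j)) - f (corner i) - f (corner j)
      - f (gasket_map i (corner k)) - f (gasket_map j (corner k)))"
proof -
  have I: "i \<in> I3" "j \<in> I3" "k \<in> I3" "i \<noteq> j" "j \<noteq> k" "i \<noteq> k" using assms by auto
  define t :: "complex \<Rightarrow> real" where "t = indicator {gasket_map i (corner j)}"
  have t: "t (corner i) = 0" "t (corner j) = 0" "t (corner k) = 0" "t (gasket_map i (corner j)) = 1"
    "t (gasket_map i (corner k)) = 0" "t (gasket_map j (corner k)) = 0"
    using corner_neq_junction[OF I(1,2) _ I(4)] I junction_neq_junction[OF I(1,2,3,5)]
      junction_neq_junction[OF I(2,1,3,6)] gasket_map_junction[of i j]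
    by (auto simp: t_def indicator_def)
  consider "i = 1" "j = 2" "k = 3" | "i = 1" "j = 3" "k = 2" | "i = 2" "j = 3" "k = 1" using assms by auto
  then have "gasket_energy_n 1 f t = 5/3 * (4 * f (gasket_map i (corner j)) - f (corner i) - f (corner j)
      - f (gasket_map i (corner k)) - f (gasket_map j (corner k)))"
  proof cases
    case 1
    note t' = t[unfolded 1 gasket_map_junction[of 2 1] gasket_map_junction[of 3 1] gasket_map_junction[of 3 2]]
    show ?thesis unfolding 1 energy_1 gasket_map_junction[of 2 1] gasket_map_junction[of 3 1] gasket_map_junction[of 3 2] t'
      by (simp only: diff_self mult_zero_right mult_zero_left diff_0_right diff_0 add_0_left add_0_right)
        (simp add: algebra_simps)
  next
    case 2
    note t' = t[unfolded 2 gasket_map_junction[of 2 1] gasket_map_junction[of 3 1] gasket_map_junction[of 3 2]]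
    show ?thesis unfolding 2 energy_1 gasket_map_junction[of 2 1] gasket_map_junction[of 3 1] gasket_map_junction[of 3 2] t'
      by (simp only: diff_self mult_zero_right mult_zero_left diff_0_right diff_0 add_0_left add_0_right)
        (simp add: algebra_simps)
  next
    case 3
    note t' = t[unfolded 3 gasket_map_junction[of 2 1] gasket_map_junction[of 3 1] gasket_map_junction[of 3 2]]
    show ?thesis unfolding 3 energy_1 gasket_map_junction[of 2 1] gasket_map_junction[of 3 1] gasket_map_junction[of 3 2] t'
      by (simp only: diff_self mult_zero_right mult_zero_left diff_0_right diff_0 add_0_left add_0_right)
        (simp add: algebra_simps)
  qed
  then show ?thesis by (simp only: t_def)
qed

section \<open>From vertices to cells\<close>

lemma gasket_words_snoc:
  assumes "v \<in> gasket_words (Suc k)" obtains u l where "u \<in> gasket_words k" "l \<in> I3" "v = u @ [l]"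
proof -
  obtain u l where v: "v = u @ [l]" using assms by (cases v rule: rev_cases) (auto simp: gasket_words_def)
  then show ?thesis using that[of u l] assms by (auto simp: gasket_words_def)
qed

lemma vertices_dense:
  assumes "x \<in> gasket"
  obtains p where "\<And>n. \<exists>w\<in>gasket_words n. p n = gasket_word_map w (corner 1)" "p \<longlonglongrightarrow> x"
proof -
  have "\<exists>w\<in>gasket_words n. \<exists>y\<in>gasket. x = gasket_word_map w y" for n by (rule gasket_cover[OF assms])
  then obtain w y where w: "\<And>n. w n \<in> gasket_words n" "\<And>n. y n \<in> gasket" "\<And>n. x = gasket_word_map (w n) (y n)"
    by metis
  obtain D where D: "\<And>a b. a \<in> gasket \<Longrightarrow> b \<in> gasket \<Longrightarrow> dist a b \<le> D"
    using gasket_diameter by blast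
  have "(\<lambda>n. gasket_word_map (w n) (corner 1)) \<longlonglongrightarrow> x"
  proof (rule metric_tendsto_imp_tendsto)
    show "(\<lambda>n. D * (1/2) ^ n) \<longlonglongrightarrow> 0" by (rule tendsto_mult_right_zero[OF LIMSEQ_power_zero]) simp
    show "\<forall>\<^sub>F n in sequentially. dist (gasket_word_map (w n) (corner 1)) x \<le> dist (D * (1/2) ^ n) 0"
    proof (rule always_eventually, rule allI)
      fix n
      have "dist (gasket_word_map (w n) (corner 1)) x = dist (corner 1) (y n) / 2 ^ n"
        using w(1)[of n] by (subst w(3)[of n]) (simp add: dist_gasket_word_map gasket_words_def)
      also have "\<dots> \<le> D / 2 ^ n" using D[OF corner_in_gasket[of 1] w(2)[of n]] by (intro divide_right_mono) auto
      also have "\<dots> \<le> dist (D * (1/2) ^ n) 0" by (simp add: dist_real_def power_divide divide_right_mono)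
      finally show "dist (gasket_word_map (w n) (corner 1)) x \<le> dist (D * (1/2) ^ n) 0" .
    qed
  qed
  then show ?thesis using that[of "\<lambda>n. gasket_word_map (w n) (corner 1)"] w(1) by blast
qed

text \<open>Adding a symbol to a word moves the chosen vertex along an edge of the next level, so the value there
differs from the value at \<open>corner 1\<close> by at most a partial sum of a geometric series; continuity
extends the bound from the dense set of vertices to all points.\<close>

lemma vertex_osc_imp_osc:
  fixes f :: "complex \<Rightarrow> real"
  assumes cont: "continuous_on gasket f" and r: "0 \<le> r" "r < 1"
    and osc: "\<And>k v i j. v \<in> gasket_words k \<Longrightarrow> i \<in> I3 \<Longrightarrow> j \<in> I3 \<Longrightarrow>
      \<bar>f (gasket_word_map v (corner i)) - f (gasket_word_map v (corner j))\<bar> \<le> a * r ^ k"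
    and x: "x \<in> gasket"
  shows "\<bar>f x - f (corner 1)\<bar> \<le> a / (1 - r)"
proof -
  have a: "0 \<le> a" using osc[of "[]" 0 1 1] by (simp add: gasket_words_0)
  have v: "\<bar>f (gasket_word_map v (corner i)) - f (corner 1)\<bar> \<le> a * (\<Sum>m\<le>k. r ^ m)"
    if "v \<in> gasket_words k" "i \<in> I3" for v k i
    using that
  proof (induction k arbitrary: v i)
    case 0
    then show ?case using osc[of v 0 i 1] by (simp add: gasket_words_0)
  next
    case (Suc k)
    obtain u l where u: "u \<in> gasket_words k" "l \<in> I3" "v = u @ [l]" using gasket_words_snoc[OF Suc.prems(1)] .
    have e: "gasket_word_map v (corner l) = gasket_word_map u (corner l)"
      unfolding u(3) gasket_word_map_append by (simp only: gasket_word_map_Cons gasket_word_map_Nil gasket_map_corner)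
    have "\<bar>f (gasket_word_map v (corner i)) - f (gasket_word_map v (corner l))\<bar> \<le> a * r ^ Suc k"
      by (rule osc[OF Suc.prems u(2)])
    moreover have "\<bar>f (gasket_word_map u (corner l)) - f (corner 1)\<bar> \<le> a * (\<Sum>m\<le>k. r ^ m)" by (rule Suc.IH[OF u(1,2)])
    ultimately show ?case unfolding e sum.atMost_Suc by (simp only: distrib_left) linarith
  qed
  obtain p where p: "\<And>n. \<exists>w\<in>gasket_words n. p n = gasket_word_map w (corner 1)" "p \<longlonglongrightarrow> x"
    using vertices_dense[OF x] by metis
  have "p n \<in> gasket" for n using p(1)[of n] gasket_word_map_in[OF corner_in_gasket[of 1]] by auto
  then have "(\<lambda>n. f (p n)) \<longlonglongrightarrow> f x"
    by (intro continuous_on_tendsto_compose[OF cont p(2) x] always_eventually) auto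
  then have lim: "(\<lambda>n. \<bar>f (p n) - f (corner 1)\<bar>) \<longlonglongrightarrow> \<bar>f x - f (corner 1)\<bar>" by (intro tendsto_intros)
  have "\<bar>f (p n) - f (corner 1)\<bar> \<le> a / (1 - r)" for n
  proof -
    obtain w where w: "w \<in> gasket_words n" "p n = gasket_word_map w (corner 1)" using p(1) by blast
    have "\<bar>f (p n) - f (corner 1)\<bar> \<le> a * (\<Sum>m\<le>n. r ^ m)" unfolding w(2) by (rule v[OF w(1)]) simp
    also have "(\<Sum>m\<le>n. r ^ m) \<le> 1 / (1 - r)"
    proof -
      have "(\<Sum>m\<le>n. r ^ m) = (1 - r ^ Suc n) / (1 - r)" using r by (subst sum_gp0) auto
      also have "\<dots> \<le> 1 / (1 - r)" using r by (intro divide_right_mono) auto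
      finally show ?thesis .
    qed
    finally show ?thesis using a by (simp add: mult_left_mono)
  qed
  then show ?thesis by (intro LIMSEQ_le_const2[OF lim]) auto
qed

lemma vertex_osc_imp_cell_osc:
  fixes f :: "complex \<Rightarrow> real"
  assumes cont: "continuous_on gasket f" and r: "0 \<le> r" "r < 1" and w: "w \<in> gasket_words n"
    and osc: "\<And>k v i j. v \<in> gasket_words k \<Longrightarrow> i \<in> I3 \<Longrightarrow> j \<in> I3 \<Longrightarrow>
      \<bar>f (gasket_word_map (w @ v) (corner i)) - f (gasket_word_map (w @ v) (corner j))\<bar> \<le> a * r ^ k"
    and x: "x \<in> gasket" and y: "y \<in> gasket"
  shows "\<bar>f (gasket_word_map w x) - f (gasket_word_map w y)\<bar> \<le> 2 * a / (1 - r)"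
proof -
  let ?g = "\<lambda>z. f (gasket_word_map w z)"
  have c: "continuous_on gasket ?g"
    using gasket_word_map_in[OF _ w] by (intro continuous_on_compose2[OF cont continuous_on_gasket_word_map]) auto
  have "\<bar>?g z - ?g (corner 1)\<bar> \<le> a / (1 - r)" if "z \<in> gasket" for z
    by (rule vertex_osc_imp_osc[OF c r _ that]) (use osc in \<open>simp only: gasket_word_map_append\<close>)
  from this[OF x] this[OF y] show ?thesis by linarith
qed

lemma energy_words:
  "gasket_energy_n n f g = (5/3) ^ n *
    (\<Sum>w\<in>gasket_words n. gasket_energy_n 0 (\<lambda>z. f (gasket_word_map w z)) (\<lambda>z. g (gasket_word_map w z)))"
proof (induction n arbitrary: f g)
  case (Suc n)
  show ?case unfolding energy_Suc[of n] sum_gasket_words_Suc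
    by (simp only: Suc.IH gasket_word_map_Cons power_Suc sum_distrib_left[symmetric] mult.assoc)
qed (simp add: gasket_words_0)

text \<open>A single edge of level \<open>k\<close> contributes its squared difference times \<open>(5/3)\<^sup>k\<close> to the energy of that
level, so edge differences decay geometrically with ratio \<open>r = sqrt (3/5) \<le> 4/5\<close>. The constant is
\<open>100 = (2 / (1 - 4/5))\<^sup>2\<close>.\<close>

lemma energy_cell_osc:
  assumes cont: "continuous_on gasket f" and E: "\<And>n. gasket_energy_n n f f \<le> E"
    and w: "w \<in> gasket_words n" and x: "x \<in> gasket" and y: "y \<in> gasket"
  shows "(f (gasket_word_map w x) - f (gasket_word_map w y))\<^sup>2 \<le> 100 * (3/5) ^ n * E"
proof -
  define r where "r = sqrt (3/5)"
  have r: "0 \<le> r" "r < 1" "r\<^sup>2 = 3/5" by (auto simp: r_def)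
  have rk: "(r ^ k)\<^sup>2 = (3/5) ^ k" for k
    by (simp only: r(3)[symmetric] power_mult[symmetric] mult.commute)
  have r45: "r \<le> 4/5" unfolding r_def by (rule real_le_lsqrt) (auto simp: power2_eq_square)
  have E0: "0 \<le> E" using E[of 0] energy_nonneg[of 0 f] by linarith
  have vert: "\<bar>f (gasket_word_map v (corner i)) - f (gasket_word_map v (corner j))\<bar> \<le> sqrt E * r ^ k"
    if v: "v \<in> gasket_words k" and ij: "i \<in> I3" "j \<in> I3" for v k i j
  proof -
    have "(f (gasket_word_map v (corner i)) - f (gasket_word_map v (corner j)))\<^sup>2
        \<le> gasket_energy_n 0 (\<lambda>z. f (gasket_word_map v z)) (\<lambda>z. f (gasket_word_map v z))"
      by (rule energy_corner_diff[OF ij])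
    also have "\<dots> \<le> (\<Sum>w\<in>gasket_words k. gasket_energy_n 0 (\<lambda>z. f (gasket_word_map w z)) (\<lambda>z. f (gasket_word_map w z)))"
      by (rule member_le_sum[OF v]) (auto simp: energy_nonneg)
    also have "\<dots> = (3/5) ^ k * gasket_energy_n k f f"
      unfolding energy_words[of k] by (simp add: power_divide)
    also have "\<dots> \<le> (3/5) ^ k * E" by (intro mult_left_mono E) auto
    also have "\<dots> = (sqrt E * r ^ k)\<^sup>2"
      using E0 by (simp add: power_mult_distrib rk)
    finally show ?thesis using E0 r by (simp add: abs_le_square_iff[symmetric])
  qed
  have "\<bar>f (gasket_word_map w x) - f (gasket_word_map w y)\<bar> \<le> 2 * (sqrt E * r ^ n) / (1 - r)"
  proof (rule vertex_osc_imp_cell_osc[OF cont r(1,2) w _ x y])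
    fix k v i j assume "v \<in> gasket_words k" and ij: "i \<in> I3" "j \<in> I3"
    then have wv: "w @ v \<in> gasket_words (n + k)" using gasket_words_append[OF w] by blast
    show "\<bar>f (gasket_word_map (w @ v) (corner i)) - f (gasket_word_map (w @ v) (corner j))\<bar> \<le> sqrt E * r ^ n * r ^ k"
      using vert[OF wv ij] by (simp only: power_add mult.assoc)
  qed
  also have "\<dots> \<le> 2 * (sqrt E * r ^ n) / (1/5)"
    using r r45 E0 by (intro divide_left_mono) auto
  finally have "\<bar>f (gasket_word_map w x) - f (gasket_word_map w y)\<bar> \<le> 10 * (sqrt E * r ^ n)" by simp
  then have "(f (gasket_word_map w x) - f (gasket_word_map w y))\<^sup>2 \<le> (10 * (sqrt E * r ^ n))\<^sup>2"
    by (subst abs_le_square_iff[symmetric]) (use E0 r in simp)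
  also have "\<dots> = 100 * (3/5) ^ n * E"
    using E0 by (simp add: power_mult_distrib rk)
  finally show ?thesis .
qed

section \<open>The form domain\<close>

lemma energy_add_sq:
  "gasket_energy_n n (\<lambda>x. f x + g x) (\<lambda>x. f x + g x) =
    gasket_energy_n n f f + 2 * gasket_energy_n n f g + gasket_energy_n n g g"
  using energy_commute[of n f "\<lambda>x. f x + g x"] energy_commute[of n g "\<lambda>x. f x + g x"] energy_commute[of n g f]
  by (simp add: energy_add_left)

lemma energy_parallelogram:
  "gasket_energy_n n (\<lambda>x. f x + g x) (\<lambda>x. f x + g x) \<le> 2 * gasket_energy_n n f f + 2 * gasket_energy_n n g g"
proof -
  have "0 \<le> gasket_energy_n n (\<lambda>x. f x + (-1) * g x) (\<lambda>x. f x + (-1) * g x)" by (rule energy_nonneg)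
  also have "\<dots> = gasket_energy_n n f f - 2 * gasket_energy_n n f g + gasket_energy_n n g g"
    using energy_commute[of n f "\<lambda>x. (-1) * g x"] energy_commute[of n g "\<lambda>x. (-1) * g x"] energy_commute[of n g f]
    unfolding energy_add_sq energy_scale_left by (simp only: energy_scale_left)
  finally show ?thesis unfolding energy_add_sq by simp
qed

text \<open>The energy of a sum is nondecreasing in the level and bounded by the parallelogram inequality, so it
converges, and polarization gives the mixed terms.\<close>

lemma energy_tendsto:
  assumes f: "f \<in> gasket_form_domain" and g: "g \<in> gasket_form_domain"
  shows "(\<lambda>n. gasket_energy_n n f g) \<longlonglongrightarrow> gasket_energy f g"
proof -
  let ?E = "\<lambda>n h. gasket_energy_n n h h"
  obtain A B where AB: "(\<lambda>n. ?E n f) \<longlonglongrightarrow> A" "(\<lambda>n. ?E n g) \<longlonglongrightarrow> B"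
    using f g by (auto simp: gasket_form_domain_def convergent_def)
  have bd: "?E n (\<lambda>x. f x + g x) \<le> 2 * A + 2 * B" for n
    using energy_parallelogram[of n f g] energy_le_limit[OF AB(1), of n] energy_le_limit[OF AB(2), of n] by linarith
  obtain C where C: "(\<lambda>n. ?E n (\<lambda>x. f x + g x)) \<longlonglongrightarrow> C"
    using incseq_convergent[OF energy_mono] bd by blast
  have "(\<lambda>n. (?E n (\<lambda>x. f x + g x) - ?E n f - ?E n g) / 2) \<longlonglongrightarrow> (C - A - B) / 2"
    by (intro tendsto_intros C AB) auto
  then have "(\<lambda>n. gasket_energy_n n f g) \<longlonglongrightarrow> (C - A - B) / 2" unfolding energy_add_sq by simp
  then show ?thesis unfolding gasket_energy_def by (simp add: limI)
qed

section \<open>Oscillation of functions with bounded Laplacian\<close>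

lemma bounded_integral_bump:
  fixes h g :: "complex \<Rightarrow> real"
  assumes h: "h \<in> borel_measurable gasket_measure" "\<And>x. x \<in> gasket \<Longrightarrow> \<bar>h x\<bar> \<le> B"
    and g: "g \<in> borel_measurable gasket_measure" "\<And>x. x \<in> gasket \<Longrightarrow> \<bar>g x\<bar> \<le> indicator (gasket_word_map w ` gasket) x"
    and w: "w \<in> gasket_words k"
  shows "\<bar>\<integral>x. h x * g x \<partial>gasket_measure\<bar> \<le> B / 3 ^ k"
proof -
  have [measurable]: "gasket_word_map w ` gasket \<in> sets gasket_measure"
    using cell_in_sets[OF w] by (simp only: sets_gasket_measure)
  note [measurable] = h(1) g(1)
  have "\<bar>h (corner 1)\<bar> \<le> B" by (rule h(2)[OF corner_in_gasket]) simp
  then have B: "0 \<le> B" by linarith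
  have bd: "\<bar>h x * g x\<bar> \<le> B * indicator (gasket_word_map w ` gasket) x" if "x \<in> gasket" for x
    unfolding abs_mult using h(2)[OF that] g(2)[OF that] B by (intro mult_mono) auto
  have int: "integrable gasket_measure (\<lambda>x. B * indicator (gasket_word_map w ` gasket) x :: real)"
    by (intro integrable_mult_right integrable_real_indicator) (auto simp: gm.emeasure_eq_measure)
  have int2: "integrable gasket_measure (\<lambda>x. h x * g x)"
    by (rule Bochner_Integration.integrable_bound[OF int]) (auto simp: bd intro!: order_trans[OF bd])
  have "\<bar>\<integral>x. h x * g x \<partial>gasket_measure\<bar> \<le> (\<integral>x. \<bar>h x * g x\<bar> \<partial>gasket_measure)" by (rule integral_abs_bound)
  also have "\<dots> \<le> (\<integral>x. B * indicator (gasket_word_map w ` gasket) x \<partial>gasket_measure)"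
    by (rule integral_mono[OF integrable_abs[OF int2] int]) (simp add: bd)
  also have "\<dots> = B / 3 ^ k"
    using gasket_word_map_in[OF _ w] measure_cell[OF w] by (simp add: Int_absorb2 image_subset_iff)
  finally show ?thesis .
qed

text \<open>A weak solution of \<open>-\<Delta> f = h\<close> with a bounded right-hand side.\<close>

locale bounded_laplacian =
  fixes f h :: "complex \<Rightarrow> real" and B :: real
  assumes cont: "continuous_on gasket f"
    and h_meas: "h \<in> borel_measurable gasket_measure" and h_bound: "\<And>x. x \<in> gasket \<Longrightarrow> \<bar>h x\<bar> \<le> B"
    and weak: "\<And>g. g \<in> gasket_form_domain \<Longrightarrow>
      (\<lambda>n. gasket_energy_n n f g) \<longlonglongrightarrow> (\<integral>x. h x * g x \<partial>gasket_measure)"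
begin

lemma B_nonneg: "0 \<le> B"
proof -
  have "\<bar>h (corner 1)\<bar> \<le> B" by (rule h_bound[OF corner_in_gasket]) simp
  then show ?thesis by linarith
qed

text \<open>The weak equation is tested with a tent function in the cell. The energy side is the discrete
Laplacian at the midpoint times \<open>(5/3)\<^sup>n\<^sup>+\<^sup>1\<close>; the other side is at most \<open>B\<close> times the mass \<open>3\<^sup>-\<^sup>n\<close> of
the cell.\<close>

lemma midpoint_defect:
  assumes ijk: "(i, j, k) \<in> {(1, 2, 3), (1, 3, 2), (2, 3, 1)}" and w: "w \<in> gasket_words n"
  defines "F \<equiv> \<lambda>z. f (gasket_word_map w z)"
  shows "\<bar>4 * F (gasket_map i (corner j)) - F (corner i) - F (corner j)
      - F (gasket_map i (corner k)) - F (gasket_map j (corner k))\<bar> \<le> 3/5 * (B / 5 ^ n)" (is "\<bar>?S\<bar> \<le> _")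
proof -
  have ij: "i \<in> I3" "j \<in> I3" "i \<noteq> j" using ijk by auto
  let ?g = "bump w (tent i j)"
  have "(5/3) ^ n * (5/3 * ?S) = (\<integral>x. h x * ?g x \<partial>gasket_measure)"
    using LIMSEQ_unique[OF energy_bump_tent_limit[OF ij w] weak[OF bump_tent_domain[OF ij w]]]
    unfolding energy_1_indicator[OF ijk] F_def .
  moreover have "\<bar>\<integral>x. h x * ?g x \<partial>gasket_measure\<bar> \<le> B / 3 ^ n"
  proof (rule bounded_integral_bump[OF h_meas h_bound _ _ w])
    have c: "continuous_on gasket ?g"
      by (rule continuous_on_bump[OF _ continuous_on_tent[OF ij]]) (rule tent_corner[OF ij])
    then show "?g \<in> borel_measurable gasket_measure" by (rule continuous_borel_gasket)
    show "\<bar>?g x\<bar> \<le> indicator (gasket_word_map w ` gasket) x" if "x \<in> gasket" for x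
    proof -
      have "\<bar>?g x\<bar> \<le> 1 * indicator (gasket_word_map w ` gasket) x"
        by (rule bump_bound[OF _ continuous_on_tent[OF ij] _ w that]) (rule tent_corner[OF ij] tent_bound[OF ij], assumption)+
      then show ?thesis by simp
    qed
  qed
  ultimately have "\<bar>(5/3) ^ n * (5/3 * ?S)\<bar> \<le> B / 3 ^ n" by (simp only:)
  then have "(5/3) ^ n * (5/3 * \<bar>?S\<bar>) \<le> B / 3 ^ n" by (simp only: abs_mult) simp
  then show ?thesis by (simp add: field_simps)
qed

text \<open>Solving the three midpoint relations shows that the midpoint values follow the 1/5-2/5 rule up to
half of the defect. Under the exact rule every edge of a subcell has at most 3/5 of the oscillation.\<close>

lemma child_osc:
  assumes w: "w \<in> gasket_words n" and l: "l \<in> I3" and ij: "i \<in> I3" "j \<in> I3"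
    and o: "\<And>i j. i \<in> I3 \<Longrightarrow> j \<in> I3 \<Longrightarrow> \<bar>f (gasket_word_map w (corner i)) - f (gasket_word_map w (corner j))\<bar> \<le> e"
  shows "\<bar>f (gasket_word_map (w @ [l]) (corner i)) - f (gasket_word_map (w @ [l]) (corner j))\<bar>
    \<le> 3/5 * e + 3/5 * (B / 5 ^ n)"
proof -
  define F where "F = (\<lambda>z. f (gasket_word_map w z))"
  define d where "d = 3/5 * (B / 5 ^ n)"
  define a b c where "a = F (corner 1)" and "b = F (corner 2)" and "c = F (corner 3)"
  define x y z where "x = F (gasket_map 1 (corner 2))" and "y = F (gasket_map 1 (corner 3))"
    and "z = F (gasket_map 2 (corner 3))"
  have d0: "0 \<le> d" using B_nonneg by (simp add: d_def)
  have e0: "\<bar>a - b\<bar> \<le> e" "\<bar>a - c\<bar> \<le> e" "\<bar>b - c\<bar> \<le> e"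
    unfolding a_def b_def c_def F_def by (rule o; simp)+
  have x: "\<bar>4 * x - a - b - y - z\<bar> \<le> d" using midpoint_defect[OF _ w, of 1 2 3]
    unfolding x_def y_def z_def a_def b_def F_def d_def by simp
  have y: "\<bar>4 * y - a - c - x - z\<bar> \<le> d" using midpoint_defect[OF _ w, of 1 3 2]
    unfolding x_def y_def z_def a_def c_def F_def d_def gasket_map_junction[of 3 2] by simp
  have z: "\<bar>4 * z - b - c - x - y\<bar> \<le> d" using midpoint_defect[OF _ w, of 2 3 1]
    unfolding x_def y_def z_def b_def c_def F_def d_def gasket_map_junction[of 2 1] gasket_map_junction[of 3 1] by simp
  have "\<bar>F (gasket_map l (corner i)) - F (gasket_map l (corner j))\<bar> \<le> 3/5 * e + d"
  proof -
    \<comment> \<open>The matrix of the three relations is inverted, with denominators cleared by the factor 10.\<close>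
    have u: "\<bar>10 * x - (4 * a + 4 * b + 2 * c)\<bar> \<le> 5 * d" "\<bar>10 * y - (4 * a + 4 * c + 2 * b)\<bar> \<le> 5 * d"
      "\<bar>10 * z - (4 * b + 4 * c + 2 * a)\<bar> \<le> 5 * d"
    proof -
      define s t r where "s = 4 * x - a - b - y - z" and "t = 4 * y - a - c - x - z" and "r = 4 * z - b - c - x - y"
      have eq: "10 * x - (4 * a + 4 * b + 2 * c) = 3 * s + t + r" "10 * y - (4 * a + 4 * c + 2 * b) = s + 3 * t + r"
        "10 * z - (4 * b + 4 * c + 2 * a) = s + t + 3 * r"
        by (simp_all add: s_def t_def r_def)
      have b: "\<bar>s\<bar> \<le> d" "\<bar>t\<bar> \<le> d" "\<bar>r\<bar> \<le> d" using x y z by (simp_all add: s_def t_def r_def)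
      show "\<bar>10 * x - (4 * a + 4 * b + 2 * c)\<bar> \<le> 5 * d" unfolding eq using b by linarith
      show "\<bar>10 * y - (4 * a + 4 * c + 2 * b)\<bar> \<le> 5 * d" unfolding eq using b by linarith
      show "\<bar>10 * z - (4 * b + 4 * c + 2 * a)\<bar> \<le> 5 * d" unfolding eq using b by linarith
    qed
    have D: "\<bar>a - x\<bar> \<le> 3/5 * e + d" "\<bar>a - y\<bar> \<le> 3/5 * e + d" "\<bar>x - y\<bar> \<le> 3/5 * e + d"
      "\<bar>x - b\<bar> \<le> 3/5 * e + d" "\<bar>x - z\<bar> \<le> 3/5 * e + d" "\<bar>b - z\<bar> \<le> 3/5 * e + d"
      "\<bar>y - z\<bar> \<le> 3/5 * e + d" "\<bar>y - c\<bar> \<le> 3/5 * e + d" "\<bar>z - c\<bar> \<le> 3/5 * e + d"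
    proof -
      show "\<bar>a - x\<bar> \<le> 3/5 * e + d" using u(1) e0 d0 by linarith
      show "\<bar>a - y\<bar> \<le> 3/5 * e + d" using u(2) e0 d0 by linarith
      show "\<bar>x - y\<bar> \<le> 3/5 * e + d" using u(1,2) e0 d0 by linarith
      show "\<bar>x - b\<bar> \<le> 3/5 * e + d" using u(1) e0 d0 by linarith
      show "\<bar>x - z\<bar> \<le> 3/5 * e + d" using u(1,3) e0 d0 by linarith
      show "\<bar>b - z\<bar> \<le> 3/5 * e + d" using u(3) e0 d0 by linarith
      show "\<bar>y - z\<bar> \<le> 3/5 * e + d" using u(2,3) e0 d0 by linarith
      show "\<bar>y - c\<bar> \<le> 3/5 * e + d" using u(2) e0 d0 by linarith
      show "\<bar>z - c\<bar> \<le> 3/5 * e + d" using u(3) e0 d0 by linarith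
    qed
    have nn: "0 \<le> 3/5 * e + d" using D(1) by linarith
    have V: "F (gasket_map 1 (corner 1)) = a" "F (gasket_map 1 (corner 2)) = x" "F (gasket_map 1 (corner 3)) = y"
      "F (gasket_map 2 (corner 1)) = x" "F (gasket_map 2 (corner 2)) = b" "F (gasket_map 2 (corner 3)) = z"
      "F (gasket_map 3 (corner 1)) = y" "F (gasket_map 3 (corner 2)) = z" "F (gasket_map 3 (corner 3)) = c"
      unfolding a_def b_def c_def x_def y_def z_def gasket_map_corner gasket_map_junction[of 2 1]
        gasket_map_junction[of 3 1] gasket_map_junction[of 3 2] by (rule refl)+
    show ?thesis using l ij unfolding I3_cases
      by (elim disjE) (simp_all only: V diff_self abs_zero, (rule D nn | subst abs_minus_commute, rule D)+)
  qed
  then show ?thesis unfolding F_def d_def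
    by (simp only: gasket_word_map_append gasket_word_map_Cons gasket_word_map_Nil)
qed

text \<open>Per level the oscillation is multiplied by 3/5 and \<open>(3/5) B / 5\<^sup>n\<close> is added. The inhomogeneity
decays with 1/5, so that \<open>oscillation + (3/2) B / 5\<^sup>n\<close> is multiplied by at most 3/5; this explains the
constant 3/2.\<close>

lemma descendant_osc:
  assumes w: "w \<in> gasket_words n"
    and o: "\<And>i j. i \<in> I3 \<Longrightarrow> j \<in> I3 \<Longrightarrow> \<bar>f (gasket_word_map w (corner i)) - f (gasket_word_map w (corner j))\<bar> \<le> e"
    and v: "v \<in> gasket_words k" and ij: "i \<in> I3" "j \<in> I3"
  shows "\<bar>f (gasket_word_map (w @ v) (corner i)) - f (gasket_word_map (w @ v) (corner j))\<bar>
    \<le> (3/5) ^ k * (e + 3/2 * (B / 5 ^ n)) - 3/2 * (B / 5 ^ (n + k))"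
  using v ij
proof (induction k arbitrary: v i j)
  case 0
  then show ?case using o by (simp add: gasket_words_0)
next
  case (Suc k)
  obtain u l where u: "u \<in> gasket_words k" "l \<in> I3" "v = u @ [l]" using gasket_words_snoc[OF Suc.prems(1)] .
  define q where "q = B / 5 ^ (n + k)"
  have q: "0 \<le> q" using B_nonneg by (simp add: q_def)
  have "\<bar>f (gasket_word_map ((w @ u) @ [l]) (corner i)) - f (gasket_word_map ((w @ u) @ [l]) (corner j))\<bar>
      \<le> 3/5 * ((3/5) ^ k * (e + 3/2 * (B / 5 ^ n)) - 3/2 * q) + 3/5 * q"
    unfolding q_def by (rule child_osc[OF gasket_words_append[OF w u(1)] u(2) Suc.prems(2,3) Suc.IH[OF u(1)]])
  also have "\<dots> = (3/5) ^ Suc k * (e + 3/2 * (B / 5 ^ n)) - 3/2 * (q / 5)" by (simp add: field_simps)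
  also have "q / 5 = B / 5 ^ (n + Suc k)" by (simp add: q_def)
  finally show ?case unfolding u(3) append_assoc .
qed

lemma cell_osc:
  assumes w: "w \<in> gasket_words n" and v: "v \<in> gasket_words k" and x: "x \<in> gasket" and y: "y \<in> gasket"
    and o: "\<And>i j. i \<in> I3 \<Longrightarrow> j \<in> I3 \<Longrightarrow> \<bar>f (gasket_word_map w (corner i)) - f (gasket_word_map w (corner j))\<bar> \<le> e"
  shows "\<bar>f (gasket_word_map (w @ v) x) - f (gasket_word_map (w @ v) y)\<bar> \<le> 5 * ((3/5) ^ k * (e + 3/2 * (B / 5 ^ n)))"
proof -
  let ?a = "(3/5) ^ k * (e + 3/2 * (B / 5 ^ n))"
  have "\<bar>f (gasket_word_map (w @ v) x) - f (gasket_word_map (w @ v) y)\<bar> \<le> 2 * ?a / (1 - 3/5)"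
  proof (rule vertex_osc_imp_cell_osc[OF cont _ _ gasket_words_append[OF w v] _ x y])
    fix m u i j assume u: "u \<in> gasket_words m" and ij: "i \<in> I3" "j \<in> I3"
    have "\<bar>f (gasket_word_map (w @ (v @ u)) (corner i)) - f (gasket_word_map (w @ (v @ u)) (corner j))\<bar>
        \<le> (3/5) ^ (k + m) * (e + 3/2 * (B / 5 ^ n)) - 3/2 * (B / 5 ^ (n + (k + m)))"
      by (rule descendant_osc[OF w o gasket_words_append[OF v u] ij])
    also have "\<dots> \<le> ?a * (3/5) ^ m" using B_nonneg by (simp add: power_add mult.commute mult.left_commute)
    finally show "\<bar>f (gasket_word_map ((w @ v) @ u) (corner i)) - f (gasket_word_map ((w @ v) @ u) (corner j))\<bar> \<le> ?a * (3/5) ^ m"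
      by (simp only: append_assoc)
  qed auto
  then show ?thesis by simp
qed

end

section \<open>Spectral estimates\<close>

locale gasket_spectral =
  fixes lam :: "nat \<Rightarrow> real" and Phi :: "nat \<Rightarrow> complex \<Rightarrow> real"
  assumes eigenbasis: "gasket_eigenbasis lam Phi"
begin

lemma lam_pos: "0 < lam j"
  using eigenbasis unfolding gasket_eigenbasis_def by (meson le0 less_le_trans monoD)

lemma lam_mono: "i \<le> j \<Longrightarrow> lam i \<le> lam j"
  using eigenbasis unfolding gasket_eigenbasis_def by (blast dest: monoD)

lemma Phi_cont: "continuous_on gasket (Phi j)"
  using eigenbasis unfolding gasket_eigenbasis_def by blast

lemma Phi_L2_0: "Phi j \<in> gasket_L2_0"
  using eigenbasis unfolding gasket_eigenbasis_def by blast

lemma Phi_orthonormal: "gasket_inner (Phi i) (Phi j) = (if i = j then 1 else 0)"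
  using eigenbasis unfolding gasket_eigenbasis_def by blast

lemma Phi_domain: "Phi j \<in> gasket_form_domain"
  using eigenbasis unfolding gasket_eigenbasis_def gasket_laplacian_def by blast

lemma Phi_energy: "g \<in> gasket_form_domain \<Longrightarrow> gasket_energy (Phi j) g = lam j * gasket_inner (Phi j) g"
  using eigenbasis unfolding gasket_eigenbasis_def gasket_laplacian_def gasket_inner_def
  by (simp add: mult.assoc)

lemma Phi_meas [measurable]: "Phi j \<in> borel_measurable gasket_measure"
  by (rule continuous_borel_gasket[OF Phi_cont])

lemma Phi_mult_integrable: "g \<in> borel_measurable gasket_measure \<Longrightarrow> integrable gasket_measure g \<Longrightarrow>
  integrable gasket_measure (\<lambda>x. Phi j x * g x)"
proof -
  assume g: "g \<in> borel_measurable gasket_measure" "integrable gasket_measure g"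
  obtain B where B: "B \<ge> 0" "\<And>x. x \<in> gasket \<Longrightarrow> \<bar>Phi j x\<bar> \<le> B" using continuous_gasket_bounded[OF Phi_cont[of j]] by metis
  note [measurable] = g(1)
  have "integrable gasket_measure (\<lambda>x. B * g x)" using g(2) by simp
  then show ?thesis
    by (rule Bochner_Integration.integrable_bound) (auto simp: abs_mult B intro!: mult_right_mono)
qed

lemma continuous_integrable: "continuous_on gasket g \<Longrightarrow> integrable gasket_measure g" for g :: "complex \<Rightarrow> real"
proof -
  assume g: "continuous_on gasket g"
  obtain B where B: "B \<ge> 0" "\<And>x. x \<in> gasket \<Longrightarrow> \<bar>g x\<bar> \<le> B" using continuous_gasket_bounded[OF g] by metis
  show ?thesis by (rule gm.integrable_const_bound[of _ B]) (use B continuous_borel_gasket[OF g] in auto)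
qed

text \<open>Sums over finite sets of indices with \<open>\<lambda>\<^sub>j \<le> 5\<^sup>n\<close> play the role of band-limited functions.\<close>

definition eigensum :: "nat set \<Rightarrow> (nat \<Rightarrow> real) \<Rightarrow> complex \<Rightarrow> real" where
  "eigensum J c x = (\<Sum>j\<in>J. c j * Phi j x)"

lemma eigensum_cont: "continuous_on gasket (eigensum J c)"
  unfolding eigensum_def[abs_def] by (intro continuous_intros Phi_cont)

lemma eigensum_integral_mult:
  assumes "continuous_on gasket g"
  shows "(\<integral>x. eigensum J c x * g x \<partial>gasket_measure) = (\<Sum>j\<in>J. c j * gasket_inner (Phi j) g)"
proof -
  have i: "integrable gasket_measure (\<lambda>x. c j * (Phi j x * g x))" for j
    by (intro integrable_mult_right Phi_mult_integrable continuous_borel_gasket continuous_integrable assms)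
  have "(\<integral>x. eigensum J c x * g x \<partial>gasket_measure) = (\<integral>x. (\<Sum>j\<in>J. c j * (Phi j x * g x)) \<partial>gasket_measure)"
    by (simp add: eigensum_def sum_distrib_right mult.assoc)
  also have "\<dots> = (\<Sum>j\<in>J. c j * gasket_inner (Phi j) g)"
    by (subst Bochner_Integration.integral_sum[OF i]) (simp add: gasket_inner_def)
  finally show ?thesis .
qed

lemma eigensum_norm: "finite J \<Longrightarrow> (\<integral>x. (eigensum J c x)\<^sup>2 \<partial>gasket_measure) = (\<Sum>j\<in>J. (c j)\<^sup>2)"
proof -
  assume J: "finite J"
  have i: "gasket_inner (Phi j) (eigensum J c) = (if j \<in> J then c j else 0)" for j
  proof -
    have "gasket_inner (Phi j) (eigensum J c) = (\<Sum>i\<in>J. c i * gasket_inner (Phi i) (Phi j))"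
      using eigensum_integral_mult[OF Phi_cont, of J c j] by (simp add: gasket_inner_def[of "Phi j" "eigensum J c"] mult.commute)
    also have "\<dots> = (\<Sum>i\<in>J. if i = j then c i else 0)" by (rule sum.cong) (auto simp: Phi_orthonormal)
    finally show ?thesis using J by simp
  qed
  have "(\<integral>x. (eigensum J c x)\<^sup>2 \<partial>gasket_measure) = (\<Sum>j\<in>J. c j * gasket_inner (Phi j) (eigensum J c))"
    unfolding power2_eq_square by (rule eigensum_integral_mult[OF eigensum_cont])
  then show ?thesis by (simp add: i power2_eq_square)
qed

lemma eigensum_energy: "finite J \<Longrightarrow> gasket_energy_n n (eigensum J c) (eigensum J c) \<le> (\<Sum>j\<in>J. lam j * (c j)\<^sup>2)"
proof (rule energy_le_limit)
  assume J: "finite J"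
  have "(\<lambda>n. \<Sum>j\<in>J. \<Sum>k\<in>J. c j * c k * gasket_energy_n n (Phi j) (Phi k)) \<longlonglongrightarrow>
      (\<Sum>j\<in>J. \<Sum>k\<in>J. c j * c k * gasket_energy (Phi j) (Phi k))"
    by (intro tendsto_intros energy_tendsto Phi_domain)
  also have "(\<Sum>j\<in>J. \<Sum>k\<in>J. c j * c k * gasket_energy (Phi j) (Phi k)) = (\<Sum>j\<in>J. lam j * (c j)\<^sup>2)"
  proof (rule sum.cong[OF refl])
    fix j assume j: "j \<in> J"
    have "(\<Sum>k\<in>J. c j * c k * gasket_energy (Phi j) (Phi k)) = (\<Sum>k\<in>J. if k = j then lam j * (c j)\<^sup>2 else 0)"
      by (rule sum.cong[OF refl]) (simp add: Phi_energy[OF Phi_domain] Phi_orthonormal power2_eq_square)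
    then show "(\<Sum>k\<in>J. c j * c k * gasket_energy (Phi j) (Phi k)) = lam j * (c j)\<^sup>2" using J j by simp
  qed
  finally show "(\<lambda>n. gasket_energy_n n (eigensum J c) (eigensum J c)) \<longlonglongrightarrow> (\<Sum>j\<in>J. lam j * (c j)\<^sup>2)"
    unfolding eigensum_def[abs_def] energy_sum[OF J] .
qed

lemma eigensum_weak:
  assumes J: "finite J" and g: "g \<in> gasket_form_domain"
  shows "(\<lambda>n. gasket_energy_n n (eigensum J c) g) \<longlonglongrightarrow> (\<integral>x. eigensum J (\<lambda>j. lam j * c j) x * g x \<partial>gasket_measure)"
proof -
  have gc: "continuous_on gasket g" using g by (simp add: gasket_form_domain_def)
  have "(\<lambda>n. \<Sum>j\<in>J. c j * gasket_energy_n n (Phi j) g) \<longlonglongrightarrow> (\<Sum>j\<in>J. c j * gasket_energy (Phi j) g)"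
    by (intro tendsto_intros energy_tendsto Phi_domain g)
  also have "(\<Sum>j\<in>J. c j * gasket_energy (Phi j) g) = (\<integral>x. eigensum J (\<lambda>j. lam j * c j) x * g x \<partial>gasket_measure)"
    unfolding eigensum_integral_mult[OF gc] by (rule sum.cong[OF refl]) (simp add: Phi_energy[OF g] mult.left_commute)
  finally show ?thesis unfolding eigensum_def[abs_def] energy_sum_left[OF J] .
qed

text \<open>The square of the value at \<open>x\<close> is compared with its average over the cell of level \<open>n\<close> around \<open>x\<close>. The
average is at most \<open>3\<^sup>n\<close> times the squared norm, and the oscillation is of the same order, because the
energy is at most \<open>5\<^sup>n\<close> times the squared norm.\<close>

lemma eigensum_sup:
  assumes J: "finite J" "\<And>j. j \<in> J \<Longrightarrow> lam j \<le> 5 ^ n" and x: "x \<in> gasket"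
  shows "(eigensum J c x)\<^sup>2 \<le> 202 * 3 ^ n * (\<Sum>j\<in>J. (c j)\<^sup>2)"
proof -
  define S where "S = (\<Sum>j\<in>J. (c j)\<^sup>2)"
  let ?f = "eigensum J c"
  obtain w x' where w: "w \<in> gasket_words n" "x' \<in> gasket" "x = gasket_word_map w x'" using gasket_cover[OF x] by blast
  let ?C = "gasket_word_map w ` gasket"
  have C [measurable]: "?C \<in> sets gasket_measure" using cell_in_sets[OF w(1)] by (simp only: sets_gasket_measure)
  have E: "gasket_energy_n k ?f ?f \<le> 5 ^ n * S" for k
  proof -
    have "gasket_energy_n k ?f ?f \<le> (\<Sum>j\<in>J. lam j * (c j)\<^sup>2)" by (rule eigensum_energy[OF J(1)])
    also have "\<dots> \<le> (\<Sum>j\<in>J. 5 ^ n * (c j)\<^sup>2)" by (intro sum_mono mult_right_mono J(2)) auto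
    finally show ?thesis by (simp add: S_def sum_distrib_left)
  qed
  have pt: "(?f x)\<^sup>2 \<le> 2 * (?f y)\<^sup>2 + 200 * 3 ^ n * S" if y: "y \<in> ?C" for y
  proof -
    obtain y' where y': "y' \<in> gasket" "y = gasket_word_map w y'" using y by blast
    have "(?f x - ?f y)\<^sup>2 \<le> 100 * (3/5) ^ n * (5 ^ n * S)"
      unfolding w(3) y'(2) by (rule energy_cell_osc[OF eigensum_cont E w(1,2) y'(1)])
    also have "\<dots> = 100 * 3 ^ n * S" by (simp add: power_divide)
    finally have "(?f x - ?f y)\<^sup>2 \<le> 100 * 3 ^ n * S" .
    moreover have "(?f x)\<^sup>2 \<le> 2 * (?f y)\<^sup>2 + 2 * (?f x - ?f y)\<^sup>2"
      using zero_le_power2[of "?f x - 2 * ?f y"] by (simp add: power2_eq_square algebra_simps)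
    ultimately show ?thesis by linarith
  qed
  have sq: "integrable gasket_measure (\<lambda>y. (?f y)\<^sup>2)"
    by (intro continuous_integrable continuous_intros eigensum_cont)
  have mC: "measure gasket_measure ?C = 1 / 3 ^ n" by (rule measure_cell[OF w(1)])
  have Cs: "?C \<inter> gasket = ?C" using gasket_word_map_in[OF _ w(1)] by auto
  have iC: "integrable gasket_measure (\<lambda>y. a * indicator ?C y :: real)" for a
    by (intro integrable_mult_right integrable_real_indicator C) (simp add: gm.emeasure_eq_measure)
  have "(?f x)\<^sup>2 / 3 ^ n = (\<integral>y. (?f x)\<^sup>2 * indicator ?C y \<partial>gasket_measure)"
    using mC Cs by simp
  also have "\<dots> \<le> (\<integral>y. 2 * (?f y)\<^sup>2 + 200 * 3 ^ n * S * indicator ?C y \<partial>gasket_measure)"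
  proof (rule integral_mono[OF iC])
    show "integrable gasket_measure (\<lambda>y. 2 * (?f y)\<^sup>2 + 200 * 3 ^ n * S * indicator ?C y)"
      by (intro Bochner_Integration.integrable_add iC integrable_mult_right sq)
    show "(?f x)\<^sup>2 * indicator ?C y \<le> 2 * (?f y)\<^sup>2 + 200 * 3 ^ n * S * indicator ?C y" for y
      using pt[of y] by (cases "y \<in> ?C") auto
  qed
  also have "\<dots> = 2 * S + 200 * S"
    using mC Cs by (subst Bochner_Integration.integral_add[OF integrable_mult_right[OF sq] iC])
      (simp add: eigensum_norm[OF J(1)] S_def)
  finally show ?thesis by (simp add: S_def field_simps)
qed

text \<open>For cells larger than the wave length the sup bound suffices. In smaller cells the function is
nearly harmonic: its Laplacian is again a sum of the same kind, whose norm is larger by a factor of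
at most \<open>5\<^sup>n\<close>.\<close>

lemma eigensum_osc:
  assumes J: "finite J" "\<And>j. j \<in> J \<Longrightarrow> lam j \<le> 5 ^ n" and xy: "same_cell m x y"
  shows "(eigensum J c x - eigensum J c y)\<^sup>2 \<le> 100000 * 3 ^ n * (if n \<le> m then (9/25) ^ (m - n) else 1) * (\<Sum>j\<in>J. (c j)\<^sup>2)"
proof -
  define S where "S = (\<Sum>j\<in>J. (c j)\<^sup>2)"
  have S0: "0 \<le> S" unfolding S_def by (intro sum_nonneg) simp
  define A where "A = sqrt (202 * 3 ^ n * S)"
  have A: "0 \<le> A" "A\<^sup>2 = 202 * 3 ^ n * S" using S0 by (auto simp: A_def)
  obtain u x' y' where u: "u \<in> gasket_words m" "x' \<in> gasket" "y' \<in> gasket"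
    "x = gasket_word_map u x'" "y = gasket_word_map u y'" using xy unfolding same_cell_def by blast
  let ?f = "eigensum J c"
  have sup: "\<bar>?f z\<bar> \<le> A" if "z \<in> gasket" for z
    using eigensum_sup[OF J that, of c] unfolding A_def S_def by (rule real_le_rsqrt[of "\<bar>_\<bar>", simplified power2_abs])
  show ?thesis
  proof (cases "n \<le> m")
    case False
    have "\<bar>?f x - ?f y\<bar> \<le> 2 * A"
      unfolding u(4,5) using sup[OF gasket_word_map_in[OF u(2,1)]] sup[OF gasket_word_map_in[OF u(3,1)]] by linarith
    then have "(?f x - ?f y)\<^sup>2 \<le> (2 * A)\<^sup>2" by (subst abs_le_square_iff[symmetric]) (use A in simp)
    also have "\<dots> = 808 * 3 ^ n * S" using A by (simp add: power_mult_distrib)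
    also have "\<dots> \<le> 100000 * 3 ^ n * S" using S0 by (intro mult_right_mono) auto
    finally show ?thesis using False by (simp add: S_def)
  next
    case True
    define w v where "w = take n u" and "v = drop n u"
    have wv: "w \<in> gasket_words n" "v \<in> gasket_words (m - n)" "w @ v = u"
      using u(1) True set_take_subset[of n u] set_drop_subset[of n u] by (auto simp: gasket_words_def w_def v_def)
    define h where "h = eigensum J (\<lambda>j. lam j * c j)"
    have hb: "\<bar>h z\<bar> \<le> A * 5 ^ n" if z: "z \<in> gasket" for z
    proof -
      have "(\<Sum>j\<in>J. (lam j * c j)\<^sup>2) \<le> (\<Sum>j\<in>J. (5 ^ n)\<^sup>2 * (c j)\<^sup>2)"
        unfolding power_mult_distrib
        by (intro sum_mono mult_right_mono power_mono J(2)) (auto intro: less_imp_le[OF lam_pos])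
      also have "\<dots> = (5 ^ n)\<^sup>2 * S" by (simp add: S_def sum_distrib_left)
      finally have le: "(\<Sum>j\<in>J. (lam j * c j)\<^sup>2) \<le> (5 ^ n)\<^sup>2 * S" .
      have "(h z)\<^sup>2 \<le> 202 * 3 ^ n * (\<Sum>j\<in>J. (lam j * c j)\<^sup>2)" unfolding h_def by (rule eigensum_sup[OF J z])
      also have "\<dots> \<le> 202 * 3 ^ n * ((5 ^ n)\<^sup>2 * S)" by (rule mult_left_mono[OF le]) simp
      also have "\<dots> = (A * 5 ^ n)\<^sup>2" using A by (simp add: power_mult_distrib)
      finally have "\<bar>h z\<bar> \<le> \<bar>A * 5 ^ n\<bar>" by (simp only: abs_le_square_iff)
      then show ?thesis using A by simp
    qed
    interpret bounded_laplacian ?f h "A * 5 ^ n"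
      by unfold_locales (use eigensum_cont hb eigensum_weak[OF J(1)] continuous_borel_gasket[OF eigensum_cont] in \<open>auto simp: h_def\<close>)
    have "\<bar>?f (gasket_word_map (w @ v) x') - ?f (gasket_word_map (w @ v) y')\<bar>
        \<le> 5 * ((3/5) ^ (m - n) * (2 * A + 3/2 * (A * 5 ^ n / 5 ^ n)))"
    proof (rule cell_osc[OF wv(1,2) u(2,3)])
      fix i j assume ij: "i \<in> I3" "j \<in> I3"
      show "\<bar>?f (gasket_word_map w (corner i)) - ?f (gasket_word_map w (corner j))\<bar> \<le> 2 * A"
        using sup[OF gasket_word_map_in[OF corner_in_gasket[OF ij(1)] wv(1)]]
          sup[OF gasket_word_map_in[OF corner_in_gasket[OF ij(2)] wv(1)]] by linarith
    qed
    then have "\<bar>?f x - ?f y\<bar> \<le> 35/2 * ((3/5) ^ (m - n) * A)" unfolding wv(3) u(4,5) by simp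
    then have "(?f x - ?f y)\<^sup>2 \<le> (35/2 * ((3/5) ^ (m - n) * A))\<^sup>2" by (subst abs_le_square_iff[symmetric]) (use A in simp)
    also have "\<dots> = (1225/4 * 202) * (3 ^ n * (9/25) ^ (m - n) * S)"
    proof -
      have "((3/5 :: real) ^ (m - n))\<^sup>2 = ((3/5)\<^sup>2) ^ (m - n)" by (simp only: power_mult[symmetric] mult.commute)
      also have "(3/5)\<^sup>2 = (9/25 :: real)" by (simp add: power2_eq_square)
      finally have p: "((3/5) ^ (m - n))\<^sup>2 = (9/25 :: real) ^ (m - n)" .
      have q: "(35/2)\<^sup>2 = (1225/4 :: real)" by (simp add: power2_eq_square)
      show ?thesis unfolding power_mult_distrib p q A(2) by (simp only: mult_ac)
    qed
    also have "\<dots> \<le> 100000 * (3 ^ n * (9/25) ^ (m - n) * S)" using S0 by (intro mult_right_mono) auto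
    finally show ?thesis using True by (simp only: if_True S_def mult.assoc)
  qed
qed

lemma quadratic_bound: "(S::real)\<^sup>2 \<le> K * S \<Longrightarrow> 0 \<le> S \<Longrightarrow> 0 \<le> K \<Longrightarrow> S \<le> K"
  by (cases "S = 0") (auto simp: power2_eq_square)

text \<open>The function with coefficients \<open>\<Phi>\<^sub>j(x)\<close> has squared norm and value at \<open>x\<close> both equal to the sum \<open>S\<close>
in question, so the sup bound reads \<open>S\<^sup>2 \<le> K S\<close>. The same choice works for differences.\<close>

lemma spectral_sum_diag:
  assumes J: "finite J" "\<And>j. j \<in> J \<Longrightarrow> lam j \<le> 5 ^ n" and x: "x \<in> gasket"
  shows "(\<Sum>j\<in>J. (Phi j x)\<^sup>2) \<le> 202 * 3 ^ n"
proof (rule quadratic_bound)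
  show "(\<Sum>j\<in>J. (Phi j x)\<^sup>2)\<^sup>2 \<le> 202 * 3 ^ n * (\<Sum>j\<in>J. (Phi j x)\<^sup>2)"
    using eigensum_sup[OF J x, of "\<lambda>j. Phi j x"] by (simp add: eigensum_def power2_eq_square)
qed (auto intro: sum_nonneg)

lemma spectral_sum_diff:
  assumes J: "finite J" "\<And>j. j \<in> J \<Longrightarrow> lam j \<le> 5 ^ n" and xy: "same_cell m x y"
  shows "(\<Sum>j\<in>J. (Phi j x - Phi j y)\<^sup>2) \<le> 100000 * 3 ^ n * (if n \<le> m then (9/25) ^ (m - n) else 1)"
proof (rule quadratic_bound)
  let ?c = "\<lambda>j. Phi j x - Phi j y"
  have "eigensum J ?c x - eigensum J ?c y = (\<Sum>j\<in>J. (?c j)\<^sup>2)"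
    unfolding eigensum_def sum_subtractf[symmetric] by (simp add: power2_eq_square algebra_simps)
  then show "(\<Sum>j\<in>J. (?c j)\<^sup>2)\<^sup>2 \<le> 100000 * 3 ^ n * (if n \<le> m then (9/25) ^ (m - n) else 1) * (\<Sum>j\<in>J. (?c j)\<^sup>2)"
    using eigensum_osc[OF J xy, of ?c] by simp
qed (auto intro: sum_nonneg)

end

section \<open>Square-integrable functions\<close>

text \<open>The conditions of \<open>gasket_L2\<close> for an arbitrary measure, to be used for \<open>\<mu>\<close> as well as for the
probability measure.\<close>

definition sqint :: "'a measure \<Rightarrow> ('a \<Rightarrow> real) \<Rightarrow> bool" where
  "sqint M f \<longleftrightarrow> f \<in> borel_measurable M \<and> integrable M (\<lambda>x. (f x)\<^sup>2)"

lemma sqint_meas: "sqint M f \<Longrightarrow> f \<in> borel_measurable M"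
  by (simp add: sqint_def)

lemma sqint_sq: "sqint M f \<Longrightarrow> integrable M (\<lambda>x. (f x)\<^sup>2)"
  by (simp add: sqint_def)

lemma sqint_mult: assumes "sqint M f" "sqint M g" shows "integrable M (\<lambda>x. f x * g x)"
proof (rule Bochner_Integration.integrable_bound)
  show "integrable M (\<lambda>x. (f x)\<^sup>2 + (g x)\<^sup>2)" using assms by (auto simp: sqint_def)
  show "(\<lambda>x. f x * g x) \<in> borel_measurable M" using assms by (auto simp: sqint_def)
  have "\<bar>a * b\<bar> \<le> a\<^sup>2 + b\<^sup>2" for a b :: real
  proof -
    have "2 * \<bar>a * b\<bar> \<le> a\<^sup>2 + b\<^sup>2"
      using zero_le_power2[of "\<bar>a\<bar> - \<bar>b\<bar>"] by (simp add: power2_diff abs_mult)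
    then show ?thesis using abs_ge_zero[of "a * b"] by linarith
  qed
  then show "AE x in M. norm (f x * g x) \<le> norm ((f x)\<^sup>2 + (g x)\<^sup>2)" by simp
qed

lemma sqint_lincomb: assumes "sqint M f" "sqint M g" shows "sqint M (\<lambda>x. a * f x + b * g x)"
proof -
  have [measurable]: "f \<in> borel_measurable M" "g \<in> borel_measurable M" using assms by (auto simp: sqint_def)
  have "integrable M (\<lambda>x. a\<^sup>2 * (f x)\<^sup>2 + 2 * a * b * (f x * g x) + b\<^sup>2 * (g x)\<^sup>2)"
    using sqint_mult[OF assms] sqint_sq[OF assms(1)] sqint_sq[OF assms(2)] by auto
  also have "(\<lambda>x. a\<^sup>2 * (f x)\<^sup>2 + 2 * a * b * (f x * g x) + b\<^sup>2 * (g x)\<^sup>2) = (\<lambda>x. (a * f x + b * g x)\<^sup>2)"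
    by (rule ext) (simp add: power2_eq_square algebra_simps)
  finally show ?thesis by (simp add: sqint_def)
qed

lemma sqint_diff: "sqint M f \<Longrightarrow> sqint M g \<Longrightarrow> sqint M (\<lambda>x. f x - g x)"
  using sqint_lincomb[of M f g 1 "-1"] by simp

lemma sqint_zero: "sqint M (\<lambda>x. 0)"
  by (simp add: sqint_def)

lemma sqint_cauchy_schwarz:
  assumes f: "sqint M f" and g: "sqint M g"
  shows "(\<integral>x. f x * g x \<partial>M)\<^sup>2 \<le> (\<integral>x. (f x)\<^sup>2 \<partial>M) * (\<integral>x. (g x)\<^sup>2 \<partial>M)"
proof -
  define A B C where "A = (\<integral>x. (f x)\<^sup>2 \<partial>M)" and "B = (\<integral>x. f x * g x \<partial>M)" and "C = (\<integral>x. (g x)\<^sup>2 \<partial>M)"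
  have q: "0 \<le> A - 2 * t * B + t\<^sup>2 * C" for t
  proof -
    have "0 \<le> (\<integral>x. (f x - t * g x)\<^sup>2 \<partial>M)" by simp
    also have "(\<lambda>x. (f x - t * g x)\<^sup>2) = (\<lambda>x. ((f x)\<^sup>2 - 2 * t * (f x * g x)) + t\<^sup>2 * (g x)\<^sup>2)"
      by (rule ext) (simp add: power2_eq_square algebra_simps)
    also have "(\<integral>x. ((f x)\<^sup>2 - 2 * t * (f x * g x)) + t\<^sup>2 * (g x)\<^sup>2 \<partial>M) = A - 2 * t * B + t\<^sup>2 * C"
      unfolding A_def B_def C_def
      using sqint_mult[OF f g] sqint_sq[OF f] sqint_sq[OF g] by simp
    finally show ?thesis .
  qed
  have "C \<ge> 0" by (simp add: C_def)
  show ?thesis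
  proof (cases "C = 0")
    case True
    have "B = 0"
    proof (rule ccontr)
      assume "B \<noteq> 0"
      then show False using q[of "(A + 1) / (2 * B)"] True by (simp add: field_simps)
    qed
    then show ?thesis using True by (simp add: A_def B_def C_def)
  next
    case False
    then have "0 < C" using \<open>C \<ge> 0\<close> by simp
    then have "B\<^sup>2 \<le> A * C" using q[of "B / C"] by (simp add: field_simps power2_eq_square)
    then show ?thesis by (simp add: A_def B_def C_def)
  qed
qed

lemma (in prob_space) sqint_const: "sqint M (\<lambda>x. c)"
  by (simp add: sqint_def)

lemma (in prob_space) sqint_integrable: "sqint M f \<Longrightarrow> integrable M f"
  using sqint_mult[OF _ sqint_const[of 1]] by simp

lemma (in prob_space) sqint_abs_le:
  assumes "sqint M f" shows "(\<integral>x. \<bar>f x\<bar> \<partial>M) \<le> sqrt (\<integral>x. (f x)\<^sup>2 \<partial>M)"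
proof (rule real_le_rsqrt)
  have "sqint M (\<lambda>x. \<bar>f x\<bar>)" using assms by (auto simp: sqint_def)
  from sqint_cauchy_schwarz[OF this sqint_const[of 1]]
  show "(\<integral>x. \<bar>f x\<bar> \<partial>M)\<^sup>2 \<le> (\<integral>x. (f x)\<^sup>2 \<partial>M)" by (simp add: prob_space)
qed

lemma fatou_L1:
  fixes S :: "nat \<Rightarrow> 'a \<Rightarrow> real"
  assumes meas: "\<And>n. S n \<in> borel_measurable M" and lim: "AE x in M. (\<lambda>n. S n x) \<longlonglongrightarrow> g x"
    and g: "g \<in> borel_measurable M" and nn: "\<And>n x. 0 \<le> S n x"
    and int: "\<And>n. integrable M (S n)" and bd: "\<And>n. (\<integral>x. S n x \<partial>M) \<le> C n" and C: "C \<longlonglongrightarrow> c"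
  shows "integrable M g" "(\<integral>x. g x \<partial>M) \<le> c"
proof -
  have g0: "AE x in M. 0 \<le> g x" using lim
    by eventually_elim (rule LIMSEQ_le_const, auto simp: nn)
  have "0 \<le> C n" for n using order_trans[OF _ bd[of n]] nn by (simp add: integral_nonneg_AE)
  then have c0: "0 \<le> c" by (intro LIMSEQ_le_const[OF C]) auto
  have "(\<integral>\<^sup>+x. ennreal (g x) \<partial>M) = (\<integral>\<^sup>+x. liminf (\<lambda>n. ennreal (S n x)) \<partial>M)"
  proof (rule nn_integral_cong_AE)
    show "AE x in M. ennreal (g x) = liminf (\<lambda>n. ennreal (S n x))" using lim
    proof eventually_elim
      fix x assume "(\<lambda>n. S n x) \<longlonglongrightarrow> g x"
      then have "(\<lambda>n. ennreal (S n x)) \<longlonglongrightarrow> ennreal (g x)" by (rule tendsto_ennrealI)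
      then show "ennreal (g x) = liminf (\<lambda>n. ennreal (S n x))"
        using lim_imp_Liminf[of sequentially] by (metis trivial_limit_sequentially)
    qed
  qed
  also have "\<dots> \<le> liminf (\<lambda>n. \<integral>\<^sup>+x. ennreal (S n x) \<partial>M)"
    by (rule nn_integral_liminf) (use meas in measurable)
  also have "\<dots> \<le> liminf (\<lambda>n. ennreal (C n))"
    by (rule Liminf_mono) (auto simp: nn_integral_eq_integral[OF int] nn intro!: always_eventually ennreal_leI bd)
  also have "\<dots> = ennreal c"
    using lim_imp_Liminf[OF trivial_limit_sequentially tendsto_ennrealI[OF C]] .
  finally have le: "(\<integral>\<^sup>+x. ennreal (g x) \<partial>M) \<le> ennreal c" .
  show ig: "integrable M g"
  proof (rule integrableI_nonneg[OF g g0])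
    show "(\<integral>\<^sup>+x. ennreal (g x) \<partial>M) < \<infinity>" using le by (rule order_le_less_trans) simp
  qed
  show "(\<integral>x. g x \<partial>M) \<le> c"
    using le nn_integral_eq_integral[OF ig g0] c0 by (simp add: ennreal_le_iff)
qed

lemma AE_limit_eq_L1_limit:
  fixes S :: "nat \<Rightarrow> 'a \<Rightarrow> real"
  assumes int: "\<And>n. integrable M (\<lambda>x. S n x - b x)" and S: "\<And>n. S n \<in> borel_measurable M"
    and a: "a \<in> borel_measurable M" and b: "b \<in> borel_measurable M"
    and lim: "AE x in M. (\<lambda>n. S n x) \<longlonglongrightarrow> a x" and L1: "\<And>n. (\<integral>x. \<bar>S n x - b x\<bar> \<partial>M) \<le> C n" and C: "C \<longlonglongrightarrow> 0"
  shows "AE x in M. a x = b x"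
proof -
  have m: "(\<lambda>x. \<bar>a x - b x\<bar>) \<in> borel_measurable M" "\<And>n. (\<lambda>x. \<bar>S n x - b x\<bar>) \<in> borel_measurable M"
    using a b S by auto
  have l: "AE x in M. (\<lambda>n. \<bar>S n x - b x\<bar>) \<longlonglongrightarrow> \<bar>a x - b x\<bar>"
    using lim by eventually_elim (intro tendsto_intros)
  note F = fatou_L1[OF m(2) l m(1) _ integrable_abs[OF int] L1 C]
  have "integrable M (\<lambda>x. \<bar>a x - b x\<bar>)" by (rule F(1)) simp
  moreover have "(\<integral>x. \<bar>a x - b x\<bar> \<partial>M) = 0"
    using F(2) by (intro antisym) simp_all
  ultimately have "AE x in M. \<bar>a x - b x\<bar> = 0" by (subst (asm) integral_nonneg_eq_0_iff_AE) auto
  then show ?thesis by simp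
qed

text \<open>On a probability space an \<open>L\<^sup>2\<close>-Cauchy sequence is Cauchy in \<open>L\<^sup>1\<close> and has an almost everywhere
convergent subsequence; Fatou's lemma identifies its limit as the \<open>L\<^sup>2\<close>-limit.\<close>

lemma (in prob_space) riesz_fischer:
  assumes S: "\<And>n. sqint M (S n)" and e: "\<And>m n. n \<le> m \<Longrightarrow> (\<integral>x. (S m x - S n x)\<^sup>2 \<partial>M) \<le> e n" and e0: "e \<longlonglongrightarrow> 0"
  shows "\<exists>g. sqint M g \<and> (\<lambda>n. \<integral>x. (g x - S n x)\<^sup>2 \<partial>M) \<longlonglongrightarrow> 0"
proof -
  have [measurable]: "S n \<in> borel_measurable M" for n by (rule sqint_meas[OF S])
  have L1: "(\<integral>x. \<bar>S m x - S n x\<bar> \<partial>M) \<le> sqrt (e n)" if "n \<le> m" for m n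
    using sqint_abs_le[OF sqint_diff[OF S S], of m n] e[OF that] by (meson order_trans real_sqrt_le_mono)
  have cau: "\<exists>N. \<forall>i\<ge>N. \<forall>j\<ge>N. (\<integral>x. norm (S i x - S j x) \<partial>M) < d" if "d > 0" for d
  proof -
    have "(\<lambda>n. sqrt (e n)) \<longlonglongrightarrow> sqrt 0" by (intro tendsto_intros e0)
    then have "\<forall>\<^sub>F n in sequentially. sqrt (e n) < d" using that by (auto dest: order_tendstoD)
    then obtain N where N: "\<And>n. n \<ge> N \<Longrightarrow> sqrt (e n) < d" by (auto simp: eventually_sequentially)
    have "(\<integral>x. norm (S i x - S j x) \<partial>M) < d" if "i \<ge> N" "j \<ge> N" for i j
    proof (cases "j \<le> i")
      case True
      then show ?thesis using L1[OF True] N[OF that(2)] by simp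
    next
      case False
      then show ?thesis using L1[of i j] N[OF that(1)] by (simp add: abs_minus_commute)
    qed
    then show ?thesis by blast
  qed
  obtain r where r: "strict_mono r" "AE x in M. Cauchy (\<lambda>i. S (r i) x)"
    using cauchy_L1_AE_cauchy_subseq[OF sqint_integrable[OF S] cau] by blast
  define g where "g x = lim (\<lambda>i. S (r i) x)" for x
  have [measurable]: "g \<in> borel_measurable M" unfolding g_def[abs_def] by measurable
  have lim: "AE x in M. (\<lambda>i. S (r i) x) \<longlonglongrightarrow> g x"
    using r(2) by eventually_elim (simp add: g_def Cauchy_convergent_iff convergent_LIMSEQ_iff)
  have fat: "integrable M (\<lambda>x. (g x - S n x)\<^sup>2) \<and> (\<integral>x. (g x - S n x)\<^sup>2 \<partial>M) \<le> e n" for n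
  proof -
    have l: "AE x in M. (\<lambda>i. (S (r (i + n)) x - S n x)\<^sup>2) \<longlonglongrightarrow> (g x - S n x)\<^sup>2"
      using lim by eventually_elim (intro tendsto_intros LIMSEQ_ignore_initial_segment)
    have le: "(\<integral>x. (S (r (i + n)) x - S n x)\<^sup>2 \<partial>M) \<le> e n" for i
      by (rule e) (meson le_add2 order_trans r(1) strict_mono_imp_increasing)
    have int: "integrable M (\<lambda>x. (S (r (i + n)) x - S n x)\<^sup>2)" for i
      by (rule sqint_sq[OF sqint_diff[OF S S]])
    show ?thesis
      using fatou_L1[OF _ l _ _ int le tendsto_const] by simp
  qed
  have "sqint M (\<lambda>x. g x - S 0 x)" using fat[of 0] by (simp add: sqint_def)
  from sqint_lincomb[OF this S[of 0], of 1 1] have "sqint M g" by simp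
  moreover have "(\<lambda>n. \<integral>x. (g x - S n x)\<^sup>2 \<partial>M) \<longlonglongrightarrow> 0"
    by (rule tendsto_sandwich[OF _ _ tendsto_const e0]) (use fat in auto)
  ultimately show ?thesis by blast
qed

section \<open>Gaussian random variables\<close>

lemma gaussian_rv_meas: "gaussian_rv M Y \<Longrightarrow> Y \<in> borel_measurable M"
  by (simp add: gaussian_rv_def)

lemma gaussian_rv_cong_AE:
  assumes "gaussian_rv M Y" "Z \<in> borel_measurable M" "AE x in M. Y x = Z x"
  shows "gaussian_rv M Z"
proof -
  have [measurable]: "Y \<in> borel_measurable M" using assms(1) by (rule gaussian_rv_meas)
  consider m where "AE x in M. Y x = m" |
    m \<sigma> where "0 < \<sigma>" "distributed M lborel Y (\<lambda>y. ennreal (normal_density m \<sigma> y))"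
    using assms(1) unfolding gaussian_rv_def by blast
  then show ?thesis
  proof cases
    case 1
    then have "AE x in M. Z x = m" using assms(3) by eventually_elim simp
    then show ?thesis using assms(2) unfolding gaussian_rv_def by blast
  next
    case 2
    have "distr M lborel Z = distr M lborel Y"
      using assms by (intro distr_cong_AE) auto
    then have "distributed M lborel Z (\<lambda>y. ennreal (normal_density m \<sigma> y))"
      using 2(2) assms(2) by (simp add: distributed_def)
    then show ?thesis using assms(2) 2(1) unfolding gaussian_rv_def by blast
  qed
qed

lemma (in prob_space) gaussian_rv_sqint: assumes "gaussian_rv M Y" shows "sqint M Y"
proof -
  have [measurable]: "Y \<in> borel_measurable M" using assms by (rule gaussian_rv_meas)
  consider m where "AE x in M. Y x = m" |
    m \<sigma> where "0 < \<sigma>" "distributed M lborel Y (\<lambda>y. ennreal (normal_density m \<sigma> y))"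
    using assms unfolding gaussian_rv_def by blast
  then show ?thesis
  proof cases
    case 1
    then have "AE x in M. (Y x)\<^sup>2 = m\<^sup>2" by eventually_elim simp
    then have "integrable M (\<lambda>x. (Y x)\<^sup>2) = integrable M (\<lambda>x. m\<^sup>2)" by (intro integrable_cong_AE) auto
    then show ?thesis by (simp add: sqint_def)
  next
    case 2
    have "integrable lborel (\<lambda>y. normal_density m \<sigma> y * (y - m)\<^sup>2)" using integrable_normal_moment[OF 2(1)] .
    then have "integrable M (\<lambda>x. (Y x - m)\<^sup>2)"
      using distributed_integrable[OF 2(2), of "\<lambda>y. (y - m)\<^sup>2"] by simp
    then have "sqint M (\<lambda>x. Y x - m)" by (simp add: sqint_def)
    from sqint_lincomb[OF this sqint_const[of m], of 1 1] show ?thesis by simp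
  qed
qed

text \<open>With zero mean the constant alternative in \<open>gaussian_rv\<close> is the zero variable; \<open>0 ^ 0 = 1\<close> makes the
formula correct there for \<open>k = 0\<close> too.\<close>

lemma (in prob_space) gaussian_rv_moment:
  assumes Y: "gaussian_rv M Y" and mean: "(\<integral>x. Y x \<partial>M) = 0"
  shows "integrable M (\<lambda>x. Y x ^ (2 * k))"
    "(\<integral>x. Y x ^ (2 * k) \<partial>M) = fact (2 * k) / (2 ^ k * fact k) * (\<integral>x. (Y x)\<^sup>2 \<partial>M) ^ k"
proof -
  have [measurable]: "Y \<in> borel_measurable M" using Y by (rule gaussian_rv_meas)
  consider m where "AE x in M. Y x = m" |
    m \<sigma> where "0 < \<sigma>" "distributed M lborel Y (\<lambda>y. ennreal (normal_density m \<sigma> y))"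
    using Y unfolding gaussian_rv_def by blast
  then have "integrable M (\<lambda>x. Y x ^ (2 * k)) \<and>
    (\<integral>x. Y x ^ (2 * k) \<partial>M) = fact (2 * k) / (2 ^ k * fact k) * (\<integral>x. (Y x)\<^sup>2 \<partial>M) ^ k"
  proof cases
    case 1
    have "(\<integral>x. Y x \<partial>M) = (\<integral>x. m \<partial>M)" using 1 by (intro integral_cong_AE) auto
    then have "m = 0" using mean by (simp add: prob_space)
    then have z: "AE x in M. Y x = 0" using 1 by simp
    have e: "AE x in M. Y x ^ l = 0 ^ l" for l using z by eventually_elim simp
    have "(\<integral>x. Y x ^ l \<partial>M) = (\<integral>x. 0 ^ l \<partial>M)" for l using e by (intro integral_cong_AE) auto
    then have i: "(\<integral>x. Y x ^ l \<partial>M) = 0 ^ l" for l by (simp add: prob_space)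
    have "integrable M (\<lambda>x. Y x ^ (2 * k)) = integrable M (\<lambda>x. 0 ^ (2 * k) :: real)"
      using e by (intro integrable_cong_AE) auto
    then show ?thesis unfolding i by (cases k) auto
  next
    case 2
    have "m = 0" using normal_distributed_expectation[OF 2] mean by simp
    have mom: "integrable M (\<lambda>x. Y x ^ (2 * l)) \<and> (\<integral>x. Y x ^ (2 * l) \<partial>M) = fact (2 * l) / ((2 / \<sigma>\<^sup>2) ^ l * fact l)" for l
      using distributed_integrable[OF 2(2), of "\<lambda>y. y ^ (2 * l)"] distributed_integral[OF 2(2), of "\<lambda>y. y ^ (2 * l)"]
        integrable_normal_moment[OF 2(1), of 0 "2 * l"] integral_normal_moment_even[OF 2(1), of 0 l] \<open>m = 0\<close>
      by simp
    have "(\<integral>x. (Y x)\<^sup>2 \<partial>M) = \<sigma>\<^sup>2" using mom[of 1] by (simp add: fact_numeral)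
    then show ?thesis using mom[of k] 2(1) by (simp add: field_simps power_divide)
  qed
  then show "integrable M (\<lambda>x. Y x ^ (2 * k))"
    "(\<integral>x. Y x ^ (2 * k) \<partial>M) = fact (2 * k) / (2 ^ k * fact k) * (\<integral>x. (Y x)\<^sup>2 \<partial>M) ^ k" by auto
qed

section \<open>Orthonormal expansions\<close>

lemma gasket_L2_iff: "f \<in> gasket_L2 \<longleftrightarrow> sqint gasket_measure f"
  by (simp add: gasket_L2_def sqint_def)

lemma gasket_L2_0_iff: "f \<in> gasket_L2_0 \<longleftrightarrow> sqint gasket_measure f \<and> (\<integral>x. f x \<partial>gasket_measure) = 0"
  by (simp add: gasket_L2_0_def gasket_L2_iff)

lemma gasket_L2_0_lincomb:
  "f \<in> gasket_L2_0 \<Longrightarrow> g \<in> gasket_L2_0 \<Longrightarrow> (\<lambda>x. a * f x + b * g x) \<in> gasket_L2_0"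
  using gm.sqint_integrable by (auto simp: gasket_L2_0_iff sqint_lincomb)

lemma gasket_L2_0_diff: "f \<in> gasket_L2_0 \<Longrightarrow> g \<in> gasket_L2_0 \<Longrightarrow> (\<lambda>x. f x - g x) \<in> gasket_L2_0"
  using gasket_L2_0_lincomb[of f g 1 "-1"] by simp

lemma gasket_L2_0_zero: "(\<lambda>x. 0) \<in> gasket_L2_0"
  by (simp add: gasket_L2_0_iff sqint_zero)

lemma gasket_L2_0_sum:
  "finite J \<Longrightarrow> (\<And>j. j \<in> J \<Longrightarrow> F j \<in> gasket_L2_0) \<Longrightarrow> (\<lambda>x. \<Sum>j\<in>J. c j * F j x) \<in> gasket_L2_0"
proof (induction J rule: finite_induct)
  case (insert j J)
  then have "(\<lambda>x. c j * F j x + 1 * (\<Sum>j\<in>J. c j * F j x)) \<in> gasket_L2_0" by (intro gasket_L2_0_lincomb) auto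
  then show ?case using insert by simp
qed (simp add: gasket_L2_0_zero)

context gasket_spectral
begin

text \<open>Membership in \<open>gasket_L2_0\<close> together with the expansion in eigenfunctions, as both the kernel of
\<open>(-\<Delta>)\<^sup>-\<^sup>s\<close> and \<open>(-\<Delta>)\<^sup>s f\<close> are known through their coefficients only.\<close>

definition expands :: "(nat \<Rightarrow> real) \<Rightarrow> (complex \<Rightarrow> real) \<Rightarrow> bool" where
  "expands a g \<longleftrightarrow> g \<in> gasket_L2_0 \<and> gasket_L2_sums (\<lambda>j x. a j * Phi j x) g"

lemma eigensum_L2_0: "finite J \<Longrightarrow> eigensum J c \<in> gasket_L2_0"
  unfolding eigensum_def[abs_def] using gasket_L2_0_sum[of J Phi c] Phi_L2_0 by blast

lemma expands_limit: "expands a g \<Longrightarrow> (\<lambda>n. \<integral>x. (g x - eigensum {..<n} a x)\<^sup>2 \<partial>gasket_measure) \<longlonglongrightarrow> 0"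
  by (simp add: expands_def gasket_L2_sums_def eigensum_def)

lemma expands_exists:
  assumes a: "summable (\<lambda>j. (a j)\<^sup>2)" shows "\<exists>g. expands a g"
proof -
  define e where "e n = (\<Sum>j. (a j)\<^sup>2) - (\<Sum>j<n. (a j)\<^sup>2)" for n
  have "(\<lambda>n. (\<Sum>j. (a j)\<^sup>2) - (\<Sum>j<n. (a j)\<^sup>2)) \<longlonglongrightarrow> (\<Sum>j. (a j)\<^sup>2) - (\<Sum>j. (a j)\<^sup>2)"
    by (intro tendsto_intros summable_LIMSEQ a)
  then have e0: "e \<longlonglongrightarrow> 0" by (simp add: e_def[abs_def])
  have e: "(\<integral>x. (eigensum {..<m} a x - eigensum {..<n} a x)\<^sup>2 \<partial>gasket_measure) \<le> e n" if "n \<le> m" for m n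
  proof -
    have split: "(\<Sum>j<m. f j) = (\<Sum>j<n. f j) + (\<Sum>j\<in>{n..<m}. f j)" for f :: "nat \<Rightarrow> real"
      using that by (simp add: sum.atLeastLessThan_concat lessThan_atLeast0)
    have "eigensum {..<m} a x - eigensum {..<n} a x = eigensum {n..<m} a x" for x by (simp add: eigensum_def split)
    then have "(\<integral>x. (eigensum {..<m} a x - eigensum {..<n} a x)\<^sup>2 \<partial>gasket_measure) = (\<Sum>j\<in>{n..<m}. (a j)\<^sup>2)"
      by (simp add: eigensum_norm)
    also have "\<dots> = (\<Sum>j<m. (a j)\<^sup>2) - (\<Sum>j<n. (a j)\<^sup>2)" by (simp add: split)
    also have "\<dots> \<le> e n" unfolding e_def using sum_le_suminf[OF a, of "{..<m}"] by simp
    finally show ?thesis .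
  qed
  have S: "sqint gasket_measure (eigensum {..<n} a)" for n using eigensum_L2_0[of "{..<n}" a] by (simp add: gasket_L2_0_iff)
  obtain g where g: "sqint gasket_measure g" "(\<lambda>n. \<integral>x. (g x - eigensum {..<n} a x)\<^sup>2 \<partial>gasket_measure) \<longlonglongrightarrow> 0"
    using gm.riesz_fischer[OF S e e0] by blast
  have "(\<lambda>n. sqrt (\<integral>x. (g x - eigensum {..<n} a x)\<^sup>2 \<partial>gasket_measure)) \<longlonglongrightarrow> sqrt 0" by (intro tendsto_intros g(2))
  moreover have "\<bar>\<integral>x. g x \<partial>gasket_measure\<bar> \<le> sqrt (\<integral>x. (g x - eigensum {..<n} a x)\<^sup>2 \<partial>gasket_measure)" for n
  proof -
    have "(\<integral>x. g x \<partial>gasket_measure) = (\<integral>x. g x - eigensum {..<n} a x \<partial>gasket_measure)"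
      using eigensum_L2_0[of "{..<n}" a] gm.sqint_integrable[OF g(1)] gm.sqint_integrable[OF S[of n]] by (simp add: gasket_L2_0_iff)
    also have "\<bar>\<dots>\<bar> \<le> (\<integral>x. \<bar>g x - eigensum {..<n} a x\<bar> \<partial>gasket_measure)" by (rule integral_abs_bound)
    also have "\<dots> \<le> sqrt (\<integral>x. (g x - eigensum {..<n} a x)\<^sup>2 \<partial>gasket_measure)"
      by (rule gm.sqint_abs_le[OF sqint_diff[OF g(1) S]])
    finally show ?thesis .
  qed
  ultimately have "\<bar>\<integral>x. g x \<partial>gasket_measure\<bar> \<le> sqrt 0" by (intro LIMSEQ_le_const) auto
  then show ?thesis using g by (intro exI[of _ g]) (simp add: expands_def gasket_L2_0_iff gasket_L2_sums_def eigensum_def)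
qed

lemma expands_inner:
  assumes g: "expands a g" and h: "h \<in> gasket_L2_0"
  shows "(\<lambda>j. a j * gasket_inner (Phi j) h) sums gasket_inner g h"
  unfolding sums_def
proof (rule Lim_null[THEN iffD2])
  have hs: "sqint gasket_measure h" and gs: "sqint gasket_measure g"
    using g h by (auto simp: expands_def gasket_L2_0_iff)
  have ls: "sqint gasket_measure (eigensum {..<n} a)" for n using eigensum_L2_0[of "{..<n}" a] by (simp add: gasket_L2_0_iff)
  have Ps: "sqint gasket_measure (Phi j)" for j using Phi_L2_0[of j] by (simp add: gasket_L2_0_iff)
  let ?q = "\<lambda>n. \<integral>x. (g x - eigensum {..<n} a x)\<^sup>2 \<partial>gasket_measure"
  let ?C = "\<integral>x. (h x)\<^sup>2 \<partial>gasket_measure"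
  have lim: "(\<lambda>n. sqrt (?q n * ?C)) \<longlonglongrightarrow> sqrt (0 * ?C)" by (intro tendsto_intros expands_limit g)
  have "\<bar>(\<Sum>j<n. a j * gasket_inner (Phi j) h) - gasket_inner g h\<bar> \<le> sqrt (?q n * ?C)" for n
  proof -
    have "(\<Sum>j<n. a j * gasket_inner (Phi j) h) = (\<integral>x. (\<Sum>j<n. a j * (Phi j x * h x)) \<partial>gasket_measure)"
      unfolding gasket_inner_def using sqint_mult[OF Ps hs] by (subst Bochner_Integration.integral_sum) auto
    also have "\<dots> = (\<integral>x. eigensum {..<n} a x * h x \<partial>gasket_measure)"
      by (simp add: eigensum_def sum_distrib_right mult.assoc)
    finally have "gasket_inner g h - (\<Sum>j<n. a j * gasket_inner (Phi j) h) = (\<integral>x. (g x - eigensum {..<n} a x) * h x \<partial>gasket_measure)"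
      unfolding gasket_inner_def using sqint_mult[OF gs hs] sqint_mult[OF ls hs] by (simp add: left_diff_distrib)
    moreover have "\<bar>\<integral>x. (g x - eigensum {..<n} a x) * h x \<partial>gasket_measure\<bar> \<le> sqrt (?q n * ?C)"
      using sqint_cauchy_schwarz[OF sqint_diff[OF gs ls] hs] by (intro real_le_rsqrt) simp
    ultimately show ?thesis by (simp add: abs_minus_commute)
  qed
  note bd = this
  have "(\<lambda>n. sqrt (?q n * ?C)) \<longlonglongrightarrow> 0" using lim by simp
  then show "(\<lambda>n. (\<Sum>j<n. a j * gasket_inner (Phi j) h) - gasket_inner g h) \<longlonglongrightarrow> 0"
  proof (rule Lim_null_comparison[rotated])
    show "\<forall>\<^sub>F n in sequentially. norm ((\<Sum>j<n. a j * gasket_inner (Phi j) h) - gasket_inner g h) \<le> sqrt (?q n * ?C)"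
      unfolding real_norm_def by (intro always_eventually allI bd)
  qed
qed

lemma inner_commute: "gasket_inner f g = gasket_inner g f"
  by (simp add: gasket_inner_def mult.commute)

lemma expands_coeff:
  assumes "expands a g" shows "gasket_inner g (Phi j) = a j"
proof -
  have "(\<lambda>i. a i * gasket_inner (Phi i) (Phi j)) sums gasket_inner g (Phi j)" by (rule expands_inner[OF assms Phi_L2_0])
  also have "(\<lambda>i. a i * gasket_inner (Phi i) (Phi j)) = (\<lambda>i. if i = j then a i else 0)"
    by (auto simp: Phi_orthonormal)
  finally show ?thesis using sums_single[of j a] by (rule sums_unique2)
qed

lemma expands_parseval: assumes "expands a g" shows "(\<lambda>j. (a j)\<^sup>2) sums gasket_inner g g"
proof -
  have "(\<lambda>j. a j * gasket_inner (Phi j) g) sums gasket_inner g g"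
    using assms by (intro expands_inner) (auto simp: expands_def)
  then show ?thesis by (simp add: expands_coeff[OF assms] inner_commute[of "Phi _"] power2_eq_square)
qed

lemma expands_diff:
  assumes "expands a g" "expands b h" shows "expands (\<lambda>j. a j - b j) (\<lambda>x. g x - h x)"
  unfolding expands_def gasket_L2_sums_def
proof (intro conjI)
  show "(\<lambda>x. g x - h x) \<in> gasket_L2_0" using assms by (intro gasket_L2_0_diff) (auto simp: expands_def)
  have gs: "sqint gasket_measure (\<lambda>x. g x - eigensum {..<n} a x)" and hs: "sqint gasket_measure (\<lambda>x. h x - eigensum {..<n} b x)" for n
    using assms eigensum_L2_0[of "{..<n}" a] eigensum_L2_0[of "{..<n}" b]
    by (auto simp: gasket_L2_0_iff expands_def intro!: sqint_diff)
  let ?u = "\<lambda>n. \<integral>x. (g x - eigensum {..<n} a x)\<^sup>2 \<partial>gasket_measure" and ?v = "\<lambda>n. \<integral>x. (h x - eigensum {..<n} b x)\<^sup>2 \<partial>gasket_measure"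
  have "(\<lambda>n. 2 * ?u n + 2 * ?v n) \<longlonglongrightarrow> 2 * 0 + 2 * 0" by (intro tendsto_intros expands_limit assms)
  moreover have "(\<integral>x. ((g x - h x) - (\<Sum>j<n. (a j - b j) * Phi j x))\<^sup>2 \<partial>gasket_measure) \<le> 2 * ?u n + 2 * ?v n" for n
  proof -
    have "(\<integral>x. ((g x - eigensum {..<n} a x) - (h x - eigensum {..<n} b x))\<^sup>2 \<partial>gasket_measure)
        \<le> (\<integral>x. 2 * (g x - eigensum {..<n} a x)\<^sup>2 + 2 * (h x - eigensum {..<n} b x)\<^sup>2 \<partial>gasket_measure)"
    proof (rule integral_mono)
      show "integrable gasket_measure (\<lambda>x. ((g x - eigensum {..<n} a x) - (h x - eigensum {..<n} b x))\<^sup>2)"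
        by (rule sqint_sq[OF sqint_diff[OF gs hs]])
      show "integrable gasket_measure (\<lambda>x. 2 * (g x - eigensum {..<n} a x)\<^sup>2 + 2 * (h x - eigensum {..<n} b x)\<^sup>2)"
        using sqint_sq[OF gs] sqint_sq[OF hs] by simp
      show "(p - q)\<^sup>2 \<le> 2 * p\<^sup>2 + 2 * q\<^sup>2" for p q :: real
        using zero_le_power2[of "p + q"] by (simp add: power2_eq_square algebra_simps)
    qed
    also have "\<dots> = 2 * ?u n + 2 * ?v n" using sqint_sq[OF gs] sqint_sq[OF hs] by simp
    also have "(\<lambda>x. ((g x - eigensum {..<n} a x) - (h x - eigensum {..<n} b x))\<^sup>2) = (\<lambda>x. ((g x - h x) - (\<Sum>j<n. (a j - b j) * Phi j x))\<^sup>2)"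
      by (rule ext) (simp add: eigensum_def left_diff_distrib sum_subtractf algebra_simps)
    finally show ?thesis .
  qed
  ultimately have lim: "(\<lambda>n. 2 * ?u n + 2 * ?v n) \<longlonglongrightarrow> 0" and
    le: "\<And>n. (\<integral>x. ((g x - h x) - (\<Sum>j<n. (a j - b j) * Phi j x))\<^sup>2 \<partial>gasket_measure) \<le> 2 * ?u n + 2 * ?v n"
    by simp_all
  show "(\<lambda>n. \<integral>x. ((g x - h x) - (\<Sum>j<n. (a j - b j) * Phi j x))\<^sup>2 \<partial>gasket_measure) \<longlonglongrightarrow> 0"
    by (rule tendsto_sandwich[OF always_eventually always_eventually tendsto_const lim]) (simp, intro allI le)
qed

lemma expands_L2_0: "f \<in> gasket_L2_0 \<Longrightarrow> expands (\<lambda>j. gasket_inner f (Phi j)) f"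
  using eigenbasis unfolding expands_def gasket_eigenbasis_def by blast

text \<open>The description by \<open>SOME\<close> is met because the coefficients are square summable on the domain.\<close>

lemma frac_laplacian_expands:
  assumes "f \<in> frac_laplacian_domain lam Phi s"
  shows "expands (\<lambda>j. lam j powr s * gasket_inner f (Phi j)) (frac_laplacian lam Phi s f)"
proof -
  have "lam j powr (2 * s) * (gasket_inner f (Phi j))\<^sup>2 = (lam j powr s * gasket_inner f (Phi j))\<^sup>2" for j
  proof -
    have "(lam j powr s)\<^sup>2 = lam j powr (2 * s)" by (simp add: power2_eq_square flip: powr_add)
    then show ?thesis by (simp only: power_mult_distrib)
  qed
  then have "summable (\<lambda>j. (lam j powr s * gasket_inner f (Phi j))\<^sup>2)"
    using assms by (simp add: frac_laplacian_domain_def)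
  from expands_exists[OF this] show ?thesis
    unfolding frac_laplacian_def expands_def by (rule someI_ex)
qed

end

section \<open>Weighted spectral sums\<close>

lemma sum_power_le_geometric:
  assumes "0 \<le> r" "r < (1::real)" "finite A" shows "(\<Sum>k\<in>A. r ^ k) \<le> 1 / (1 - r)"
  using sum_le_suminf[OF summable_geometric assms(3), of r] suminf_geometric[of r] assms by simp

text \<open>Compared with the term at \<open>n = m\<close>, the terms decay geometrically in both directions.\<close>

lemma sum_two_sided:
  assumes "0 < k" "k < t" "t < (1::real)"
  shows "(\<Sum>n\<le>N. t ^ n * (if n \<le> m then k ^ (m - n) else 1)) \<le> t ^ m * (1 / (1 - k / t) + 1 / (1 - t))"
proof -
  have t0: "0 < t" using assms by simp
  have "t ^ n * (if n \<le> m then k ^ (m - n) else 1) \<le>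
      t ^ m * (if n \<le> m then (k / t) ^ (m - n) else 0) + t ^ m * (if n \<ge> m then t ^ (n - m) else 0)" for n
  proof (cases "n \<le> m")
    case True
    have "t ^ n * k ^ (m - n) = t ^ m * (k / t) ^ (m - n)"
      using True t0 by (simp add: power_divide field_simps flip: power_add)
    then show ?thesis using True t0 by simp
  next
    case False
    have "t ^ n = t ^ m * t ^ (n - m)" using False by (simp flip: power_add)
    then show ?thesis using False by simp
  qed
  then have "(\<Sum>n\<le>N. t ^ n * (if n \<le> m then k ^ (m - n) else 1)) \<le>
      (\<Sum>n\<le>N. t ^ m * (if n \<le> m then (k / t) ^ (m - n) else 0) + t ^ m * (if n \<ge> m then t ^ (n - m) else 0))"
    by (intro sum_mono)
  also have "\<dots> = t ^ m * ((\<Sum>n\<in>{n. n \<le> N \<and> n \<le> m}. (k / t) ^ (m - n)) + (\<Sum>n\<in>{n. n \<le> N \<and> m \<le> n}. t ^ (n - m)))"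
  proof -
    have "(\<Sum>n\<le>N. if P n then f n else 0) = (\<Sum>n\<in>{n. n \<le> N \<and> P n}. f n)" for P and f :: "nat \<Rightarrow> real"
      by (subst sum.inter_filter[symmetric]) (auto intro!: sum.cong)
    then show ?thesis by (simp add: sum.distrib sum_distrib_left[symmetric] distrib_left)
  qed
  also have "(\<Sum>n\<in>{n. n \<le> N \<and> n \<le> m}. (k / t) ^ (m - n)) = (\<Sum>i\<in>(\<lambda>n. m - n) ` {n. n \<le> N \<and> n \<le> m}. (k / t) ^ i)"
    by (subst sum.reindex) (auto simp: inj_on_def)
  also have "\<dots> \<le> 1 / (1 - k / t)" by (rule sum_power_le_geometric) (use assms t0 in auto)
  also have "(\<Sum>n\<in>{n. n \<le> N \<and> m \<le> n}. t ^ (n - m)) = (\<Sum>i\<in>(\<lambda>n. n - m) ` {n. n \<le> N \<and> m \<le> n}. t ^ i)"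
    by (subst sum.reindex) (auto simp: inj_on_def)
  also have "\<dots> \<le> 1 / (1 - t)" by (rule sum_power_le_geometric) (use assms t0 in auto)
  finally show ?thesis using t0 by (simp add: mult_left_mono)
qed

text \<open>The number \<open>q = 5\<^sup>-\<^sup>2\<^sup>s\<close> is the factor by which the weight \<open>\<lambda>\<^sup>-\<^sup>2\<^sup>s\<close> drops from one spectral scale to
the next. The two inequalities are \<open>s > d\<^sub>h/(2 d\<^sub>w)\<close> and \<open>s < 1 - d\<^sub>h/(2 d\<^sub>w)\<close>.\<close>

locale spectral_weights = gasket_spectral +
  fixes s q :: real
  assumes q_def: "q = 25 powr (- s)" and q_less: "3 * q < 1" and q_gr: "9/25 < 3 * q"
begin

lemma q_pos: "0 < q" by (simp add: q_def)

lemma s_pos: "0 < s"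
proof (rule ccontr)
  assume "\<not> 0 < s"
  then have "1 \<le> q" unfolding q_def by (intro ge_one_powr_ge_zero) auto
  then show False using q_less by simp
qed

definition weight_const :: real where "weight_const = lam 0 powr (- (2 * s)) + 1 / q"

lemma weight_const_nonneg: "0 \<le> weight_const"
  unfolding weight_const_def using q_pos by (intro add_nonneg_nonneg) auto

lemma q_power: "q ^ n = (5 ^ n) powr (- (2 * s))"
proof -
  have "q = 5 powr (- (2 * s))"
  proof -
    have "(25::real) = 5 powr 2" by simp
    then show ?thesis unfolding q_def by (simp only: powr_powr) simp
  qed
  then have "q ^ n = 5 powr (- (2 * s) * n)" by (simp add: powr_power mult.commute)
  also have "\<dots> = (5 powr n) powr (- (2 * s))" by (simp only: powr_powr mult.commute)
  finally show ?thesis by (simp add: powr_realpow)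
qed

text \<open>For the least \<open>n\<close> with \<open>\<lambda>\<^sub>j \<le> 5\<^sup>n\<close> the weight is comparable to \<open>q\<^sup>n\<close>. This \<open>n\<close> is 0 for the eigenvalues
below 1, whence the dependence of the constant on the first eigenvalue.\<close>

lemma weight_le:
  assumes "lam j \<le> 5 ^ M"
  shows "lam j powr (- (2 * s)) \<le> weight_const * (\<Sum>n\<le>M. if lam j \<le> 5 ^ n then q ^ n else 0)"
proof -
  define n where "n = (LEAST n. lam j \<le> 5 ^ n)"
  have n: "lam j \<le> 5 ^ n" unfolding n_def using assms by (rule LeastI)
  have nM: "n \<le> M" unfolding n_def using assms by (rule Least_le)
  have "lam j powr (- (2 * s)) \<le> weight_const * q ^ n"
  proof (cases n)
    case 0
    have "lam j powr (- (2 * s)) \<le> lam 0 powr (- (2 * s))"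
      using lam_mono[of 0 j] lam_pos[of 0] s_pos by (intro powr_mono2') auto
    then show ?thesis using 0 q_pos by (simp add: weight_const_def add_increasing2)
  next
    case (Suc k)
    have "\<not> lam j \<le> 5 ^ k" using Suc not_less_Least[of k "\<lambda>n. lam j \<le> 5 ^ n"] unfolding n_def by simp
    then have "lam j powr (- (2 * s)) \<le> (5 ^ k) powr (- (2 * s))" using s_pos by (intro powr_mono2') auto
    also have "\<dots> = 1 / q * q ^ n" using q_pos by (simp add: q_power[symmetric] Suc)
    also have "\<dots> \<le> weight_const * q ^ n" using q_pos by (intro mult_right_mono) (auto simp: weight_const_def)
    finally show ?thesis .
  qed
  also have "weight_const * q ^ n \<le> weight_const * (\<Sum>n\<le>M. if lam j \<le> 5 ^ n then q ^ n else 0)"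
  proof (rule mult_left_mono[OF _ weight_const_nonneg])
    have "(if lam j \<le> 5 ^ n then q ^ n else 0) \<le> (\<Sum>n\<le>M. if lam j \<le> 5 ^ n then q ^ n else 0)"
      using nM q_pos by (intro member_le_sum) auto
    then show "q ^ n \<le> (\<Sum>n\<le>M. if lam j \<le> 5 ^ n then q ^ n else 0)" using n by simp
  qed
  finally show ?thesis .
qed

lemma weighted_sum_le:
  assumes a: "\<And>j. 0 \<le> a j"
    and b: "\<And>n J. finite J \<Longrightarrow> (\<And>j. j \<in> J \<Longrightarrow> lam j \<le> 5 ^ n) \<Longrightarrow> (\<Sum>j\<in>J. a j) \<le> b n"
  shows "\<exists>M. (\<Sum>j<N. lam j powr (- (2 * s)) * a j) \<le> weight_const * (\<Sum>n\<le>M. q ^ n * b n)"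
proof -
  obtain M where "lam N < 5 ^ M" using real_arch_pow[of 5 "lam N"] by auto
  then have M: "lam j \<le> 5 ^ M" if "j < N" for j using lam_mono[of j N] that by simp
  have "(\<Sum>j<N. lam j powr (- (2 * s)) * a j) \<le> (\<Sum>j<N. (weight_const * (\<Sum>n\<le>M. if lam j \<le> 5 ^ n then q ^ n else 0)) * a j)"
    using M a by (intro sum_mono mult_right_mono weight_le) auto
  also have "\<dots> = weight_const * (\<Sum>j<N. \<Sum>n\<le>M. q ^ n * (if lam j \<le> 5 ^ n then a j else 0))"
    by (simp add: sum_distrib_left sum_distrib_right mult.assoc if_distrib[of "\<lambda>t. t * _"] if_distrib[of "(*) _"] cong: if_cong)
  also have "\<dots> = weight_const * (\<Sum>n\<le>M. q ^ n * (\<Sum>j<N. if lam j \<le> 5 ^ n then a j else 0))"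
    by (subst sum.swap) (simp add: sum_distrib_left)
  also have "\<dots> \<le> weight_const * (\<Sum>n\<le>M. q ^ n * b n)"
  proof (intro mult_left_mono[OF _ weight_const_nonneg] sum_mono mult_left_mono)
    fix n
    have "(\<Sum>j<N. if lam j \<le> 5 ^ n then a j else 0) = (\<Sum>j\<in>{j\<in>{..<N}. lam j \<le> 5 ^ n}. a j)"
      by (subst sum.inter_filter) auto
    also have "\<dots> \<le> b n" by (rule b) auto
    finally show "(\<Sum>j<N. if lam j \<le> 5 ^ n then a j else 0) \<le> b n" .
  qed (use q_pos in auto)
  finally show ?thesis by blast
qed

definition weight :: "nat \<Rightarrow> real" where "weight j = lam j powr (- s)"

lemma weight_sq: "(weight j * c)\<^sup>2 = lam j powr (- (2 * s)) * c\<^sup>2"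
proof -
  have "(lam j powr (- s))\<^sup>2 = lam j powr (- (2 * s))" by (simp add: power2_eq_square flip: powr_add)
  then show ?thesis by (simp only: weight_def power_mult_distrib)
qed

definition diag_const :: real where "diag_const = weight_const * (202 * (1 / (1 - 3 * q)))"
definition diff_const :: real where "diff_const = weight_const * (100000 * (1 / (1 - (9/25) / (3 * q)) + 1 / (1 - 3 * q)))"

lemma diag_bound:
  assumes x: "x \<in> gasket" shows "(\<Sum>j<N. (weight j * Phi j x)\<^sup>2) \<le> diag_const"
proof -
  obtain M where "(\<Sum>j<N. lam j powr (- (2 * s)) * (Phi j x)\<^sup>2) \<le> weight_const * (\<Sum>n\<le>M. q ^ n * (202 * 3 ^ n))"
    using weighted_sum_le[of "\<lambda>j. (Phi j x)\<^sup>2" "\<lambda>n. 202 * 3 ^ n" N] spectral_sum_diag[OF _ _ x] by auto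
  also have "(\<Sum>n\<le>M. q ^ n * (202 * 3 ^ n)) = 202 * (\<Sum>n\<le>M. (3 * q) ^ n)"
    by (simp add: sum_distrib_left power_mult_distrib mult_ac)
  also have "weight_const * \<dots> \<le> diag_const" unfolding diag_const_def
    using q_pos q_less by (intro mult_left_mono[OF _ weight_const_nonneg] mult_left_mono sum_power_le_geometric) auto
  finally show ?thesis by (simp add: weight_sq)
qed

lemma diff_bound:
  assumes xy: "same_cell m x y" shows "(\<Sum>j<N. (weight j * Phi j x - weight j * Phi j y)\<^sup>2) \<le> diff_const * (3 * q) ^ m"
proof -
  let ?b = "\<lambda>n. 100000 * 3 ^ n * (if n \<le> m then (9/25) ^ (m - n) else 1)"
  obtain M where "(\<Sum>j<N. lam j powr (- (2 * s)) * (Phi j x - Phi j y)\<^sup>2) \<le> weight_const * (\<Sum>n\<le>M. q ^ n * ?b n)"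
    using weighted_sum_le[of "\<lambda>j. (Phi j x - Phi j y)\<^sup>2" ?b N] spectral_sum_diff[OF _ _ xy] by auto
  also have "(\<Sum>n\<le>M. q ^ n * ?b n) = 100000 * (\<Sum>n\<le>M. (3 * q) ^ n * (if n \<le> m then (9/25) ^ (m - n) else 1))"
    by (simp only: sum_distrib_left power_mult_distrib mult_ac)
  also have "weight_const * \<dots> \<le> weight_const * (100000 * ((3 * q) ^ m * (1 / (1 - (9/25) / (3 * q)) + 1 / (1 - 3 * q))))"
    by (intro mult_left_mono[OF _ weight_const_nonneg] mult_left_mono sum_two_sided) (use q_less q_gr in auto)
  also have "\<dots> = diff_const * (3 * q) ^ m" by (simp only: diff_const_def mult_ac)
  finally show ?thesis by (simp only: right_diff_distrib[symmetric] weight_sq)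
qed

lemma diff_const_nonneg: "0 \<le> diff_const"
proof -
  have "0 \<le> 1 / (1 - (9/25) / (3 * q)) + 1 / (1 - 3 * q)" using q_less q_gr q_pos by (intro add_nonneg_nonneg) (auto simp: field_simps)
  then show ?thesis unfolding diff_const_def using weight_const_nonneg by simp
qed

end

section \<open>Continuous paths from vertex increments\<close>

text \<open>A total function, so that the field can be defined for every outcome; it is only meaningful when the
increments of \<open>g\<close> along the edges decay.\<close>

definition spline_limit :: "(complex \<Rightarrow> real) \<Rightarrow> complex \<Rightarrow> real" where
  "spline_limit g x = lim (\<lambda>n. spline n g x)"

locale vertex_increments =
  fixes g :: "complex \<Rightarrow> real" and C r :: real
  assumes r: "0 \<le> r" "r < 1"
    and incr: "\<And>n w i j. w \<in> gasket_words n \<Longrightarrow> i \<in> I3 \<Longrightarrow> j \<in> I3 \<Longrightarrow>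
      \<bar>g (gasket_word_map w (corner i)) - g (gasket_word_map w (corner j))\<bar> \<le> C * r ^ n"
begin

lemma C_nonneg: "0 \<le> C"
  using incr[of "[]" 0 1 1] by (simp add: gasket_words_0)

lemma spline_near_vertex:
  assumes "w \<in> gasket_words n" "y \<in> gasket" "i \<in> I3"
  shows "\<bar>spline n g (gasket_word_map w y) - g (gasket_word_map w (corner i))\<bar> \<le> C * r ^ n"
proof -
  let ?v = "\<lambda>j. g (gasket_word_map w (corner j))"
  have "spline n g (gasket_word_map w y) - ?v i = (\<Sum>j\<in>I3. ?v j * harm_coord j y) - ?v i * (\<Sum>j\<in>I3. harm_coord j y)"
    by (simp only: spline_word_map[OF assms(1,2)] harm_coord_sum[OF assms(2)] mult_1_right)
  also have "\<dots> = (\<Sum>j\<in>I3. (?v j - ?v i) * harm_coord j y)"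
    by (simp only: sum_distrib_left sum_subtractf[symmetric] left_diff_distrib)
  also have "\<bar>\<dots>\<bar> \<le> C * r ^ n"
    by (rule harm_coord_convex_bound[OF assms(2) incr[OF assms(1) _ assms(3)]])
  finally show ?thesis .
qed

text \<open>A point lies in a cell of level \<open>n\<close> and in one of its children. Both contain the same corner, and
each spline is close to \<open>g\<close> at that corner.\<close>

lemma spline_step:
  assumes "x \<in> gasket" shows "\<bar>spline (Suc n) g x - spline n g x\<bar> \<le> 2 * C * r ^ n"
proof -
  obtain v y where v: "v \<in> gasket_words (Suc n)" "y \<in> gasket" "x = gasket_word_map v y" using gasket_cover[OF assms] by blast
  obtain u l where u: "u \<in> gasket_words n" "l \<in> I3" "v = u @ [l]" using gasket_words_snoc[OF v(1)] .
  have e: "gasket_word_map v (corner l) = gasket_word_map u (corner l)"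
    unfolding u(3) gasket_word_map_append by (simp only: gasket_word_map_Cons gasket_word_map_Nil gasket_map_corner)
  have x: "x = gasket_word_map u (gasket_map l y)" unfolding v(3) u(3) gasket_word_map_append by simp
  have "\<bar>spline (Suc n) g x - g (gasket_word_map u (corner l))\<bar> \<le> C * r ^ Suc n"
    using spline_near_vertex[OF v(1,2) u(2)] unfolding e v(3) .
  moreover have "\<bar>spline n g x - g (gasket_word_map u (corner l))\<bar> \<le> C * r ^ n"
    unfolding x by (rule spline_near_vertex[OF u(1) gasket_map_in[OF v(2) u(2)] u(2)])
  moreover have "C * r ^ Suc n \<le> C * r ^ n"
    using C_nonneg r by (intro mult_left_mono power_decreasing) auto
  ultimately show ?thesis by linarith
qed

lemma spline_uniform_limit: "uniform_limit gasket (\<lambda>n. spline n g) (spline_limit g) sequentially"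
proof -
  have "uniform_limit gasket (\<lambda>n x. \<Sum>i<n. spline (Suc i) g x - spline i g x)
      (\<lambda>x. \<Sum>i. spline (Suc i) g x - spline i g x) sequentially"
  proof (rule Weierstrass_m_test)
    show "norm (spline (Suc n) g x - spline n g x) \<le> 2 * C * r ^ n" if "x \<in> gasket" for n x
      using spline_step[OF that] by simp
    show "summable (\<lambda>n. 2 * C * r ^ n)" using r by (intro summable_mult summable_geometric) simp
  qed
  moreover have "(\<Sum>i<n. spline (Suc i) g x - spline i g x) = spline n g x - spline 0 g x" for n x
    using sum_lessThan_telescope[of "\<lambda>i. spline i g x" n] .
  ultimately have "uniform_limit gasket (\<lambda>n x. spline n g x - spline 0 g x)
      (\<lambda>x. \<Sum>i. spline (Suc i) g x - spline i g x) sequentially" by (simp only:)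
  from uniform_limit_add[OF uniform_limit_const this, of "spline 0 g"]
  have u: "uniform_limit gasket (\<lambda>n x. spline 0 g x + (spline n g x - spline 0 g x))
      (\<lambda>x. spline 0 g x + (\<Sum>i. spline (Suc i) g x - spline i g x)) sequentially" .
  then have u': "uniform_limit gasket (\<lambda>n. spline n g)
      (\<lambda>x. spline 0 g x + (\<Sum>i. spline (Suc i) g x - spline i g x)) sequentially" by simp
  have "spline_limit g x = spline 0 g x + (\<Sum>i. spline (Suc i) g x - spline i g x)" if "x \<in> gasket" for x
    unfolding spline_limit_def using tendsto_uniform_limitI[OF u' that] by (rule limI)
  then show ?thesis by (intro uniform_limit_cong'[THEN iffD2, OF refl _ u'])
qed

lemma spline_limit_tendsto: "x \<in> gasket \<Longrightarrow> (\<lambda>n. spline n g x) \<longlonglongrightarrow> spline_limit g x"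
  using tendsto_uniform_limitI[OF spline_uniform_limit] .

lemma continuous_on_spline_limit: "continuous_on gasket (spline_limit g)"
  by (rule uniform_limit_theorem[OF _ spline_uniform_limit]) (auto intro!: always_eventually continuous_on_spline)

lemma spline_limit_vertex:
  assumes w: "w \<in> gasket_words k" and i: "i \<in> I3"
  shows "spline_limit g (gasket_word_map w (corner i)) = g (gasket_word_map w (corner i))"
proof -
  have e: "gasket_word_map (replicate m i) (corner i) = corner i" for m
    by (induction m) (simp_all only: replicate.simps gasket_word_map_Nil gasket_word_map_Cons gasket_map_corner)
  have "spline n g (gasket_word_map w (corner i)) = g (gasket_word_map w (corner i))" if "n \<ge> k" for n
  proof -
    have rep: "replicate (n - k) i \<in> gasket_words (n - k)" using i by (auto simp: gasket_words_def)
    have wn: "w @ replicate (n - k) i \<in> gasket_words n" using gasket_words_append[OF w rep] that by simp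
    have x: "gasket_word_map (w @ replicate (n - k) i) (corner i) = gasket_word_map w (corner i)"
      by (simp only: gasket_word_map_append e)
    have "spline n g (gasket_word_map w (corner i)) =
        (\<Sum>j\<in>I3. g (gasket_word_map (w @ replicate (n - k) i) (corner j)) * harm_coord j (corner i))"
      using spline_word_map[OF wn corner_in_gasket[OF i], of g] unfolding x .
    also have "\<dots> = (\<Sum>j\<in>I3. if j = i then g (gasket_word_map (w @ replicate (n - k) i) (corner j)) else 0)"
      by (rule sum.cong[OF refl]) (simp only: harm_coord_corner i, simp)
    also have "\<dots> = g (gasket_word_map w (corner i))" by (simp only: sum_I3_delta[OF i] x)
    finally show ?thesis .
  qed
  then have "(\<lambda>n. spline n g (gasket_word_map w (corner i))) \<longlonglongrightarrow> g (gasket_word_map w (corner i))"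
    by (intro tendsto_eventually) (auto simp: eventually_sequentially)
  then show ?thesis unfolding spline_limit_def by (rule limI)
qed

lemma spline_limit_cell_osc: assumes "same_cell n x y" shows "\<bar>spline_limit g x - spline_limit g y\<bar> \<le> 2 * (C * r ^ n) / (1 - r)"
proof -
  obtain w x' y' where w: "w \<in> gasket_words n" "x' \<in> gasket" "y' \<in> gasket"
    "x = gasket_word_map w x'" "y = gasket_word_map w y'" using assms unfolding same_cell_def by blast
  show ?thesis unfolding w(4,5)
  proof (rule vertex_osc_imp_cell_osc[OF continuous_on_spline_limit r w(1) _ w(2,3)])
    fix k v i j assume v: "v \<in> gasket_words k" and ij: "i \<in> I3" "j \<in> I3"
    note wv = gasket_words_append[OF w(1) v]
    show "\<bar>spline_limit g (gasket_word_map (w @ v) (corner i)) - spline_limit g (gasket_word_map (w @ v) (corner j))\<bar> \<le> C * r ^ n * r ^ k"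
      using incr[OF wv ij] unfolding spline_limit_vertex[OF wv ij(1)] spline_limit_vertex[OF wv ij(2)] power_add by (simp only: mult.assoc)
  qed
qed

text \<open>The cell estimate is applied twice, from each point to the intermediate point of \<open>gasket_chain\<close>.\<close>

lemma spline_limit_holder:
  assumes b: "0 < \<beta>" "r = (1/2) powr \<beta>" shows "holder_on gasket \<beta> (spline_limit g)"
  unfolding holder_on_def
proof (intro exI ballI)
  fix x y assume xy: "x \<in> gasket" "y \<in> gasket"
  let ?K = "4 * C / (1 - r) * 4 powr \<beta>"
  show "\<bar>spline_limit g x - spline_limit g y\<bar> \<le> ?K * dist x y powr \<beta>"
  proof (cases "x = y")
    case False
    have one: "\<bar>spline_limit g a - spline_limit g b\<bar> \<le> 2 * C / (1 - r) * (4 * dist x y) powr \<beta>"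
      if "same_cell m a b" "(1/2) ^ m \<le> 4 * dist x y" for m a b
    proof -
      have "r ^ m = ((1/2) ^ m) powr \<beta>"
      proof -
        have "r ^ m = (1/2) powr (\<beta> * m)" unfolding b(2) by (simp add: powr_power mult.commute)
        also have "\<dots> = ((1/2) powr m) powr \<beta>" by (simp only: powr_powr mult.commute)
        finally show ?thesis by (simp add: powr_realpow)
      qed
      also have "\<dots> \<le> (4 * dist x y) powr \<beta>" using that(2) b(1) by (intro powr_mono2) auto
      finally have "r ^ m \<le> (4 * dist x y) powr \<beta>" .
      then have "2 * C / (1 - r) * r ^ m \<le> 2 * C / (1 - r) * (4 * dist x y) powr \<beta>"
        using C_nonneg r by (intro mult_left_mono) auto
      then show ?thesis using spline_limit_cell_osc[OF that(1)] by simp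
    qed
    obtain p m n where p: "p \<in> gasket" "same_cell m x p" "(1/2) ^ m \<le> 4 * dist x y"
      "same_cell n y p" "(1/2) ^ n \<le> 4 * dist x y"
      using gasket_chain[OF xy False] by blast
    have "\<bar>spline_limit g x - spline_limit g y\<bar> \<le> 2 * (2 * C / (1 - r) * (4 * dist x y) powr \<beta>)"
      using one[OF p(2,3)] one[OF p(4,5)] by linarith
    also have "\<dots> = ?K * dist x y powr \<beta>" by (simp add: powr_mult)
    finally show ?thesis .
  qed simp
qed

end

subsection \<open>Splines as finite sums over vertices\<close>

definition vertices :: "nat \<Rightarrow> complex set" where
  "vertices n = (\<lambda>(w, j). gasket_word_map w (corner j)) ` (gasket_words n \<times> I3)"

lemma finite_vertices: "finite (vertices n)"
  unfolding vertices_def by (intro finite_imageI finite_cartesian_product) auto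

lemma vertices_in_gasket: "p \<in> vertices n \<Longrightarrow> p \<in> gasket"
proof -
  assume "p \<in> vertices n"
  then obtain w j where "w \<in> gasket_words n" "j \<in> I3" "p = gasket_word_map w (corner j)"
    unfolding vertices_def by (auto simp del: insert_iff)
  then show "p \<in> gasket" using gasket_word_map_in[OF corner_in_gasket] by metis
qed

text \<open>Separates the random values from the deterministic functions, for joint measurability.\<close>

lemma spline_vertex_sum:
  assumes "x \<in> gasket" shows "spline n g x = (\<Sum>p\<in>vertices n. g p * spline n (indicator {p}) x)"
proof -
  obtain w y where w: "w \<in> gasket_words n" "y \<in> gasket" "x = gasket_word_map w y" using gasket_cover[OF assms] by blast
  let ?v = "\<lambda>j. gasket_word_map w (corner j)"
  have v: "?v j \<in> vertices n" if "j \<in> I3" for j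
    unfolding vertices_def using w(1) that by (intro image_eqI[of _ _ "(w, j)"]) (simp_all del: insert_iff)
  have "(\<Sum>p\<in>vertices n. g p * spline n (indicator {p}) x) = (\<Sum>p\<in>vertices n. \<Sum>j\<in>I3. g p * (indicator {p} (?v j) * harm_coord j y))"
    unfolding w(3) by (simp only: spline_word_map[OF w(1,2)] sum_distrib_left)
  also have "\<dots> = (\<Sum>j\<in>I3. \<Sum>p\<in>vertices n. if p = ?v j then g p * harm_coord j y else 0)"
    by (subst sum.swap) (intro sum.cong refl, auto simp: indicator_def)
  also have "\<dots> = (\<Sum>j\<in>I3. g (?v j) * harm_coord j y)"
    by (rule sum.cong[OF refl]) (use v finite_vertices in \<open>simp only: sum.delta if_True\<close>)
  finally show ?thesis unfolding w(3) by (simp only: spline_word_map[OF w(1,2)])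
qed

section \<open>The random field\<close>

text \<open>The relation between \<open>q\<close> and \<open>H\<close> is \<open>3 * 5\<^sup>-\<^sup>2\<^sup>s = 2\<^sup>-\<^sup>2\<^sup>H\<close>, so that variances of increments in cells of
level \<open>m\<close> are of order \<open>2\<^sup>-\<^sup>2\<^sup>H\<^sup>m\<close>.\<close>

locale white_noise_field = spectral_weights lam Phi s q for lam Phi s q +
  fixes M :: "'w measure" and W :: "(complex \<Rightarrow> real) \<Rightarrow> 'w \<Rightarrow> real" and H :: real
  assumes white_noise: "gasket_white_noise M W" and q_H: "3 * q = 2 powr (- (2 * H))"

sublocale white_noise_field \<subseteq> P: prob_space M
  using white_noise by (simp add: gasket_white_noise_def)

context white_noise_field
begin

lemma W_gaussian: assumes "f \<in> gasket_L2_0" shows "gaussian_rv M (W f)"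
proof -
  have "gaussian_family M gasket_L2_0 W" using white_noise unfolding gasket_white_noise_def by (elim conjE)
  then have "finite {f} \<and> {f} \<subseteq> gasket_L2_0 \<longrightarrow> gaussian_rv M (\<lambda>\<omega>. \<Sum>i\<in>{f}. 1 * W i \<omega>)"
    unfolding gaussian_family_def by (elim allE)
  then show ?thesis using assms by simp
qed

lemma W_meas: "f \<in> gasket_L2_0 \<Longrightarrow> W f \<in> borel_measurable M"
  using W_gaussian gaussian_rv_meas by blast

lemma W_sqint: "f \<in> gasket_L2_0 \<Longrightarrow> sqint M (W f)"
  using W_gaussian P.gaussian_rv_sqint by blast

lemma W_mean: "f \<in> gasket_L2_0 \<Longrightarrow> (\<integral>\<omega>. W f \<omega> \<partial>M) = 0"
  using white_noise by (simp add: gasket_white_noise_def)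

lemma W_var: "f \<in> gasket_L2_0 \<Longrightarrow> (\<integral>\<omega>. (W f \<omega>)\<^sup>2 \<partial>M) = gasket_inner f f"
  using white_noise by (simp add: gasket_white_noise_def power2_eq_square)

lemma W_lincomb:
  "f \<in> gasket_L2_0 \<Longrightarrow> g \<in> gasket_L2_0 \<Longrightarrow> AE \<omega> in M. W (\<lambda>x. a * f x + b * g x) \<omega> = a * W f \<omega> + b * W g \<omega>"
  using white_noise by (simp add: gasket_white_noise_def)

lemma W_diff: "f \<in> gasket_L2_0 \<Longrightarrow> g \<in> gasket_L2_0 \<Longrightarrow> AE \<omega> in M. W (\<lambda>x. f x - g x) \<omega> = W f \<omega> - W g \<omega>"
  using W_lincomb[of f g 1 "-1"] by simp

lemma W_zero: "AE \<omega> in M. W (\<lambda>x. 0) \<omega> = 0"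
  using W_lincomb[OF gasket_L2_0_zero gasket_L2_0_zero, of 0 0] by simp

lemma W_sum:
  "finite J \<Longrightarrow> (\<And>j. j \<in> J \<Longrightarrow> F j \<in> gasket_L2_0) \<Longrightarrow>
    AE \<omega> in M. W (\<lambda>x. \<Sum>j\<in>J. c j * F j x) \<omega> = (\<Sum>j\<in>J. c j * W (F j) \<omega>)"
proof (induction J rule: finite_induct)
  case (insert j J)
  have "AE \<omega> in M. W (\<lambda>x. c j * F j x + 1 * (\<Sum>j\<in>J. c j * F j x)) \<omega> = c j * W (F j) \<omega> + 1 * W (\<lambda>x. \<Sum>j\<in>J. c j * F j x) \<omega>"
    using insert by (intro W_lincomb gasket_L2_0_sum) auto
  moreover have "AE \<omega> in M. W (\<lambda>x. \<Sum>j\<in>J. c j * F j x) \<omega> = (\<Sum>j\<in>J. c j * W (F j) \<omega>)" using insert by auto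
  ultimately show ?case by eventually_elim (use insert in simp)
qed (simp add: W_zero)

text \<open>The kernel \<open>G\<^sub>x\<close> of \<open>(-\<Delta>)\<^sup>-\<^sup>s\<close>; its coefficients are square summable by \<open>diag_bound\<close>.\<close>

definition riesz_kernel :: "complex \<Rightarrow> complex \<Rightarrow> real" where
  "riesz_kernel x = (SOME g. expands (\<lambda>j. weight j * Phi j x) g)"

lemma riesz_kernel_expands: assumes "x \<in> gasket" shows "expands (\<lambda>j. weight j * Phi j x) (riesz_kernel x)"
proof -
  have "summable (\<lambda>j. (weight j * Phi j x)\<^sup>2)"
    by (rule summableI_nonneg_bounded[OF _ diag_bound[OF assms]]) simp
  from expands_exists[OF this] show ?thesis unfolding riesz_kernel_def by (rule someI_ex)
qed

lemma riesz_kernel_L2_0: "x \<in> gasket \<Longrightarrow> riesz_kernel x \<in> gasket_L2_0"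
  using riesz_kernel_expands by (simp add: expands_def)

lemma riesz_kernel_norm: assumes "x \<in> gasket" shows "gasket_inner (riesz_kernel x) (riesz_kernel x) \<le> diag_const"
  using expands_parseval[OF riesz_kernel_expands[OF assms]] diag_bound[OF assms]
  unfolding sums_def by (intro LIMSEQ_le_const2) auto

lemma same_cell_in_gasket: assumes "same_cell m x y" shows "x \<in> gasket" "y \<in> gasket"
  using assms gasket_word_map_in unfolding same_cell_def by blast+

lemma riesz_kernel_diff_norm:
  assumes "same_cell m x y"
  shows "gasket_inner (\<lambda>z. riesz_kernel x z - riesz_kernel y z) (\<lambda>z. riesz_kernel x z - riesz_kernel y z) \<le> diff_const * (3 * q) ^ m"
proof -
  note K = same_cell_in_gasket[OF assms]
  note lim = expands_parseval[OF expands_diff[OF riesz_kernel_expands[OF K(1)] riesz_kernel_expands[OF K(2)]], unfolded sums_def]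
  show ?thesis by (rule LIMSEQ_le_const2[OF lim]) (use diff_bound[OF assms] in blast)
qed

definition raw_field :: "complex \<Rightarrow> 'w \<Rightarrow> real" where "raw_field x = W (riesz_kernel x)"

lemma raw_field_meas: "x \<in> gasket \<Longrightarrow> raw_field x \<in> borel_measurable M"
  unfolding raw_field_def by (intro W_meas riesz_kernel_L2_0)

lemma raw_field_diff:
  assumes "x \<in> gasket" "y \<in> gasket"
  shows "gaussian_rv M (\<lambda>\<omega>. raw_field x \<omega> - raw_field y \<omega>)" "(\<integral>\<omega>. raw_field x \<omega> - raw_field y \<omega> \<partial>M) = 0"
    "(\<integral>\<omega>. (raw_field x \<omega> - raw_field y \<omega>)\<^sup>2 \<partial>M) = gasket_inner (\<lambda>z. riesz_kernel x z - riesz_kernel y z) (\<lambda>z. riesz_kernel x z - riesz_kernel y z)"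
proof -
  let ?D = "\<lambda>z. riesz_kernel x z - riesz_kernel y z"
  have D: "?D \<in> gasket_L2_0" using assms by (intro gasket_L2_0_diff riesz_kernel_L2_0)
  have ae: "AE \<omega> in M. W ?D \<omega> = raw_field x \<omega> - raw_field y \<omega>" unfolding raw_field_def using assms by (intro W_diff riesz_kernel_L2_0)
  have m: "(\<lambda>\<omega>. raw_field x \<omega> - raw_field y \<omega>) \<in> borel_measurable M" using assms by (intro borel_measurable_diff raw_field_meas)
  show "gaussian_rv M (\<lambda>\<omega>. raw_field x \<omega> - raw_field y \<omega>)" by (rule gaussian_rv_cong_AE[OF W_gaussian[OF D] m ae])
  have "(\<integral>\<omega>. W ?D \<omega> \<partial>M) = (\<integral>\<omega>. raw_field x \<omega> - raw_field y \<omega> \<partial>M)"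
    by (rule integral_cong_AE[OF W_meas[OF D] m ae])
  then show "(\<integral>\<omega>. raw_field x \<omega> - raw_field y \<omega> \<partial>M) = 0" using W_mean[OF D] by simp
  have "(\<integral>\<omega>. (W ?D \<omega>)\<^sup>2 \<partial>M) = (\<integral>\<omega>. (raw_field x \<omega> - raw_field y \<omega>)\<^sup>2 \<partial>M)"
    by (rule integral_cong_AE) (use W_meas[OF D] m ae in auto)
  then show "(\<integral>\<omega>. (raw_field x \<omega> - raw_field y \<omega>)\<^sup>2 \<partial>M) = gasket_inner ?D ?D" using W_var[OF D] by simp
qed

lemma raw_field_moment:
  assumes xy: "same_cell m x y"
  shows "integrable M (\<lambda>\<omega>. (raw_field x \<omega> - raw_field y \<omega>) ^ (2 * k))"
    "(\<integral>\<omega>. (raw_field x \<omega> - raw_field y \<omega>) ^ (2 * k) \<partial>M) \<le> fact (2 * k) / (2 ^ k * fact k) * (diff_const * (3 * q) ^ m) ^ k"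
proof -
  note K = same_cell_in_gasket[OF xy]
  note D = P.gaussian_rv_moment[OF raw_field_diff(1,2)[OF K], of k]
  show "integrable M (\<lambda>\<omega>. (raw_field x \<omega> - raw_field y \<omega>) ^ (2 * k))" by (rule D(1))
  have "gasket_inner (\<lambda>z. riesz_kernel x z - riesz_kernel y z) (\<lambda>z. riesz_kernel x z - riesz_kernel y z) ^ k \<le> (diff_const * (3 * q) ^ m) ^ k"
    using riesz_kernel_diff_norm[OF xy] by (intro power_mono) (auto simp: gasket_inner_def power2_eq_square[symmetric])
  then show "(\<integral>\<omega>. (raw_field x \<omega> - raw_field y \<omega>) ^ (2 * k) \<partial>M) \<le> fact (2 * k) / (2 ^ k * fact k) * (diff_const * (3 * q) ^ m) ^ k"
    unfolding D(2) raw_field_diff(3)[OF K] by (intro mult_left_mono) auto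
qed

lemma raw_field_L1:
  assumes xy: "same_cell m x y"
  shows "(\<integral>\<omega>. \<bar>raw_field x \<omega> - raw_field y \<omega>\<bar> \<partial>M) \<le> sqrt (diff_const * (3 * q) ^ m)"
proof -
  note K = same_cell_in_gasket[OF xy]
  have "(\<integral>\<omega>. \<bar>raw_field x \<omega> - raw_field y \<omega>\<bar> \<partial>M) \<le> sqrt (\<integral>\<omega>. (raw_field x \<omega> - raw_field y \<omega>)\<^sup>2 \<partial>M)"
    by (rule P.sqint_abs_le[OF P.gaussian_rv_sqint[OF raw_field_diff(1)[OF K]]])
  also have "\<dots> \<le> sqrt (diff_const * (3 * q) ^ m)" unfolding raw_field_diff(3)[OF K] using riesz_kernel_diff_norm[OF xy] by simp
  finally show ?thesis .
qed

lemma vertex_same_cell: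
  "w \<in> gasket_words n \<Longrightarrow> i \<in> I3 \<Longrightarrow> j \<in> I3 \<Longrightarrow> same_cell n (gasket_word_map w (corner i)) (gasket_word_map w (corner j))"
  unfolding same_cell_def using corner_in_gasket by blast

text \<open>Kolmogorov's argument. There are \<open>9 * 3\<^sup>n\<close> pairs of vertices in the cells of level \<open>n\<close>, and the
\<open>2k\<close>-th moment of an increment times \<open>2\<^sup>\<beta>\<^sup>n\<close> is of order \<open>t\<^sup>k\<^sup>n\<close> with \<open>t = 2\<^sup>2\<^sup>\<beta>\<^sup>-\<^sup>2\<^sup>H < 1\<close>. For large \<open>k\<close> the
expectations are summable over all pairs, and a finite total bounds every single increment.\<close>

lemma vertex_increments_AE:
  assumes \<beta>: "0 < \<beta>" "\<beta> < H"
  shows "AE \<omega> in M. \<exists>C. vertex_increments (\<lambda>p. raw_field p \<omega>) C ((1/2) powr \<beta>)"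
proof -
  define b where "b = 2 powr \<beta>"
  have b: "0 < b" by (simp add: b_def)
  define t where "t = b\<^sup>2 * (3 * q)"
  have "t = 2 powr (2 * \<beta> - 2 * H)"
    unfolding t_def b_def q_H by (simp add: power2_eq_square flip: powr_add)
  also have "\<dots> < 2 powr 0" using \<beta> by (intro powr_less_mono) auto
  finally have t1: "t < 1" by simp
  have t0: "0 < t" using b q_pos by (simp add: t_def)
  have "(\<lambda>k. t ^ k) \<longlonglongrightarrow> 0" using t0 t1 by (intro LIMSEQ_power_zero) simp
  then have "\<forall>\<^sub>F k in sequentially. t ^ k < 1/3" by (rule order_tendstoD) simp
  then obtain k0 where k0: "\<And>k. k \<ge> k0 \<Longrightarrow> t ^ k < 1/3" by (auto simp: eventually_sequentially)
  define k where "k = Suc k0"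
  have k: "3 * t ^ k < 1" "k \<ge> 1" using k0[of k] by (auto simp: k_def)
  define D where "D w i j \<omega> = raw_field (gasket_word_map w (corner i)) \<omega> - raw_field (gasket_word_map w (corner j)) \<omega>" for w i j \<omega>
  define F where "F n \<omega> = (\<Sum>w\<in>gasket_words n. \<Sum>i\<in>I3. \<Sum>j\<in>I3. (b ^ n * D w i j \<omega>) ^ (2 * k))" for n \<omega>
  define c where "c = fact (2 * k) / (2 ^ k * fact k) * diff_const ^ k"
  have c0: "0 \<le> c" using diff_const_nonneg by (simp add: c_def)
  have ev: "0 \<le> (x::real) ^ (2 * k)" for x by (simp add: power_mult)
  have F0: "0 \<le> F n \<omega>" for n \<omega> unfolding F_def by (intro sum_nonneg ev)
  have Dint: "integrable M (\<lambda>\<omega>. (b ^ n * D w i j \<omega>) ^ (2 * k))"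
    and Dle: "(\<integral>\<omega>. (b ^ n * D w i j \<omega>) ^ (2 * k) \<partial>M) \<le> c * (t ^ k) ^ n"
    if "w \<in> gasket_words n" "i \<in> I3" "j \<in> I3" for w i j n
  proof -
    note mom = raw_field_moment[OF vertex_same_cell[OF that], of k]
    show "integrable M (\<lambda>\<omega>. (b ^ n * D w i j \<omega>) ^ (2 * k))"
      unfolding power_mult_distrib D_def by (intro integrable_mult_right mom(1))
    have "(\<integral>\<omega>. (b ^ n * D w i j \<omega>) ^ (2 * k) \<partial>M) \<le> (b ^ n) ^ (2 * k) * (fact (2 * k) / (2 ^ k * fact k) * (diff_const * (3 * q) ^ n) ^ k)"
      unfolding power_mult_distrib D_def integral_mult_right_zero using b
      by (intro mult_left_mono[OF mom(2)[unfolded power_mult_distrib]]) auto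
    also have "\<dots> = c * (t ^ k) ^ n"
    proof -
      have e: "(b ^ n) ^ (2 * k) = ((b\<^sup>2) ^ k) ^ n" "((3 * q) ^ n) ^ k = ((3 * q) ^ k) ^ n"
        by (simp_all only: power_mult[symmetric] mult_ac)
      show ?thesis unfolding c_def t_def power_mult_distrib[of diff_const] power_mult_distrib[of "b\<^sup>2"] e
        by (simp only: power_mult_distrib mult_ac)
    qed
    finally show "(\<integral>\<omega>. (b ^ n * D w i j \<omega>) ^ (2 * k) \<partial>M) \<le> c * (t ^ k) ^ n" .
  qed
  have Fint: "integrable M (F n)" for n unfolding F_def
    by (intro Bochner_Integration.integrable_sum Dint)
  have Fle: "(\<integral>\<omega>. F n \<omega> \<partial>M) \<le> 9 * c * (3 * t ^ k) ^ n" for n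
  proof -
    have "(\<integral>\<omega>. F n \<omega> \<partial>M) = (\<Sum>w\<in>gasket_words n. \<Sum>i\<in>I3. \<Sum>j\<in>I3. \<integral>\<omega>. (b ^ n * D w i j \<omega>) ^ (2 * k) \<partial>M)"
      unfolding F_def
      by (subst Bochner_Integration.integral_sum, intro Bochner_Integration.integrable_sum Dint, assumption+,
          rule sum.cong[OF refl], subst Bochner_Integration.integral_sum,
          intro Bochner_Integration.integrable_sum Dint, assumption+, rule sum.cong[OF refl],
          subst Bochner_Integration.integral_sum, intro Dint, assumption+, rule refl)
    also have "\<dots> \<le> (\<Sum>w\<in>gasket_words n. \<Sum>i\<in>I3. \<Sum>j\<in>I3. c * (t ^ k) ^ n)"
      by (intro sum_mono Dle)
    also have "\<dots> = 9 * c * (3 * t ^ k) ^ n" by (simp add: card_gasket_words power_mult_distrib)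
    finally show ?thesis .
  qed
  have summ: "summable (\<lambda>n. 9 * c * (3 * t ^ k) ^ n)" using k(1) t0 by (intro summable_mult summable_geometric) simp
  have Fm: "(\<lambda>\<omega>. ennreal (F n \<omega>)) \<in> borel_measurable M" for n using Fint[of n] by auto
  have "(\<integral>\<^sup>+\<omega>. (\<Sum>n. ennreal (F n \<omega>)) \<partial>M) = (\<Sum>n. \<integral>\<^sup>+\<omega>. ennreal (F n \<omega>) \<partial>M)"
    by (rule nn_integral_suminf[OF Fm])
  also have "\<dots> \<le> (\<Sum>n. ennreal (9 * c * (3 * t ^ k) ^ n))"
  proof (rule suminf_le)
    fix n
    have "(\<integral>\<^sup>+\<omega>. ennreal (F n \<omega>) \<partial>M) = ennreal (\<integral>\<omega>. F n \<omega> \<partial>M)"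
      by (rule nn_integral_eq_integral[OF Fint]) (simp add: F0)
    also have "\<dots> \<le> ennreal (9 * c * (3 * t ^ k) ^ n)" by (rule ennreal_leI[OF Fle])
    finally show "(\<integral>\<^sup>+\<omega>. ennreal (F n \<omega>) \<partial>M) \<le> ennreal (9 * c * (3 * t ^ k) ^ n)" .
  qed simp_all
  also have "\<dots> < \<infinity>"
  proof -
    have "0 \<le> 9 * c * (3 * t ^ k) ^ n" for n using c0 t0 by (intro mult_nonneg_nonneg zero_le_power) auto
    from suminf_ennreal2[OF this summ] show ?thesis by (simp only: infinity_ennreal_def ennreal_less_top)
  qed
  finally have "AE \<omega> in M. (\<Sum>n. ennreal (F n \<omega>)) \<noteq> \<infinity>"
    by (intro nn_integral_noteq_infinite) (use Fm in auto)
  then show ?thesis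
  proof eventually_elim
    fix \<omega> assume fin: "(\<Sum>n. ennreal (F n \<omega>)) \<noteq> \<infinity>"
    then obtain S where S: "0 \<le> S" "(\<Sum>n. ennreal (F n \<omega>)) = ennreal S"
      by (metis ennreal_cases infinity_ennreal_def)
    have Fn: "F n \<omega> \<le> S" for n
    proof -
      have "ennreal (F n \<omega>) \<le> ennreal S" unfolding S(2)[symmetric] using sum_le_suminf[of "\<lambda>n. ennreal (F n \<omega>)" "{n}"] by simp
      then show ?thesis using S(1) by simp
    qed
    \<comment> \<open>A number greater than 1 is at most its \<open>2k\<close>-th power, so no root of \<open>S\<close> is needed.\<close>
    have "vertex_increments (\<lambda>p. raw_field p \<omega>) (max 1 S) ((1/2) powr \<beta>)"
    proof
      show "(1/2) powr \<beta> < 1" using \<beta>(1) powr_less_mono'[of "1/2" 0 \<beta>] by simp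
      fix n w i j assume A: "w \<in> gasket_words n" "i \<in> I3" "j \<in> I3"
      let ?d = "b ^ n * D w i j \<omega>"
      have "?d ^ (2 * k) \<le> (\<Sum>j\<in>I3. (b ^ n * D w i j \<omega>) ^ (2 * k))" by (rule member_le_sum[OF A(3)]) (auto simp: ev)
      also have "\<dots> \<le> (\<Sum>i\<in>I3. \<Sum>j\<in>I3. (b ^ n * D w i j \<omega>) ^ (2 * k))"
        by (rule member_le_sum[OF A(2)]) (auto intro!: sum_nonneg simp: ev)
      also have "\<dots> \<le> F n \<omega>" unfolding F_def by (rule member_le_sum[OF A(1)]) (auto intro!: sum_nonneg simp: ev)
      also have "\<dots> \<le> S" by (rule Fn)
      finally have le: "\<bar>?d\<bar> ^ (2 * k) \<le> S" by (simp add: power_even_abs)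
      have "\<bar>?d\<bar> \<le> max 1 S"
      proof (cases "\<bar>?d\<bar> \<le> 1")
        case False
        then have "\<bar>?d\<bar> ^ 1 \<le> \<bar>?d\<bar> ^ (2 * k)" using k(2) by (intro power_increasing) auto
        then show ?thesis using le by simp
      qed simp
      then have "\<bar>D w i j \<omega>\<bar> \<le> max 1 S * (1 / b ^ n)" using b by (simp add: abs_mult field_simps)
      also have "1 / b ^ n = ((1/2) powr \<beta>) ^ n"
        unfolding b_def by (simp add: powr_divide power_divide)
      finally show "\<bar>raw_field (gasket_word_map w (corner i)) \<omega> - raw_field (gasket_word_map w (corner j)) \<omega>\<bar> \<le> max 1 S * ((1/2) powr \<beta>) ^ n"
        unfolding D_def .
    qed simp
    then show "\<exists>C. vertex_increments (\<lambda>p. raw_field p \<omega>) C ((1/2) powr \<beta>)" by blast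
  qed
qed

lemma H_pos: "0 < H"
proof (rule ccontr)
  assume "\<not> 0 < H"
  then have "1 \<le> 2 powr (- (2 * H))" by (intro ge_one_powr_ge_zero) auto
  then show False using q_less q_H by simp
qed

text \<open>Defined through the values at vertices, of which there are countably many, to obtain continuous paths
and joint measurability.\<close>

definition field :: "complex \<Rightarrow> 'w \<Rightarrow> real" where "field x \<omega> = spline_limit (\<lambda>p. raw_field p \<omega>) x"

lemma field_good_AE: "AE \<omega> in M. \<exists>C. vertex_increments (\<lambda>p. raw_field p \<omega>) C ((1/2) powr (H / 2))"
  using vertex_increments_AE[of "H / 2"] H_pos by simp

lemma field_cont_AE: "AE \<omega> in M. continuous_on gasket (\<lambda>x. field x \<omega>)"
  using field_good_AE by eventually_elim (auto simp: field_def dest: vertex_increments.continuous_on_spline_limit)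

lemma field_limit_AE: "AE \<omega> in M. \<forall>x\<in>gasket. (\<lambda>n. spline n (\<lambda>p. raw_field p \<omega>) x) \<longlonglongrightarrow> field x \<omega>"
  using field_good_AE by eventually_elim (auto simp: field_def dest: vertex_increments.spline_limit_tendsto)

text \<open>The exceptional set must not depend on the exponent: countably many exponents increasing to \<open>H\<close> are
used, and a faster decay of the increments implies a slower one.\<close>

lemma field_holder_AE: "AE \<omega> in M. \<forall>\<epsilon>. 0 < \<epsilon> \<and> \<epsilon> < H \<longrightarrow> holder_on gasket (H - \<epsilon>) (\<lambda>x. field x \<omega>)"
proof -
  define \<beta> where "\<beta> n = H - H / (real n + 2)" for n :: nat
  have \<beta>: "0 < \<beta> n" "\<beta> n < H" for n using H_pos by (auto simp: \<beta>_def field_simps intro: add_pos_nonneg)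
  have "AE \<omega> in M. \<forall>n. \<exists>C. vertex_increments (\<lambda>p. raw_field p \<omega>) C ((1/2) powr \<beta> n)"
    unfolding AE_all_countable using vertex_increments_AE[OF \<beta>] by blast
  then show ?thesis
  proof eventually_elim
    fix \<omega> assume all: "\<forall>n. \<exists>C. vertex_increments (\<lambda>p. raw_field p \<omega>) C ((1/2) powr \<beta> n)"
    show "\<forall>\<epsilon>. 0 < \<epsilon> \<and> \<epsilon> < H \<longrightarrow> holder_on gasket (H - \<epsilon>) (\<lambda>x. field x \<omega>)"
    proof (intro allI impI)
      fix \<epsilon> assume \<epsilon>: "0 < \<epsilon> \<and> \<epsilon> < H"
      obtain n :: nat where n: "H / \<epsilon> < real n" using reals_Archimedean2 by blast
      have "H / (real n + 2) \<le> \<epsilon>" using n \<epsilon> by (simp add: field_simps)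
      then have le: "H - \<epsilon> \<le> \<beta> n" by (simp add: \<beta>_def)
      obtain C where "vertex_increments (\<lambda>p. raw_field p \<omega>) C ((1/2) powr \<beta> n)" using all by blast
      then interpret V: vertex_increments "\<lambda>p. raw_field p \<omega>" C "(1/2) powr \<beta> n" .
      have r: "(1/2::real) powr \<beta> n \<le> (1/2) powr (H - \<epsilon>)" using le by (intro powr_mono') auto
      interpret V2: vertex_increments "\<lambda>p. raw_field p \<omega>" C "(1/2) powr (H - \<epsilon>)"
      proof
        show "(1/2::real) powr (H - \<epsilon>) < 1" using \<epsilon> powr_less_mono'[of "1/2" 0 "H - \<epsilon>"] by simp
        fix m w i j assume A: "w \<in> gasket_words m" "i \<in> I3" "j \<in> I3"
        have "C * ((1/2) powr \<beta> n) ^ m \<le> C * ((1/2) powr (H - \<epsilon>)) ^ m"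
          by (intro mult_left_mono power_mono r V.C_nonneg) simp
        then show "\<bar>raw_field (gasket_word_map w (corner i)) \<omega> - raw_field (gasket_word_map w (corner j)) \<omega>\<bar> \<le> C * ((1/2) powr (H - \<epsilon>)) ^ m"
          using V.incr[OF A] by linarith
      qed simp
      show "holder_on gasket (H - \<epsilon>) (\<lambda>x. field x \<omega>)"
        unfolding field_def using V2.spline_limit_holder[of "H - \<epsilon>"] \<epsilon> by simp
    qed
  qed
qed

lemma spline_raw_field_meas: "x \<in> gasket \<Longrightarrow> (\<lambda>\<omega>. spline n (\<lambda>p. raw_field p \<omega>) x) \<in> borel_measurable M"
  using raw_field_meas[OF vertices_in_gasket] by (subst spline_vertex_sum) auto

lemma field_meas: "x \<in> gasket \<Longrightarrow> field x \<in> borel_measurable M"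
  unfolding field_def[abs_def] spline_limit_def using spline_raw_field_meas by (intro borel_measurable_lim_metric)

lemma field_joint_meas: "(\<lambda>(\<omega>, x). field x \<omega>) \<in> borel_measurable (M \<Otimes>\<^sub>M gasket_measure)"
proof -
  have "(\<lambda>z. spline n (\<lambda>p. raw_field p (fst z)) (snd z)) \<in> borel_measurable (M \<Otimes>\<^sub>M gasket_measure)" for n
  proof -
    have "(\<lambda>z. \<Sum>p\<in>vertices n. raw_field p (fst z) * spline n (indicator {p}) (snd z)) \<in> borel_measurable (M \<Otimes>\<^sub>M gasket_measure)"
      by (intro borel_measurable_sum borel_measurable_times measurable_compose[OF measurable_fst] measurable_compose[OF measurable_snd]
          raw_field_meas vertices_in_gasket continuous_borel_gasket continuous_on_spline)
    then show ?thesis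
      by (subst measurable_cong[OF spline_vertex_sum]) (auto simp: space_pair_measure)
  qed
  then show ?thesis unfolding field_def spline_limit_def case_prod_beta by (intro borel_measurable_lim_metric)
qed

text \<open>The splines through the values of \<open>raw_field\<close> converge almost surely to \<open>field\<close> and in \<open>L\<^sup>1\<close> to \<open>raw_field\<close>,
since all vertices of the cell of \<open>x\<close> are close to \<open>x\<close> in mean.\<close>

lemma field_modification: assumes x: "x \<in> gasket" shows "AE \<omega> in M. field x \<omega> = raw_field x \<omega>"
proof -
  have rep: "\<exists>w y. w \<in> gasket_words n \<and> y \<in> gasket \<and> x = gasket_word_map w y" for n using gasket_cover[OF x] by blast
  have key: "integrable M (\<lambda>\<omega>. spline n (\<lambda>p. raw_field p \<omega>) x - raw_field x \<omega>) \<and>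
    (\<integral>\<omega>. \<bar>spline n (\<lambda>p. raw_field p \<omega>) x - raw_field x \<omega>\<bar> \<partial>M) \<le> sqrt (diff_const * (3 * q) ^ n)" for n
  proof -
    obtain w y where w: "w \<in> gasket_words n" "y \<in> gasket" "x = gasket_word_map w y" using rep by blast
    let ?v = "\<lambda>j. gasket_word_map w (corner j)"
    have sc: "same_cell n (?v j) x" if "j \<in> I3" for j
      unfolding same_cell_def w(3) using w(1,2) corner_in_gasket[OF that] by blast
    have e: "spline n (\<lambda>p. raw_field p \<omega>) x - raw_field x \<omega> = (\<Sum>j\<in>I3. (raw_field (?v j) \<omega> - raw_field x \<omega>) * harm_coord j y)" for \<omega>
    proof -
      have "spline n (\<lambda>p. raw_field p \<omega>) x - raw_field x \<omega> = (\<Sum>j\<in>I3. raw_field (?v j) \<omega> * harm_coord j y) - raw_field x \<omega> * (\<Sum>j\<in>I3. harm_coord j y)"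
        unfolding w(3) by (simp only: spline_word_map[OF w(1,2)] harm_coord_sum[OF w(2)] mult_1_right)
      then show ?thesis by (simp only: sum_distrib_left sum_subtractf[symmetric] left_diff_distrib)
    qed
    have i: "integrable M (\<lambda>\<omega>. (raw_field (?v j) \<omega> - raw_field x \<omega>))" if "j \<in> I3" for j
      by (rule P.sqint_integrable[OF P.gaussian_rv_sqint[OF raw_field_diff(1)[OF same_cell_in_gasket[OF sc[OF that]]]]])
    have int: "integrable M (\<lambda>\<omega>. spline n (\<lambda>p. raw_field p \<omega>) x - raw_field x \<omega>)" unfolding e
      by (intro Bochner_Integration.integrable_sum integrable_mult_left i)
    have i2: "integrable M (\<lambda>\<omega>. \<bar>raw_field (?v j) \<omega> - raw_field x \<omega>\<bar> * harm_coord j y)" if "j \<in> I3" for j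
      by (intro integrable_mult_left integrable_abs i that)
    have "(\<integral>\<omega>. \<bar>spline n (\<lambda>p. raw_field p \<omega>) x - raw_field x \<omega>\<bar> \<partial>M) \<le> (\<integral>\<omega>. (\<Sum>j\<in>I3. \<bar>raw_field (?v j) \<omega> - raw_field x \<omega>\<bar> * harm_coord j y) \<partial>M)"
    proof (rule integral_mono)
      show "integrable M (\<lambda>\<omega>. \<bar>spline n (\<lambda>p. raw_field p \<omega>) x - raw_field x \<omega>\<bar>)" by (intro integrable_abs int)
      show "integrable M (\<lambda>\<omega>. \<Sum>j\<in>I3. \<bar>raw_field (?v j) \<omega> - raw_field x \<omega>\<bar> * harm_coord j y)"
        by (intro Bochner_Integration.integrable_sum i2)
      show "\<bar>spline n (\<lambda>p. raw_field p \<omega>) x - raw_field x \<omega>\<bar> \<le> (\<Sum>j\<in>I3. \<bar>raw_field (?v j) \<omega> - raw_field x \<omega>\<bar> * harm_coord j y)" for \<omega>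
        unfolding e by (rule order_trans[OF sum_abs])
          (intro sum_mono, simp only: abs_mult abs_of_nonneg[OF harm_coord_nonneg[OF _ w(2)]] order_refl)
    qed
    also have "\<dots> = (\<Sum>j\<in>I3. (\<integral>\<omega>. \<bar>raw_field (?v j) \<omega> - raw_field x \<omega>\<bar> \<partial>M) * harm_coord j y)"
      by (subst Bochner_Integration.integral_sum[OF i2]) (simp_all only: integral_mult_left_zero)
    also have "\<dots> \<le> (\<Sum>j\<in>I3. sqrt (diff_const * (3 * q) ^ n) * harm_coord j y)"
      by (intro sum_mono mult_right_mono raw_field_L1 sc harm_coord_nonneg w(2))
    also have "\<dots> = sqrt (diff_const * (3 * q) ^ n)" by (simp only: sum_distrib_left[symmetric] harm_coord_sum[OF w(2)] mult_1_right)
    finally show ?thesis using int by blast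
  qed
  have lim0: "(\<lambda>n. sqrt (diff_const * (3 * q) ^ n)) \<longlonglongrightarrow> 0"
  proof -
    have "norm (3 * q) < 1" using q_pos q_less by simp
    then have "(\<lambda>n. (3 * q) ^ n) \<longlonglongrightarrow> 0" by (rule LIMSEQ_power_zero)
    then have "(\<lambda>n. sqrt (diff_const * (3 * q) ^ n)) \<longlonglongrightarrow> sqrt (diff_const * 0)"
      by (intro tendsto_real_sqrt tendsto_mult tendsto_const)
    then show ?thesis by simp
  qed
  show ?thesis
  proof (rule AE_limit_eq_L1_limit[OF _ spline_raw_field_meas[OF x] field_meas[OF x] raw_field_meas[OF x] _ _ lim0])
    show "AE \<omega> in M. (\<lambda>n. spline n (\<lambda>p. raw_field p \<omega>) x) \<longlonglongrightarrow> field x \<omega>"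
      using field_limit_AE by eventually_elim (use x in blast)
  qed (use key in blast)+
qed

lemma field_gaussian: "gaussian_family M gasket field"
  unfolding gaussian_family_def
proof (intro allI impI)
  fix J c assume J: "finite J \<and> J \<subseteq> gasket"
  let ?h = "\<lambda>z. \<Sum>x\<in>J. c x * riesz_kernel x z"
  have GJ: "\<And>x. x \<in> J \<Longrightarrow> riesz_kernel x \<in> gasket_L2_0" using J riesz_kernel_L2_0 by blast
  have "gaussian_rv M (W ?h)" using J GJ by (intro W_gaussian gasket_L2_0_sum) auto
  moreover have "(\<lambda>\<omega>. \<Sum>x\<in>J. c x * field x \<omega>) \<in> borel_measurable M"
    using J field_meas by (intro borel_measurable_sum borel_measurable_times) auto
  moreover have "AE \<omega> in M. W ?h \<omega> = (\<Sum>x\<in>J. c x * field x \<omega>)"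
  proof -
    have "AE \<omega> in M. \<forall>x\<in>J. field x \<omega> = raw_field x \<omega>" using J field_modification by (intro AE_finite_allI) auto
    moreover have "AE \<omega> in M. W ?h \<omega> = (\<Sum>x\<in>J. c x * W (riesz_kernel x) \<omega>)" using J GJ by (intro W_sum) auto
    ultimately show ?thesis by eventually_elim (simp add: raw_field_def)
  qed
  ultimately show "gaussian_rv M (\<lambda>\<omega>. \<Sum>x\<in>J. c x * field x \<omega>)" by (rule gaussian_rv_cong_AE)
qed

section \<open>The fractional equation\<close>

definition partial_field :: "nat \<Rightarrow> complex \<Rightarrow> 'w \<Rightarrow> real" where
  "partial_field N x \<omega> = (\<Sum>j<N. weight j * Phi j x * W (Phi j) \<omega>)"

lemma W_Phi_meas [measurable]: "W (Phi j) \<in> borel_measurable M"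
  by (rule W_meas[OF Phi_L2_0])

text \<open>At a fixed point the remainder of the field is almost surely the noise applied to the remainder of
the kernel. The uniform bound serves as the dominating function below.\<close>

lemma remainder_bound:
  assumes x: "x \<in> gasket"
  defines "\<rho> \<equiv> \<lambda>N. \<integral>z. (riesz_kernel x z - eigensum {..<N} (\<lambda>j. weight j * Phi j x) z)\<^sup>2 \<partial>gasket_measure"
  shows "(\<integral>\<^sup>+\<omega>. ennreal \<bar>field x \<omega> - partial_field N x \<omega>\<bar> \<partial>M) \<le> ennreal (sqrt (\<rho> N))"
    and "\<rho> \<longlonglongrightarrow> 0" and "\<rho> N \<le> 4 * diag_const"
proof -
  let ?a = "\<lambda>j. weight j * Phi j x"
  have L: "eigensum {..<N} ?a \<in> gasket_L2_0" by (rule eigensum_L2_0) simp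
  let ?R = "\<lambda>z. riesz_kernel x z - eigensum {..<N} ?a z"
  have R: "?R \<in> gasket_L2_0" by (intro gasket_L2_0_diff riesz_kernel_L2_0 x L)
  have "AE \<omega> in M. W (eigensum {..<N} ?a) \<omega> = partial_field N x \<omega>"
    using W_sum[of "{..<N}" Phi ?a] Phi_L2_0 unfolding eigensum_def[abs_def] partial_field_def by simp
  with W_diff[OF riesz_kernel_L2_0[OF x] L] field_modification[OF x]
  have ae: "AE \<omega> in M. W ?R \<omega> = field x \<omega> - partial_field N x \<omega>" by eventually_elim (simp add: raw_field_def)
  have "(\<integral>\<^sup>+\<omega>. ennreal \<bar>field x \<omega> - partial_field N x \<omega>\<bar> \<partial>M) = (\<integral>\<^sup>+\<omega>. ennreal \<bar>W ?R \<omega>\<bar> \<partial>M)"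
    using ae by (intro nn_integral_cong_AE) (auto elim: eventually_mono)
  also have "\<dots> = ennreal (\<integral>\<omega>. \<bar>W ?R \<omega>\<bar> \<partial>M)"
    by (intro nn_integral_eq_integral integrable_abs P.sqint_integrable W_sqint R) simp
  also have "\<dots> \<le> ennreal (sqrt (\<integral>\<omega>. (W ?R \<omega>)\<^sup>2 \<partial>M))" by (intro ennreal_leI P.sqint_abs_le W_sqint R)
  finally show "(\<integral>\<^sup>+\<omega>. ennreal \<bar>field x \<omega> - partial_field N x \<omega>\<bar> \<partial>M) \<le> ennreal (sqrt (\<rho> N))"
    unfolding W_var[OF R] by (simp add: \<rho>_def gasket_inner_def power2_eq_square)
  show "\<rho> \<longlonglongrightarrow> 0" unfolding \<rho>_def by (rule expands_limit[OF riesz_kernel_expands[OF x]])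
  have Gs: "sqint gasket_measure (riesz_kernel x)" and Ls: "sqint gasket_measure (eigensum {..<N} ?a)"
    using riesz_kernel_L2_0[OF x] L by (auto simp: gasket_L2_0_iff)
  have "\<rho> N \<le> (\<integral>z. 2 * (riesz_kernel x z)\<^sup>2 + 2 * (eigensum {..<N} ?a z)\<^sup>2 \<partial>gasket_measure)"
    unfolding \<rho>_def
  proof (rule integral_mono)
    show "integrable gasket_measure (\<lambda>z. (?R z)\<^sup>2)" by (rule sqint_sq[OF sqint_diff[OF Gs Ls]])
    show "integrable gasket_measure (\<lambda>z. 2 * (riesz_kernel x z)\<^sup>2 + 2 * (eigensum {..<N} ?a z)\<^sup>2)"
      using sqint_sq[OF Gs] sqint_sq[OF Ls] by simp
    show "(p - r)\<^sup>2 \<le> 2 * p\<^sup>2 + 2 * r\<^sup>2" for p r :: real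
      using zero_le_power2[of "p + r"] by (simp add: power2_eq_square algebra_simps)
  qed
  also have "\<dots> = 2 * gasket_inner (riesz_kernel x) (riesz_kernel x) + 2 * (\<Sum>j<N. (?a j)\<^sup>2)"
    using sqint_sq[OF Gs] sqint_sq[OF Ls] by (simp add: eigensum_norm gasket_inner_def flip: power2_eq_square)
  also have "\<dots> \<le> 4 * diag_const" using riesz_kernel_norm[OF x] diag_bound[OF x, of N] by simp
  finally show "\<rho> N \<le> 4 * diag_const" .
qed

lemma weight_inverse: "weight j * lam j powr s = 1"
  using lam_pos[of j] by (simp add: weight_def flip: powr_add)

text \<open>Both \<open>\<integral> F X d\<mu>\<close> and \<open>W(f)\<close> are the \<open>L\<^sup>1\<close>-limit of the partial sums \<open>\<Sum>\<^sub>j\<^sub><\<^sub>N \<langle>f, \<Phi>\<^sub>j\<rangle> W(\<Phi>\<^sub>j)\<close>.\<close>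

lemma fractional_equation:
  assumes f: "f \<in> frac_laplacian_domain lam Phi s"
  shows "AE \<omega> in M. has_bochner_integral gasket_measure (\<lambda>x. frac_laplacian lam Phi s f x * field x \<omega>) (W f \<omega>)"
proof -
  define F where "F = frac_laplacian lam Phi s f"
  define fj where "fj j = gasket_inner f (Phi j)" for j
  have f0: "f \<in> gasket_L2_0" using f by (simp add: frac_laplacian_domain_def)
  have Fexp: "expands (\<lambda>j. lam j powr s * fj j) F"
    unfolding F_def fj_def by (rule frac_laplacian_expands[OF f])
  have Fs: "sqint gasket_measure F" using Fexp by (simp add: expands_def gasket_L2_0_iff)
  have Fi: "integrable gasket_measure F" by (rule gm.sqint_integrable[OF Fs])
  have Fm [measurable]: "F \<in> borel_measurable gasket_measure" by (rule sqint_meas[OF Fs])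
  have field_m [measurable]: "(\<lambda>(\<omega>, x). field x \<omega>) \<in> borel_measurable (M \<Otimes>\<^sub>M gasket_measure)" by (rule field_joint_meas)
  have partial_field_m [measurable]: "(\<lambda>(\<omega>, x). partial_field N x \<omega>) \<in> borel_measurable (M \<Otimes>\<^sub>M gasket_measure)" for N
    unfolding partial_field_def by measurable
  interpret pair_sigma_finite M gasket_measure
    by (intro pair_sigma_finite.intro P.sigma_finite_measure_axioms gm.sigma_finite_measure_axioms)
  define Y where "Y \<omega> = (\<integral>x. F x * field x \<omega> \<partial>gasket_measure)" for \<omega>
  define WN where "WN N \<omega> = (\<Sum>j<N. fj j * W (Phi j) \<omega>)" for N \<omega>
  have Ym [measurable]: "Y \<in> borel_measurable M"
    unfolding Y_def by (rule gm.borel_measurable_lebesgue_integral) measurable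
  have WNm [measurable]: "WN N \<in> borel_measurable M" for N unfolding WN_def by measurable
  have Wfm [measurable]: "W f \<in> borel_measurable M" by (rule W_meas[OF f0])
  have int_cont: "integrable gasket_measure (\<lambda>x. F x * h x)" if h: "continuous_on gasket h" for h
  proof -
    obtain B where B: "B \<ge> 0" "\<And>x. x \<in> gasket \<Longrightarrow> \<bar>h x\<bar> \<le> B" using continuous_gasket_bounded[OF h] by metis
    have [measurable]: "h \<in> borel_measurable gasket_measure" by (rule continuous_borel_gasket[OF h])
    have "integrable gasket_measure (\<lambda>x. B * F x)" using Fi by simp
    then show ?thesis
      by (rule Bochner_Integration.integrable_bound)
        (auto simp: abs_mult mult.commute[of _ "\<bar>F _\<bar>"] B intro!: mult_left_mono)
  qed
  have partial_field_cont: "continuous_on gasket (\<lambda>x. partial_field N x \<omega>)" for N \<omega>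
    unfolding partial_field_def by (intro continuous_intros Phi_cont)
  \<comment> \<open>The factors \<open>\<lambda>\<^sub>j\<^sup>-\<^sup>s\<close> of the field and \<open>\<lambda>\<^sub>j\<^sup>s\<close> of \<open>F\<close> cancel.\<close>
  have WN: "(\<integral>x. F x * partial_field N x \<omega> \<partial>gasket_measure) = WN N \<omega>" for N \<omega>
  proof -
    have "(\<integral>x. F x * partial_field N x \<omega> \<partial>gasket_measure) = (\<integral>x. (\<Sum>j<N. weight j * W (Phi j) \<omega> * (F x * Phi j x)) \<partial>gasket_measure)"
      by (simp add: partial_field_def sum_distrib_left mult_ac)
    also have "\<dots> = (\<Sum>j<N. weight j * W (Phi j) \<omega> * gasket_inner F (Phi j))"
      using int_cont[OF Phi_cont] by (subst Bochner_Integration.integral_sum) (auto simp: gasket_inner_def)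
    also have "\<dots> = WN N \<omega>" unfolding WN_def
    proof (rule sum.cong[OF refl])
      fix j
      have "weight j * W (Phi j) \<omega> * gasket_inner F (Phi j) = (weight j * lam j powr s) * (fj j * W (Phi j) \<omega>)"
        by (simp add: expands_coeff[OF Fexp])
      then show "weight j * W (Phi j) \<omega> * gasket_inner F (Phi j) = fj j * W (Phi j) \<omega>" by (simp add: weight_inverse)
    qed
    finally show ?thesis .
  qed
  define err where "err N = (\<integral>\<^sup>+\<omega>. (\<integral>\<^sup>+x. ennreal \<bar>F x\<bar> * ennreal \<bar>field x \<omega> - partial_field N x \<omega>\<bar> \<partial>gasket_measure) \<partial>M)" for N
  have YWN: "(\<integral>\<^sup>+\<omega>. ennreal \<bar>Y \<omega> - WN N \<omega>\<bar> \<partial>M) \<le> err N" for N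
    unfolding err_def
  proof (rule nn_integral_mono_AE)
    show "AE \<omega> in M. ennreal \<bar>Y \<omega> - WN N \<omega>\<bar> \<le> (\<integral>\<^sup>+x. ennreal \<bar>F x\<bar> * ennreal \<bar>field x \<omega> - partial_field N x \<omega>\<bar> \<partial>gasket_measure)"
      using field_cont_AE
    proof eventually_elim
      fix \<omega> assume c: "continuous_on gasket (\<lambda>x. field x \<omega>)"
      have c': "continuous_on gasket (\<lambda>x. field x \<omega> - partial_field N x \<omega>)" by (intro continuous_intros c partial_field_cont)
      have "Y \<omega> - WN N \<omega> = (\<integral>x. F x * (field x \<omega> - partial_field N x \<omega>) \<partial>gasket_measure)"
        unfolding Y_def WN[symmetric] using int_cont[OF c] int_cont[OF partial_field_cont] by (simp add: right_diff_distrib)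
      then have "\<bar>Y \<omega> - WN N \<omega>\<bar> \<le> (\<integral>x. \<bar>F x * (field x \<omega> - partial_field N x \<omega>)\<bar> \<partial>gasket_measure)" by simp
      then have "ennreal \<bar>Y \<omega> - WN N \<omega>\<bar> \<le> ennreal (\<integral>x. \<bar>F x * (field x \<omega> - partial_field N x \<omega>)\<bar> \<partial>gasket_measure)" by (rule ennreal_leI)
      also have "\<dots> = (\<integral>\<^sup>+x. ennreal \<bar>F x * (field x \<omega> - partial_field N x \<omega>)\<bar> \<partial>gasket_measure)"
        by (intro nn_integral_eq_integral[symmetric] integrable_abs int_cont[OF c']) simp
      finally show "ennreal \<bar>Y \<omega> - WN N \<omega>\<bar> \<le> (\<integral>\<^sup>+x. ennreal \<bar>F x\<bar> * ennreal \<bar>field x \<omega> - partial_field N x \<omega>\<bar> \<partial>gasket_measure)"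
        by (simp add: abs_mult ennreal_mult)
    qed
  qed
  have err0: "err \<longlonglongrightarrow> 0"
  proof -
    define hN where "hN N x = (\<integral>\<^sup>+\<omega>. ennreal \<bar>F x\<bar> * ennreal \<bar>field x \<omega> - partial_field N x \<omega>\<bar> \<partial>M)" for N x
    have hm: "hN N \<in> borel_measurable gasket_measure" for N
      unfolding hN_def by measurable
    have e: "err N = (\<integral>\<^sup>+x. hN N x \<partial>gasket_measure)" for N
      unfolding err_def hN_def by (rule Fubini'[symmetric]) measurable
    define \<rho> where "\<rho> x N = (\<integral>z. (riesz_kernel x z - eigensum {..<N} (\<lambda>j. weight j * Phi j x) z)\<^sup>2 \<partial>gasket_measure)" for x N
    have h: "hN N x \<le> ennreal (\<bar>F x\<bar> * sqrt (\<rho> x N))" if x: "x \<in> gasket" for N x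
    proof -
      have [measurable]: "field x \<in> borel_measurable M" by (rule field_meas[OF x])
      have [measurable]: "partial_field N x \<in> borel_measurable M" unfolding partial_field_def by measurable
      have "hN N x = ennreal \<bar>F x\<bar> * (\<integral>\<^sup>+\<omega>. ennreal \<bar>field x \<omega> - partial_field N x \<omega>\<bar> \<partial>M)"
        unfolding hN_def by (rule nn_integral_cmult) measurable
      also have "\<dots> \<le> ennreal \<bar>F x\<bar> * ennreal (sqrt (\<rho> x N))"
        unfolding \<rho>_def by (intro mult_left_mono remainder_bound(1)[OF x]) simp
      finally show ?thesis by (simp add: ennreal_mult')
    qed
    have "(\<lambda>N. \<integral>\<^sup>+x. hN N x \<partial>gasket_measure) \<longlonglongrightarrow> (\<integral>\<^sup>+x. 0 \<partial>gasket_measure)"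
    proof (rule nn_integral_dominated_convergence[where w = "\<lambda>x. ennreal (\<bar>F x\<bar> * sqrt (4 * diag_const))"])
      show "AE x in gasket_measure. hN N x \<le> ennreal (\<bar>F x\<bar> * sqrt (4 * diag_const))" for N
      proof (rule AE_I2)
        fix x assume "x \<in> space gasket_measure"
        then have x: "x \<in> gasket" by simp
        have "\<bar>F x\<bar> * sqrt (\<rho> x N) \<le> \<bar>F x\<bar> * sqrt (4 * diag_const)"
          unfolding \<rho>_def by (intro mult_left_mono real_sqrt_le_mono remainder_bound(3)[OF x]) simp
        then show "hN N x \<le> ennreal (\<bar>F x\<bar> * sqrt (4 * diag_const))" using h[OF x, of N] by (meson ennreal_leI order_trans)
      qed
      have "(\<integral>\<^sup>+x. ennreal (\<bar>F x\<bar> * sqrt (4 * diag_const)) \<partial>gasket_measure) = ennreal (\<integral>x. \<bar>F x\<bar> * sqrt (4 * diag_const) \<partial>gasket_measure)"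
      proof (rule nn_integral_eq_integral)
        show "integrable gasket_measure (\<lambda>x. \<bar>F x\<bar> * sqrt (4 * diag_const))" using Fi by simp
        have "0 \<le> diag_const" using diag_bound[OF corner_in_gasket[of 1], of 0] by simp
        then show "AE x in gasket_measure. 0 \<le> \<bar>F x\<bar> * sqrt (4 * diag_const)" by simp
      qed
      then show "(\<integral>\<^sup>+x. ennreal (\<bar>F x\<bar> * sqrt (4 * diag_const)) \<partial>gasket_measure) < \<infinity>" by simp
      show "AE x in gasket_measure. (\<lambda>N. hN N x) \<longlonglongrightarrow> 0"
      proof (rule AE_I2)
        fix x assume "x \<in> space gasket_measure"
        then have x: "x \<in> gasket" by simp
        have "(\<lambda>N. ennreal (\<bar>F x\<bar> * sqrt (\<rho> x N))) \<longlonglongrightarrow> ennreal (\<bar>F x\<bar> * sqrt 0)"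
          unfolding \<rho>_def by (intro tendsto_intros tendsto_ennrealI remainder_bound(2)[OF x])
        then have "(\<lambda>N. ennreal (\<bar>F x\<bar> * sqrt (\<rho> x N))) \<longlonglongrightarrow> 0" by simp
        from tendsto_sandwich[OF always_eventually always_eventually tendsto_const this]
        show "(\<lambda>N. hN N x) \<longlonglongrightarrow> 0" using h[OF x] by simp
      qed
    qed (use hm in auto)
    moreover have "err = (\<lambda>N. \<integral>\<^sup>+x. hN N x \<partial>gasket_measure)" by (rule ext) (rule e)
    ultimately show ?thesis by simp
  qed
  have fexp: "expands fj f" unfolding fj_def by (rule expands_L2_0[OF f0])
  define d where "d N = (\<integral>x. (f x - eigensum {..<N} fj x)\<^sup>2 \<partial>gasket_measure)" for N
  have d0: "d \<longlonglongrightarrow> 0" unfolding d_def by (rule expands_limit[OF fexp])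
  have WNf: "(\<integral>\<^sup>+\<omega>. ennreal \<bar>WN N \<omega> - W f \<omega>\<bar> \<partial>M) \<le> ennreal (sqrt (d N))" for N
  proof -
    have L: "eigensum {..<N} fj \<in> gasket_L2_0" by (rule eigensum_L2_0) simp
    let ?R = "\<lambda>z. f z - eigensum {..<N} fj z"
    have R: "?R \<in> gasket_L2_0" by (intro gasket_L2_0_diff f0 L)
    have "AE \<omega> in M. W (eigensum {..<N} fj) \<omega> = WN N \<omega>"
      using W_sum[of "{..<N}" Phi fj] Phi_L2_0 unfolding eigensum_def[abs_def] WN_def by simp
    with W_diff[OF f0 L] have ae: "AE \<omega> in M. W ?R \<omega> = W f \<omega> - WN N \<omega>" by eventually_elim simp
    have "(\<integral>\<^sup>+\<omega>. ennreal \<bar>WN N \<omega> - W f \<omega>\<bar> \<partial>M) = (\<integral>\<^sup>+\<omega>. ennreal \<bar>W ?R \<omega>\<bar> \<partial>M)"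
      using ae by (intro nn_integral_cong_AE) (auto elim!: eventually_mono simp: abs_minus_commute)
    also have "\<dots> = ennreal (\<integral>\<omega>. \<bar>W ?R \<omega>\<bar> \<partial>M)"
      by (intro nn_integral_eq_integral integrable_abs P.sqint_integrable W_sqint R) simp
    also have "\<dots> \<le> ennreal (sqrt (\<integral>\<omega>. (W ?R \<omega>)\<^sup>2 \<partial>M))" by (intro ennreal_leI P.sqint_abs_le W_sqint R)
    finally show ?thesis unfolding W_var[OF R] by (simp add: d_def gasket_inner_def power2_eq_square)
  qed
  have le: "(\<integral>\<^sup>+\<omega>. ennreal \<bar>Y \<omega> - W f \<omega>\<bar> \<partial>M) \<le> err N + ennreal (sqrt (d N))" for N
  proof -
    have "(\<integral>\<^sup>+\<omega>. ennreal \<bar>Y \<omega> - W f \<omega>\<bar> \<partial>M) \<le> (\<integral>\<^sup>+\<omega>. ennreal \<bar>Y \<omega> - WN N \<omega>\<bar> + ennreal \<bar>WN N \<omega> - W f \<omega>\<bar> \<partial>M)"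
      by (intro nn_integral_mono) (simp flip: ennreal_plus)
    also have "\<dots> = (\<integral>\<^sup>+\<omega>. ennreal \<bar>Y \<omega> - WN N \<omega>\<bar> \<partial>M) + (\<integral>\<^sup>+\<omega>. ennreal \<bar>WN N \<omega> - W f \<omega>\<bar> \<partial>M)"
      by (rule nn_integral_add) measurable
    also have "\<dots> \<le> err N + ennreal (sqrt (d N))" by (intro add_mono YWN WNf)
    finally show ?thesis .
  qed
  have "(\<lambda>N. err N + ennreal (sqrt (d N))) \<longlonglongrightarrow> 0 + ennreal (sqrt 0)"
    by (intro tendsto_intros tendsto_ennrealI err0 d0)
  then have "(\<lambda>N. err N + ennreal (sqrt (d N))) \<longlonglongrightarrow> 0" by simp
  then have "(\<integral>\<^sup>+\<omega>. ennreal \<bar>Y \<omega> - W f \<omega>\<bar> \<partial>M) \<le> 0" by (rule LIMSEQ_le_const) (use le in blast)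
  then have "(\<integral>\<^sup>+\<omega>. ennreal \<bar>Y \<omega> - W f \<omega>\<bar> \<partial>M) = 0" by simp
  then have "AE \<omega> in M. ennreal \<bar>Y \<omega> - W f \<omega>\<bar> = 0" by (subst (asm) nn_integral_0_iff_AE) measurable
  with field_cont_AE show ?thesis
  proof eventually_elim
    fix \<omega> assume c: "continuous_on gasket (\<lambda>x. field x \<omega>)" and z: "ennreal \<bar>Y \<omega> - W f \<omega>\<bar> = 0"
    have "\<bar>Y \<omega> - W f \<omega>\<bar> \<le> 0" using z by (simp add: ennreal_eq_0_iff)
    then have "Y \<omega> = W f \<omega>" by simp
    then show "has_bochner_integral gasket_measure (\<lambda>x. frac_laplacian lam Phi s f x * field x \<omega>) (W f \<omega>)"
      using has_bochner_integral_integrable[OF int_cont[OF c]] by (simp add: Y_def F_def)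
  qed
qed

end

lemma two_powr_log: "0 < (a::real) \<Longrightarrow> 2 powr (x * (ln a / ln 2)) = a powr x"
  by (simp add: powr_def)

theorem theorem1p1:
  fixes M :: "'w measure"
    and W :: "(complex \<Rightarrow> real) \<Rightarrow> 'w \<Rightarrow> real"
    and lam :: "nat \<Rightarrow> real"
    and Phi :: "nat \<Rightarrow> complex \<Rightarrow> real"
    and s H :: real
  assumes eigenbasis: "gasket_eigenbasis lam Phi"
    and white_noise: "gasket_white_noise M W"
    and s_lower: "gasket_dh / (2 * gasket_dw) < s"
    and s_upper: "s < 1 - gasket_dh / (2 * gasket_dw)"
    and H: "H = s * gasket_dw - gasket_dh / 2"
  shows "\<exists>X :: complex \<Rightarrow> 'w \<Rightarrow> real.
    gaussian_family M gasket X \<and>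
    (AE \<omega> in M. \<forall>\<epsilon>. 0 < \<epsilon> \<and> \<epsilon> < H \<longrightarrow> holder_on gasket (H - \<epsilon>) (\<lambda>x. X x \<omega>)) \<and>
    (\<forall>f\<in>frac_laplacian_domain lam Phi s. AE \<omega> in M.
       has_bochner_integral gasket_measure (\<lambda>x. frac_laplacian lam Phi s f x * X x \<omega>) (W f \<omega>))"
proof -
  \<comment> \<open>In terms of \<open>q\<close> the bounds on \<open>s\<close> read \<open>9/25 < 3 * q < 1\<close>, as \<open>d\<^sub>h/(2 d\<^sub>w) = ln 3 / ln 25\<close>.\<close>
  define q :: real where "q = 25 powr (- s)"
  have l2: "0 < ln (2::real)" and l5: "0 < ln (5::real)" by auto
  have ln25: "ln (25::real) = 2 * ln 5" using ln_realpow[of 5 2] by simp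
  have r: "gasket_dh / (2 * gasket_dw) = ln 3 / ln 25"
    using l2 l5 by (simp add: gasket_dh_def gasket_dw_def ln25)
  have q_ln: "ln (3 * q) = ln 3 - s * ln 25" by (simp add: q_def ln_mult ln_powr)
  have q0: "0 < 3 * q" by (simp add: q_def)
  have "ln 3 < s * ln 25" using s_lower l5 unfolding r by (simp add: divide_less_eq ln25)
  then have "ln (3 * q) < ln 1" unfolding q_ln by simp
  then have q1: "3 * q < 1" using q0 by (subst (asm) ln_less_cancel_iff) auto
  have "s * ln 25 < ln 25 - ln 3"
  proof -
    have "s * ln 25 < (1 - ln 3 / ln 25) * ln 25" using s_upper l5 unfolding r by (intro mult_strict_right_mono) (auto simp: ln25)
    then show ?thesis using l5 by (simp add: left_diff_distrib ln25)
  qed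
  moreover have "ln (9/25 :: real) = 2 * ln 3 - ln 25" using ln_realpow[of 3 2] by (simp add: ln_div)
  ultimately have "ln (9/25) < ln (3 * q)" unfolding q_ln by simp
  then have q2: "9/25 < 3 * q" using q0 by (subst (asm) ln_less_cancel_iff) auto
  have "- (2 * H) = (- 2 * s) * (ln 5 / ln 2) + 1 * (ln 3 / ln 2)"
    using H by (simp add: gasket_dh_def gasket_dw_def)
  then have "2 powr (- (2 * H)) = 5 powr (- 2 * s) * 3"
    using two_powr_log[of 5 "- 2 * s"] two_powr_log[of 3 1] by (simp only: powr_add) simp
  moreover have "q = 5 powr (- 2 * s)"
  proof -
    have "(25::real) = 5 powr 2" by simp
    then show ?thesis unfolding q_def by (simp only: powr_powr) simp
  qed
  ultimately have qH: "3 * q = 2 powr (- (2 * H))" by simp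
  interpret white_noise_field lam Phi s q M W H
    by unfold_locales (use eigenbasis white_noise q1 q2 qH in \<open>auto simp: q_def\<close>)
  show ?thesis using field_gaussian field_holder_AE fractional_equation by blast
qed

end
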